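(* Let $\tau$ be a similarity class type of size $n$ and define \[ f_\tau(u;t)=\prod_{(d,\lambda)\in\tau} f_\lambda(u^d;t^d)\in\mathbb{Z}[u,t] \] (product over the multiset with multiplicity). Then for every prime power $q$ and every matrix $T\in M_n(\mathbb{F}_q)$ of similarity class type $\tau$, one has $f_T(t)=f_\tau(q;t)$. In particular, for every $0\le j\le n$ there is a polynomial $X_j^\tau(u)\in\mathbb{Z}[u]$ such that $X_j^T=X_j^\tau(q)$ for all such $q$ and $T$.
   Context: For $T\in M_n(\mathbb{F}_q)$, let $X_j^T$ be the number of $j$-dimensional $T$-invariant subspaces of $\mathbb{F}_q^n$ and $f_T(t)=\sum_{j=0}^n X_j^T t^j$. Let $M_T$ be the $\mathbb{F}_q[t]$-module $\mathbb{F}_q^n$ with $t$ acting by $T$. For each monic irreducible $p\in\mathbb{F}_q[t]$, the $p$-primary component of $M_T$ is isomorphic to $\bigoplus_i \mathbb{F}_q[t]/(p^{\lambda_i})$ for a unique integer partition $\lambda=(\lambda_1\ge\lambda_2\ge\dots)$, denoted $c_T(p)$ (empty if the component is zero). A similarity class type of size $n$ is a multiset $\tau$ of pairs $(d,\lambda)$ with $d$ a positive integer and $\lambda$ a nonempty partition, such that $\sum_{(d,\lambda)\in\tau} d|\lambda|=n$ (with multiplicity). The similarity class type of $T$ is the multiset $\{(\deg p, c_T(p)) : p \text{ monic irreducible},\ c_T(p)\neq\emptyset\}$. For a partition $\lambda$, $f_\lambda(u;t)\in\mathbb{Z}[u,t]$ is the polynomial defined by $f_\emptyset=1$ and the recurrence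 $(t-1)f_\lambda(u;t)=t^{\lambda_1+1}u^{\sum_{j\ge2}\lambda_j}f_{(\lambda_2,\lambda_3,\dots)}(u;t/u)-f_{(\lambda_2,\lambda_3,\dots)}(u;tu)$; for each prime power $q$, $f_\lambda(q;t)$ is the invariant subspace generating function of the nilpotent matrix over $\mathbb{F}_q$ with Jordan block sizes the parts of $\lambda$. *)

theory Defs
  imports "HOL-Library.Cardinality" "Jordan_Normal_Form.Char_Poly" "Jordan_Normal_Form.VS_Connect"
begin

text \<open>A type \<open>'a\<close> of class \<open>{field, finite}\<close> plays the role of \<open>F_q\<close>, with \<open>q = CARD('a)\<close>.
  Elements of \<open>Z[u]\<close> are \<open>int poly\<close>; elements of \<open>Z[u,t] = Z[u][t]\<close> are \<open>int poly poly\<close>,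
  the outer variable being \<open>t\<close>.\<close>

section \<open>Invariant subspaces\<close>

definition invariant_subspaces :: "'a::field mat \<Rightarrow> 'a vec set set" where
  "invariant_subspaces T =
     {W. VectorSpace.subspace class_ring W (module_vec TYPE('a) (dim_row T)) \<and> (\<forall>w\<in>W. T *\<^sub>v w \<in> W)}"

definition num_invariant_subspaces :: "'a::field mat \<Rightarrow> nat \<Rightarrow> nat" where
  "num_invariant_subspaces T j =
     card {W \<in> invariant_subspaces T.
       vectorspace.dim class_ring ((module_vec TYPE('a) (dim_row T))\<lparr>carrier := W\<rparr>) = j}"

definition invariant_gf :: "'a::field mat \<Rightarrow> int poly" where
  "invariant_gf T = (\<Sum>j\<le>dim_row T. monom (int (num_invariant_subspaces T j)) j)"

section \<open>Similarity class types\<close>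

definition int_partition :: "nat list \<Rightarrow> bool" where
  "int_partition l \<longleftrightarrow> sorted_wrt (\<ge>) l \<and> 0 \<notin> set l"

definition class_type_of_size :: "nat \<Rightarrow> (nat \<times> nat list) multiset \<Rightarrow> bool" where
  "class_type_of_size n \<tau> \<longleftrightarrow>
     (\<forall>(d, l) \<in># \<tau>. d > 0 \<and> int_partition l \<and> l \<noteq> []) \<and> (\<Sum>(d, l) \<in># \<tau>. d * sum_list l) = n"

text \<open>The action \<open>f \<cdot> v = f(T) v\<close> on column vectors, and the resulting module \<open>M_T\<close>. The fields
  \<open>mult\<close> and \<open>one\<close> of the record are irrelevant for modules.\<close>

definition poly_act :: "'a::field mat \<Rightarrow> 'a poly \<Rightarrow> 'a vec \<Rightarrow> 'a vec" where
  "poly_act T f v =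
     finsum_vec TYPE('a) (dim_row T) (\<lambda>k. coeff f k \<cdot>\<^sub>v ((T ^\<^sub>m k) *\<^sub>v v)) {..degree f}"

definition mat_module :: "'a::field mat \<Rightarrow> ('a poly, 'a vec) module" where
  "mat_module T =
     \<lparr>carrier = carrier_vec (dim_row T), mult = undefined, one = undefined,
      zero = 0\<^sub>v (dim_row T), add = (+), smult = poly_act T\<rparr>"

definition primary_component ::
    "('a::field poly, 'm) module \<Rightarrow> 'a poly \<Rightarrow> ('a poly, 'm) module" where
  "primary_component M p =
     M\<lparr>carrier := {x \<in> carrier M. \<exists>k. (p ^ k) \<odot>\<^bsub>M\<^esub> x = \<zero>\<^bsub>M\<^esub>}\<rparr>"

text \<open>The module \<open>\<Oplus>\<^sub>i F[t]/(p^(l!i))\<close>. An element is the list of its components, each residue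
  class being represented by its reduced representative modulo \<open>p^(l!i)\<close>.\<close>

definition cyclic_sum :: "'a::field poly \<Rightarrow> nat list \<Rightarrow> ('a poly, 'a poly list) module" where
  "cyclic_sum p l =
     \<lparr>carrier = {gs. list_all2 (\<lambda>k g. g mod p ^ k = g) l gs}, mult = undefined, one = undefined,
      zero = replicate (length l) 0, add = map2 (+),
      smult = (\<lambda>f. map2 (\<lambda>k g. (f * g) mod p ^ k) l)\<rparr>"

definition module_isomorphic ::
    "('r, 'c) ring_scheme \<Rightarrow> ('r, 'm, 'd) module_scheme \<Rightarrow> ('r, 'n, 'e) module_scheme \<Rightarrow> bool" where
  "module_isomorphic R M N \<longleftrightarrow>
     (\<exists>h \<in> LinearCombinations.module_hom R M N. bij_betw h (carrier M) (carrier N))"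

definition primary_partition :: "'a::field mat \<Rightarrow> 'a poly \<Rightarrow> nat list" where
  "primary_partition T p =
     (THE l. int_partition l \<and>
        module_isomorphic class_ring (primary_component (mat_module T) p) (cyclic_sum p l))"

text \<open>Only finitely many \<open>p\<close> have a non-zero primary component, so \<open>mset_set\<close> is applied to a
  finite set.\<close>

definition similarity_class_type :: "'a::field mat \<Rightarrow> (nat \<times> nat list) multiset" where
  "similarity_class_type T =
     image_mset (\<lambda>p. (degree p, primary_partition T p))
       (mset_set {p. lead_coeff p = 1 \<and> irreducible p \<and> primary_partition T p \<noteq> []})"

section \<open>The polynomials \<open>f_\<lambda>(u;t)\<close> and \<open>f_\<tau>(u;t)\<close>\<close>

text \<open>\<open>homog m F\<close> is \<open>u^m F(u; t/u)\<close>, a polynomial when the degree of \<open>F\<close> in \<open>t\<close> is at most \<open>m\<close>;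
  \<open>scale_t F\<close> is \<open>F(u; t u)\<close>.\<close>

definition homog :: "nat \<Rightarrow> int poly poly \<Rightarrow> int poly poly" where
  "homog m F = (\<Sum>k\<le>m. monom (monom 1 (m - k) * coeff F k) k)"

definition scale_t :: "int poly poly \<Rightarrow> int poly poly" where
  "scale_t F = pcompose F (monom (monom 1 1) 1)"

text \<open>The division by \<open>t - 1\<close> is exact, see \<open>f_part_recurrence\<close> and \<open>eval_f_part_recurrence\<close>
  below.\<close>

fun f_part :: "nat list \<Rightarrow> int poly poly" where
  "f_part [] = 1"
| "f_part (a # l) =
     (monom 1 (a + 1) * homog (sum_list l) (f_part l) - scale_t (f_part l)) div [:-1, 1:]"

definition subst_pow :: "nat \<Rightarrow> int poly poly \<Rightarrow> int poly poly" where
  "subst_pow d F = pcompose (map_poly (\<lambda>c. pcompose c (monom 1 d)) F) (monom 1 d)"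

definition f_type :: "(nat \<times> nat list) multiset \<Rightarrow> int poly poly" where
  "f_type \<tau> = (\<Prod>(d, l) \<in># \<tau>. subst_pow d (f_part l))"

text \<open>\<open>specialize q F = F(q; t)\<close>\<close>

definition specialize :: "int \<Rightarrow> int poly poly \<Rightarrow> int poly" where
  "specialize q F = map_poly (\<lambda>c. poly c q) F"

text \<open>The coefficient of \<open>t^j\<close> in \<open>f_\<tau>(u;t)\<close>; it depends on \<open>\<tau>\<close> and \<open>j\<close> only.\<close>

definition X_type :: "(nat \<times> nat list) multiset \<Rightarrow> nat \<Rightarrow> int poly" where
  "X_type \<tau> j = coeff (f_type \<tau>) j"

subsection \<open>The defining recurrence\<close>

lemma coeff_homog: "coeff (homog m F) k = (if k \<le> m then monom 1 (m - k) * coeff F k else 0)"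
  by (simp add: homog_def coeff_sum)

lemma coeff_scale_t: "coeff (scale_t F) k = monom 1 k * coeff F k"
proof -
  have "scale_t F = pcompose F [:0, monom 1 1:]"
    by (simp add: scale_t_def monom_altdef)
  then show ?thesis
    by (simp add: coeff_pcompose_linear monom_power)
qed

text \<open>\<open>palin m F\<close> states that \<open>F\<close> has degree at most \<open>m\<close> in \<open>t\<close> and \<open>t^m F(u; 1/t) = F(u; t)\<close>.\<close>

definition palin :: "nat \<Rightarrow> int poly poly \<Rightarrow> bool" where
  "palin m F \<longleftrightarrow> (\<forall>k>m. coeff F k = 0) \<and> (\<forall>k\<le>m. coeff F (m - k) = coeff F k)"

lemma f_part_aux:
  "palin (sum_list l) (f_part l) \<and>
   (\<forall>a l'. l = a # l' \<longrightarrow> [:-1, 1:] * f_part l =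
      monom 1 (a + 1) * homog (sum_list l') (f_part l') - scale_t (f_part l'))"
proof (induction l)
  case Nil
  then show ?case by (auto simp: palin_def)
next
  case (Cons a l)
  define m F where "m = sum_list l" and "F = f_part l"
  define R where "R = monom 1 (a + 1) * homog m F - scale_t F"
  have F: "\<And>k. k > m \<Longrightarrow> coeff F k = 0" "\<And>k. k \<le> m \<Longrightarrow> coeff F (m - k) = coeff F k"
    using Cons unfolding palin_def m_def F_def by auto
  have cR: "coeff R k = (if a + 1 \<le> k \<and> k \<le> a + 1 + m
      then monom 1 (m - (k - (a + 1))) * coeff F (k - (a + 1)) else 0)
      - monom 1 k * coeff F k" for k
    by (auto simp: R_def coeff_monom_mult coeff_homog coeff_scale_t)
  have "poly R 1 = poly (homog m F) 1 - poly (scale_t F) 1"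
    by (simp add: R_def poly_monom)
  also have "poly (homog m F) 1 = (\<Sum>k\<le>m. monom 1 (m - k) * coeff F k)"
    by (simp add: homog_def poly_sum poly_monom)
  also have "\<dots> = (\<Sum>k\<le>m. monom 1 k * coeff F k)"
    by (rule sum.reindex_bij_witness[of _ "\<lambda>k. m - k" "\<lambda>k. m - k"]) (auto simp: F)
  also have "poly (scale_t F) 1 = (\<Sum>k\<le>m. coeff (scale_t F) k)"
  proof -
    have "degree (scale_t F) \<le> m"
      by (rule degree_le) (auto simp: coeff_scale_t F)
    then have "scale_t F = (\<Sum>k\<le>m. monom (coeff (scale_t F) k) k)"
      by (rule poly_as_sum_of_monoms'[symmetric])
    then show ?thesis
      by (metis (mono_tags, lifting) mult.right_neutral poly_monom poly_sum power_one sum.cong)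
  qed
  finally have R1: "poly R 1 = 0"
    by (simp add: coeff_scale_t)
  then obtain G where G: "R = [:-1, 1:] * G"
    by (auto simp: poly_eq_0_iff_dvd elim: dvdE)
  have "f_part (a # l) = R div [:-1, 1:]"
    by (simp add: R_def m_def F_def)
  also have "\<dots> = G"
    using nonzero_mult_div_cancel_left[of "[:-1, 1:]" G] by (simp only: G) simp
  finally have fG: "f_part (a # l) = G" .
  have R_anti: "coeff R (a + 1 + m - k) = - coeff R k" if "k \<le> a + 1 + m" for k
  proof -
    have e1: "coeff F (m - k) = coeff F k" if "k \<le> m" using F(2) that by auto
    have e2: "coeff F (a + 1 + m - k) = coeff F (k - (a + 1))" if "a + 1 \<le> k" "k \<le> a + 1 + m"
      using F(2)[of "k - (a + 1)"] that by (simp add: algebra_simps)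
    have e3: "coeff F (a + 1 + m - k) = 0" if "k < a + 1" using F(1) that by auto
    have e4: "a + 1 + m - k - (a + 1) = m - k" "m - (m - k) = k" if "k \<le> m"
      using that by auto
    have e5: "m - (k - (a + 1)) = a + 1 + m - k" if "a + 1 \<le> k" using that by auto
    show ?thesis
    proof (cases "k \<le> m"; cases "a + 1 \<le> k")
      assume "k \<le> m" "a + 1 \<le> k"
      then show ?thesis using that e1 e2 e4 e5 unfolding cR by auto
    next
      assume "k \<le> m" "\<not> a + 1 \<le> k"
      then show ?thesis using that e1 e3 e4 unfolding cR by auto
    next
      assume "\<not> k \<le> m" "a + 1 \<le> k"
      then show ?thesis using that e2 e5 F(1)[of k] unfolding cR by auto
    next
      assume "\<not> k \<le> m" "\<not> a + 1 \<le> k"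
      then show ?thesis using that e3 F(1)[of k] unfolding cR by auto
    qed
  qed
  have GR0: "coeff R 0 = - coeff G 0"
    by (simp add: G)
  have GR: "coeff R (Suc k) = coeff G k - coeff G (Suc k)" for k
    by (simp add: G)
  have G0: "coeff G k = 0" if "k > a + m" for k
  proof (cases "G = 0")
    case False
    have "degree R = Suc (degree G)"
      using False by (simp add: G degree_mult_eq del: mult_pCons_left)
    moreover have "degree R \<le> a + 1 + m"
      by (rule degree_le) (auto simp: cR F)
    ultimately show ?thesis using that by (intro coeff_eq_0) auto
  qed auto
  have Gp: "coeff G (a + m - k) = coeff G k" if "k \<le> a + m" for k
    using that
  proof (induction k)
    case 0
    then show ?case
      using R_anti[of 0] GR[of "a + m"] G0[of "Suc (a + m)"] GR0 by simp
  next
    case (Suc k)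
    have "a + 1 + m - Suc k = Suc (a + m - Suc k)" "Suc (a + m - Suc k) = a + m - k"
      using Suc.prems by auto
    then show ?case
      using R_anti[of "Suc k"] GR[of "a + m - Suc k"] GR[of k] Suc by simp
  qed
  show ?case
    using fG G0 Gp G by (auto simp: palin_def R_def m_def F_def)
qed

lemma f_part_recurrence:
  "(monom 1 1 - 1) * f_part (a # l) =
     monom 1 (a + 1) * homog (sum_list l) (f_part l) - scale_t (f_part l)"
proof -
  have "(monom 1 1 - 1 :: int poly poly) = [:-1, 1:]"
    by (simp add: monom_altdef one_pCons)
  then show ?thesis using f_part_aux[of "a # l"] by simp
qed

definition eval2 :: "int poly poly \<Rightarrow> 'b::field_char_0 \<Rightarrow> 'b \<Rightarrow> 'b" where
  "eval2 F u t = poly (map_poly (\<lambda>c. poly (map_poly of_int c) u) F) t"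

lemma eval_f_part_recurrence:
  fixes u t :: "'b::field_char_0"
  assumes "u \<noteq> 0"
  shows "(t - 1) * eval2 (f_part (a # l)) u t =
    t ^ (a + 1) * u ^ sum_list l * eval2 (f_part l) u (t / u) - eval2 (f_part l) u (t * u)"
proof -
  define e where "e = (\<lambda>c. poly (map_poly of_int c) u)"
  interpret of_int_poly: map_poly_comm_ring_hom "of_int :: int \<Rightarrow> 'b" ..
  interpret e: comm_ring_hom e
    by unfold_locales (auto simp: e_def hom_distribs)
  interpret E: map_poly_comm_ring_hom e ..
  define F m where "F = f_part l" and "m = sum_list l"
  have F0: "coeff F k = 0" if "k > m" for k
    using f_part_aux[of l] that by (auto simp: palin_def F_def m_def)
  have emon: "e (monom 1 k) = u ^ k" for k
    by (simp add: e_def map_poly_monom poly_monom)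
  have as_sum: "poly (map_poly e H) x = (\<Sum>k\<le>m. e (coeff H k) * x ^ k)"
    if "\<And>k. k > m \<Longrightarrow> coeff H k = 0" for H x
  proof -
    have "degree (map_poly e H) \<le> m"
      by (rule degree_le) (auto simp: coeff_map_poly that)
    then have "map_poly e H = (\<Sum>k\<le>m. monom (coeff (map_poly e H) k) k)"
      by (rule poly_as_sum_of_monoms'[symmetric])
    then have "poly (map_poly e H) x = poly (\<Sum>k\<le>m. monom (coeff (map_poly e H) k) k) x"
      by (rule arg_cong)
    then show ?thesis
      by (simp add: poly_sum poly_monom coeff_map_poly)
  qed
  have h: "poly (map_poly e (homog m F)) t = u ^ m * poly (map_poly e F) (t / u)"
    using assms F0
    by (subst (1 2) as_sum)
      (auto simp: coeff_homog sum_distrib_left e.hom_mult emon power_divide power_diff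
        intro!: sum.cong)
  have s: "poly (map_poly e (scale_t F)) t = poly (map_poly e F) (t * u)"
    using F0
    by (subst (1 2) as_sum)
      (auto simp: coeff_scale_t e.hom_mult emon power_mult_distrib mult_ac intro!: sum.cong)
  have m1: "map_poly e (monom 1 k) = monom 1 k" for k
    by (simp add: map_poly_monom)
  have "poly (map_poly e ((monom 1 1 - 1) * f_part (a # l))) t =
      poly (map_poly e (monom 1 (a + 1) * homog m F - scale_t F)) t"
    by (simp only: f_part_recurrence F_def m_def)
  then have "(t - 1) * poly (map_poly e (f_part (a # l))) t =
      t ^ (a + 1) * (u ^ m * poly (map_poly e F) (t / u)) - poly (map_poly e F) (t * u)"
    by (simp only: E.hom_mult E.hom_minus E.hom_one m1 poly_mult poly_diff poly_monom h s) simp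
  then show ?thesis
    by (simp add: eval2_def F_def m_def e_def mult_ac)
qed

end

theory Submission
  imports Defs "HOL-Library.Function_Algebras"
begin

text \<open>Invariant subspaces of \<open>T\<close> are submodules of the finite \<open>F_q[t]\<close>-module \<open>M_T\<close>, which is the
  direct sum of its primary components; so is every submodule, and hence the generating function
  is the product of those of the primary components. A \<open>p\<close>-primary component splits as
  \<open>M = R b \<oplus> M'\<close>, where \<open>b\<close> has order \<open>p ^ (a + 1)\<close> and \<open>p ^ (a + 1)\<close> kills \<open>M'\<close>. Put
  \<open>N = R p b \<oplus> M'\<close> and \<open>d = deg p\<close>, and count the submodules \<open>W\<close> of \<open>M\<close> in two ways.

  Either \<open>W\<close> lies in \<open>N\<close>, or \<open>W\<close> is given by \<open>K = W \<inter> M'\<close> and the coset of those \<open>x \<in> M'\<close> with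
  \<open>b + x \<in> W\<close>; this gives \<open>f_M(t) = f_N(t) + t ^ (d (a + 1)) (\<Sum>K. |M' / K| t ^ dim K)\<close>.

  Either \<open>W\<close> contains the socle of \<open>R b\<close>, and since \<open>r b + m \<mapsto> r p b + m\<close> induces an isomorphism from
  the quotient of \<open>M\<close> by this socle to \<open>N\<close>, these \<open>W\<close> contribute \<open>t ^ d f_N(t)\<close>; or \<open>W \<inter> R b = 0\<close>,
  and \<open>W\<close> is a complement of \<open>R b\<close> in \<open>R b + L\<close> for a unique \<open>L \<le> M'\<close>, which has exactly \<open>|L|\<close>
  complements.

  Eliminating \<open>f_N\<close> from the two expressions for \<open>f_M\<close> yields the recurrence that defines
  \<open>f_\<lambda>(q ^ d; t ^ d)\<close>.\<close>

section \<open>Polynomials over a field\<close>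

text \<open>The auxiliary module \<open>N\<close> has first part a, which may be 0 or smaller than
  the next part, so no induction over partitions reaches it directly. Hence both counts are arranged
  so that it enters only through its generating function, and eliminating that leaves the factor t^d
  - 1.

  That p^(a+1) kills M', i.e. that the part a + 1 is a largest one, matters in both counts: it gives
  every b + x the same order as b, and it allows a complement of R b to be extended one simple
  factor at a time.

  The two remaining sums over submodules of M' are its own generating function in disguise. As |L| =
  q^dim L, the weight |L| replaces t by q t, and the weight |M'/K| replaces t by t/q and multiplies
  by |M'|. In terms of u = q^d and t^d these are the two terms on the right of the recurrence.

  Dimensions are logarithms of cardinalities throughout, so the module part is pure counting; bases
  occur only in the comparison with \<open>vectorspace.dim\<close>. Existence and uniqueness of the
  partition are proved because \<open>primary_partition\<close> is a definite description.\<close>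

definition comaximal :: "'r::comm_ring_1 \<Rightarrow> 'r \<Rightarrow> bool" where
  "comaximal f g \<longleftrightarrow> (\<exists>u v. u * f + v * g = 1)"

lemma comaximal_sym: "comaximal f g \<Longrightarrow> comaximal g f"
  unfolding comaximal_def by (metis add.commute)

lemma comaximal_one: "comaximal f 1"
  unfolding comaximal_def by (rule exI[of _ 0], rule exI[of _ 1]) simp

lemma comaximal_mult:
  assumes "comaximal f g" "comaximal f h"
  shows "comaximal f (g * h)"
proof -
  obtain u v u' v' where *: "u * f + v * g = 1" "u' * f + v' * h = 1"
    using assms unfolding comaximal_def by blast
  have "(u * (u' * f + v' * h) + v * g * u') * f + (v * v') * (g * h)
      = (u * f + v * g) * (u' * f + v' * h)"
    by (simp add: algebra_simps)
  then show ?thesis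
    unfolding comaximal_def using * by (metis mult_1)
qed

lemma comaximal_power: "comaximal f g \<Longrightarrow> comaximal f (g ^ k)"
  by (induction k) (auto intro: comaximal_one comaximal_mult)

lemma comaximal_prod: "(\<And>i. i \<in> I \<Longrightarrow> comaximal f (g i)) \<Longrightarrow> comaximal f (prod g I)"
  by (induction I rule: infinite_finite_induct) (auto intro: comaximal_one comaximal_mult)

text \<open>Euclid's algorithm: the combination produced is a greatest common divisor.\<close>

lemma poly_bezout:
  fixes f g :: "'a::field poly"
  shows "\<exists>u v. u * f + v * g dvd f \<and> u * f + v * g dvd g"
\<comment> \<open>The measure separates \<open>g = 0\<close> from the nonzero constants, which also
  have degree 0, so the last division step decreases it too.\<close>
proof (induction "if g = 0 then 0 else Suc (degree g)" arbitrary: f g rule: less_induct)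
  case less
  show ?case
  proof (cases "g = 0")
    case True
    show ?thesis by (rule exI[of _ 1], rule exI[of _ 0]) (simp add: True)
  next
    case False
    have "f mod g = 0 \<or> degree (f mod g) < degree g"
      using False degree_mod_less by blast
    then have "\<exists>u v. u * g + v * (f mod g) dvd g \<and> u * g + v * (f mod g) dvd f mod g"
      by (intro less) (use False in auto)
    then obtain u v where uv: "u * g + v * (f mod g) dvd g" "u * g + v * (f mod g) dvd f mod g"
      by blast
    have "u * g + v * (f mod g) dvd f"
      using uv by (metis dvd_mod_iff)
    moreover have "u * g + v * (f mod g) = v * f + (u - v * (f div g)) * g"
      by (simp add: algebra_simps minus_mult_div_eq_mod[symmetric])
    ultimately show ?thesis using uv(1) by metis
  qed
qed

lemma comaximal_irreducible:
  fixes p r :: "'a::field poly"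
  assumes "irreducible p" "\<not> p dvd r"
  shows "comaximal p r"
proof -
  obtain u v where uv: "u * p + v * r dvd p" "u * p + v * r dvd r"
    using poly_bezout by blast
  then have "u * p + v * r dvd 1"
    using assms by (metis dvd_trans irreducibleD')
  then obtain w where "1 = (u * p + v * r) * w" ..
  then have "(w * u) * p + (w * v) * r = 1"
    by (simp add: algebra_simps)
  then show ?thesis unfolding comaximal_def by blast
qed

lemma comaximal_irreducibles:
  fixes p p' :: "'a::field poly"
  assumes "irreducible p" "irreducible p'" "lead_coeff p = 1" "lead_coeff p' = 1" "p \<noteq> p'"
  shows "comaximal p p'"
proof (rule comaximal_irreducible[OF assms(1)])
  show "\<not> p dvd p'"
  proof
    assume "p dvd p'"
    then have "p' dvd p"
      using assms by (metis irreducibleD' irreducible_not_unit)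
    with \<open>p dvd p'\<close> show False
      using assms(3-5) poly_dvd_antisym by metis
  qed
qed

text \<open>Here \<open>j\<close> is the multiplicity of \<open>p\<close> in \<open>r\<close>; the
  hypothesis also excludes \<open>r = 0\<close>.\<close>

lemma not_power_dvdE:
  fixes p r :: "'a::field poly"
  assumes "irreducible p" "\<not> p ^ a dvd r"
  obtains j s where "j < a" "r = p ^ j * s" "\<not> p dvd s"
proof -
  have "\<exists>j s. j < a \<and> r = p ^ j * s \<and> \<not> p dvd s"
    using assms(2)
  proof (induction a)
    case (Suc a)
    show ?case
    proof (cases "p ^ a dvd r")
      case True
      then obtain s where s: "r = p ^ a * s" ..
      with Suc.prems have "\<not> p dvd s" by (auto simp: mult_ac)
      with s show ?thesis by blast
    qed (use Suc.IH in \<open>auto intro: less_SucI\<close>)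
  qed simp
  with that show thesis by blast
qed

lemma exists_monic_irreducible_dvd:
  fixes f :: "'a::field poly"
  assumes "f \<noteq> 0" "\<not> is_unit f"
  shows "\<exists>p. irreducible p \<and> lead_coeff p = 1 \<and> p dvd f"
  using assms
proof (induction "degree f" arbitrary: f rule: less_induct)
  case less
  show ?case
  proof (cases "irreducible f")
    case True
    have "irreducible ([:inverse (lead_coeff f):] * f)"
      using True less.prems by (subst irreducible_mult_unit_left) (auto simp: is_unit_triv)
    then show ?thesis using less.prems(1)
      by (intro exI[of _ "Polynomial.smult (inverse (lead_coeff f)) f"]) (auto simp: smult_dvd_iff)
  next
    case False
    then obtain g h where gh: "f = g * h" "\<not> is_unit g" "\<not> is_unit h"
      using less.prems unfolding irreducible_def by blast
    then have nz: "g \<noteq> 0" "h \<noteq> 0" using less.prems by auto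
    then have "degree h > 0" using gh(3) by (simp add: is_unit_iff_degree)
    then have "degree g < degree f" using nz gh by (simp add: degree_mult_eq)
    then show ?thesis using less.hyps[of g] nz gh by (metis dvd_mult2)
  qed
qed

text \<open>A crude form of factorization, sufficient for the primary decomposition: it supplies a
  finite set of primes and an annihilating power of their product.\<close>

lemma dvd_power_prod_irreducibles:
  fixes f :: "'a::field poly"
  assumes "f \<noteq> 0"
  shows "\<exists>P k. finite P \<and> (\<forall>p\<in>P. irreducible p \<and> lead_coeff p = 1) \<and> f dvd \<Prod>P ^ k"
  using assms
proof (induction "degree f" arbitrary: f rule: less_induct)
  case less
  show ?case
  proof (cases "is_unit f")
    case True
    then show ?thesis by (intro exI[of _ "{}"]) auto
  next
    case False
    then obtain p where p: "irreducible p" "lead_coeff p = 1" "p dvd f"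
      using exists_monic_irreducible_dvd less.prems by blast
    then obtain g where g: "f = p * g" by blast
    then have nz: "g \<noteq> 0" "p \<noteq> 0" using less.prems by auto
    have "degree p > 0" using p(1) nz by (metis irreducible_def is_unit_iff_degree neq0_conv)
    then have "degree g < degree f" using g nz by (simp add: degree_mult_eq)
    then obtain P k where P: "finite P" "\<forall>p\<in>P. irreducible p \<and> lead_coeff p = 1" "g dvd \<Prod>P ^ k"
      using less.hyps[OF _ nz(1)] by metis
    have "\<Prod>P dvd \<Prod>(insert p P)"
      using P(1) by (intro prod_dvd_prod_subset) auto
    then have "g dvd \<Prod>(insert p P) ^ k"
      using P(3) dvd_power_same dvd_trans by blast
    moreover have "p dvd \<Prod>(insert p P)" using P(1) by (intro dvd_prodI) auto
    ultimately have "f dvd \<Prod>(insert p P) ^ Suc k"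
      using g by (simp add: mult_dvd_mono)
    then show ?thesis using P(1,2) p(1,2)
      by (intro exI[of _ "insert p P"] exI[of _ "Suc k"]) simp
  qed
qed

lemma card_reduced_residues:
  fixes f :: "'a::{field,finite} poly"
  assumes "f \<noteq> 0"
  shows "finite {r. r mod f = r}" "card {r. r mod f = r} = CARD('a) ^ degree f"
proof -
  define n where "n = degree f"
  have eq: "{r. r mod f = r} = {r. \<forall>i\<ge>n. coeff r i = 0}"
  proof (intro equalityI subsetI)
    fix r assume "r \<in> {r. r mod f = r}"
    then have r: "r mod f = r" by simp
    have "coeff r i = 0" if "n \<le> i" for i
      using degree_mod_less[OF assms, of r] r that by (auto simp: n_def intro: coeff_eq_0)
    then show "r \<in> {r. \<forall>i\<ge>n. coeff r i = 0}" by simp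
  next
    fix r assume "r \<in> {r :: 'a poly. \<forall>i\<ge>n. coeff r i = 0}"
    then have r: "\<forall>i\<ge>n. coeff r i = 0" by simp
    show "r \<in> {r. r mod f = r}"
    proof (cases "r = 0")
      case False
      then have "degree r < n" using r by (metis leading_coeff_0_iff not_le)
      then show ?thesis by (simp add: mod_poly_less n_def)
    qed auto
  qed
  have bij: "bij_betw Poly {xs. set xs \<subseteq> (UNIV :: 'a set) \<and> length xs = n} {r. \<forall>i\<ge>n. coeff r i = 0}"
    by (rule bij_betw_byWitness[where f' = "\<lambda>r. map (coeff r) [0..<n]"])
      (auto intro!: nth_equalityI poly_eqI simp: nth_default_def)
  show "card {r. r mod f = r} = CARD('a) ^ degree f"
    using bij_betw_same_card[OF bij] card_lists_length_eq[of "UNIV :: 'a set" n]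
    by (simp add: eq n_def)
  show "finite {r. r mod f = r}"
    using bij_betw_finite[OF bij] finite_lists_length_eq[of "UNIV :: 'a set" n] by (simp add: eq)
qed

section \<open>Finite modules over polynomial rings\<close>

lemma card_image_fibres:
  assumes "finite S" "\<And>x. x \<in> S \<Longrightarrow> card {x' \<in> S. g x' = g x} = c"
  shows "card S = c * card (g ` S)"
proof -
  have "card S = (\<Sum>y\<in>g ` S. card {x \<in> S. g x = y})"
    using sum.group[OF assms(1), of "g ` S" g "\<lambda>_. 1 :: nat"] assms(1) by simp
  also have "\<dots> = (\<Sum>y\<in>g ` S. c)"
    using assms(2) by (intro sum.cong) auto
  finally show ?thesis by simp
qed

text \<open>Over the ring \<open>'a poly\<close>, \<open>subspace\<close> means submodule. The
  ambient type may be infinite, so finiteness is imposed on the submodule at hand.\<close>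

locale poly_module = Modules.module scale
  for scale :: "'a::{field,finite} poly \<Rightarrow> 'b::ab_group_add \<Rightarrow> 'b" (infixr \<open>*s\<close> 75)
begin

definition adjoin :: "'b set \<Rightarrow> 'b \<Rightarrow> 'b set" where
  "adjoin L x = {l + r *s x | l r. l \<in> L}"

lemma adjoinI: "l \<in> L \<Longrightarrow> l + r *s x \<in> adjoin L x"
  by (auto simp: adjoin_def)

lemma adjoinE:
  assumes "y \<in> adjoin L x"
  obtains l r where "l \<in> L" "y = l + r *s x"
  using assms by (auto simp: adjoin_def)

lemma subspace_adjoin:
  assumes "subspace L"
  shows "subspace (adjoin L x)"
proof (rule subspaceI)
  show "0 \<in> adjoin L x"
    using adjoinI[of 0 L 0 x] subspace_0[OF assms] by simp
next
  fix y z assume "y \<in> adjoin L x" "z \<in> adjoin L x"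
  then obtain l r l' r' where "l \<in> L" "y = l + r *s x" "l' \<in> L" "z = l' + r' *s x"
    by (elim adjoinE) blast
  then show "y + z \<in> adjoin L x"
    using adjoinI[of "l + l'" L "r + r'" x] subspace_add[OF assms]
    by (simp add: scale_left_distrib algebra_simps)
next
  fix c y assume "y \<in> adjoin L x"
  then obtain l r where "l \<in> L" "y = l + r *s x"
    by (elim adjoinE) blast
  then show "c *s y \<in> adjoin L x"
    using adjoinI[of "c *s l" L "c * r" x] subspace_scale[OF assms]
    by (simp add: scale_right_distrib)
qed

lemma adjoin_superset: "L \<subseteq> adjoin L x"
  using adjoinI[of _ L 0 x] by auto

lemma adjoin_mem: "subspace L \<Longrightarrow> r *s x \<in> adjoin L x"
  using adjoinI[of 0 L r x] subspace_0 by auto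

lemma adjoin_mem1: "subspace L \<Longrightarrow> x \<in> adjoin L x"
  using adjoin_mem[of L 1 x] by simp

lemma adjoin_least:
  assumes "subspace W" "L \<subseteq> W" "x \<in> W"
  shows "adjoin L x \<subseteq> W"
proof
  fix y assume "y \<in> adjoin L x"
  then obtain l r where "l \<in> L" "y = l + r *s x" by (elim adjoinE)
  then show "y \<in> W"
    using assms subspace_add[of W l "r *s x"] subspace_scale[of W x r] by blast
qed

lemma subspace_add_cancel:
  assumes "subspace L" "x \<in> L"
  shows "x + y \<in> L \<longleftrightarrow> y \<in> L" "y + x \<in> L \<longleftrightarrow> y \<in> L"
proof -
  have "y \<in> L" if "y + x \<in> L" for y
    using subspace_diff[OF assms(1) that assms(2)] by simp
  moreover have "y + x \<in> L" if "y \<in> L" for y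
    by (rule subspace_add[OF assms(1) that assms(2)])
  ultimately show "x + y \<in> L \<longleftrightarrow> y \<in> L" "y + x \<in> L \<longleftrightarrow> y \<in> L"
    by (metis add.commute)+
qed

lemma subspace_add_eq:
  assumes "subspace L" "l \<in> L" "l' \<in> L" "l + x = l' + y"
  shows "x - y \<in> L" "y - x \<in> L"
proof -
  have "x - y = l' - l" "y - x = l - l'"
    using assms(4) by (metis add_diff_cancel_left add_diff_cancel_left' diff_add_eq
      diff_diff_eq2 add.commute)+
  then show "x - y \<in> L" "y - x \<in> L"
    using subspace_diff[OF assms(1)] assms(2,3) by auto
qed

text \<open>The conductor of \<open>x\<close> into \<open>L\<close> is the ideal generated by
  \<open>f\<close>, so \<open>adjoin L x\<close> modulo \<open>L\<close> is the residue ring modulo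
  \<open>f\<close>. The bijection takes reduced residues as coefficients of
  \<open>x\<close>.\<close>

lemma card_adjoin:
  assumes L: "subspace L" "finite L" and f: "\<And>r. r *s x \<in> L \<longleftrightarrow> f dvd r" "f \<noteq> 0"
  shows "finite (adjoin L x)" "card (adjoin L x) = card L * CARD('a) ^ degree f"
proof -
  let ?R = "{r. r mod f = r}"
  have "bij_betw (\<lambda>(l, r). l + r *s x) (L \<times> ?R) (adjoin L x)"
    unfolding bij_betw_def
  proof (intro conjI inj_onI equalityI subsetI)
    fix z z' assume "z \<in> L \<times> ?R" "z' \<in> L \<times> ?R"
      and eq: "(case z of (l, r) \<Rightarrow> l + r *s x) = (case z' of (l, r) \<Rightarrow> l + r *s x)"
    then obtain l r l' r' where z: "z = (l, r)" "z' = (l', r')" "l \<in> L" "l' \<in> L"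
      "r mod f = r" "r' mod f = r'" by auto
    then have eq': "l + r *s x = l' + r' *s x" using eq by simp
    have "(r - r') *s x \<in> L"
      using subspace_add_eq(1)[OF L(1) z(3,4) eq'] by (simp add: scale_left_diff_distrib)
    then have "f dvd r - r'" using f by blast
    then have "r = r'"
      using z(5,6) by (metis mod_eq_dvd_iff)
    then show "z = z'" using z eq' by simp
  next
    fix y assume "y \<in> (\<lambda>(l, r). l + r *s x) ` (L \<times> ?R)"
    then show "y \<in> adjoin L x" by (auto intro: adjoinI)
  next
    fix y assume "y \<in> adjoin L x"
    then obtain l r where y: "l \<in> L" "y = l + r *s x" by (elim adjoinE) blast
    have "r *s x = (f * (r div f)) *s x + (r mod f) *s x"
      by (simp flip: scale_left_distrib)
    then have "y = (l + (f * (r div f)) *s x) + (r mod f) *s x"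
      using y by (simp add: add.assoc)
    moreover have "l + (f * (r div f)) *s x \<in> L"
      using y f by (intro subspace_add L) auto
    ultimately show "y \<in> (\<lambda>(l, r). l + r *s x) ` (L \<times> ?R)"
      by (intro image_eqI[of _ _ "(l + (f * (r div f)) *s x, r mod f)"]) auto
  qed
  from bij_betw_same_card[OF this] bij_betw_finite[OF this]
  show "finite (adjoin L x)" "card (adjoin L x) = card L * CARD('a) ^ degree f"
    using card_reduced_residues[OF f(2)] L(2) by (auto simp: card_cartesian_product)
qed

text \<open>The polynomial ring is infinite and \<open>W\<close> is finite, so two scalars agree on
  \<open>x\<close>; hence the conductor of \<open>x\<close> into \<open>L\<close> is a nonzero
  ideal, generated by an element of least degree.\<close>

lemma exists_conductor:
  assumes L: "subspace L" and W: "subspace W" "finite W" "x \<in> W"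
  obtains f where "f \<noteq> 0" "\<And>r. r *s x \<in> L \<longleftrightarrow> f dvd r"
proof -
  have "\<not> inj (\<lambda>r. r *s x)"
  proof
    assume "inj (\<lambda>r. r *s x)"
    moreover have "range (\<lambda>r. r *s x) \<subseteq> W" using W subspace_scale by auto
    ultimately have "finite (UNIV :: 'a poly set)"
      using W(2) by (metis finite_imageD finite_subset)
    moreover have "inj (\<lambda>n. monom 1 n :: 'a poly)"
      by (rule injI, drule arg_cong[of _ _ degree]) (simp add: degree_monom_eq)
    ultimately show False
      using range_inj_infinite rev_finite_subset[OF _ subset_UNIV] by blast
  qed
  then obtain r r' where "r *s x = r' *s x" "r \<noteq> r'" unfolding inj_def by blast
  then have "(r - r') *s x \<in> L" "r - r' \<noteq> 0"
    using subspace_0[OF L] by (auto simp: scale_left_diff_distrib)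
  define f where "f = arg_min degree (\<lambda>g. g \<noteq> 0 \<and> g *s x \<in> L)"
  have f: "f \<noteq> 0" "f *s x \<in> L" "\<And>g. g \<noteq> 0 \<Longrightarrow> g *s x \<in> L \<Longrightarrow> degree f \<le> degree g"
    using arg_min_nat_lemma[of "\<lambda>g. g \<noteq> 0 \<and> g *s x \<in> L" "r - r'" degree]
      \<open>(r - r') *s x \<in> L\<close> \<open>r - r' \<noteq> 0\<close> by (auto simp: f_def)
  have "r *s x \<in> L \<longleftrightarrow> f dvd r" for r
  proof
    assume "r *s x \<in> L"
    have "(r mod f) *s x = r *s x - (r div f) *s (f *s x)"
      by (simp add: scale_left_diff_distrib minus_div_mult_eq_mod[symmetric])
    then have "(r mod f) *s x \<in> L"
      using subspace_diff[OF L \<open>r *s x \<in> L\<close> subspace_scale[OF L f(2)]] by metis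
    then have "r mod f = 0"
      using f(3)[of "r mod f"] degree_mod_less[OF f(1), of r] by force
    then show "f dvd r" by auto
  next
    assume "f dvd r"
    then obtain s where "r = s * f" by (metis dvd_def mult.commute)
    then show "r *s x \<in> L" using f(2) L by (simp add: subspace_scale flip: scale_scale)
  qed
  then show thesis using that f(1) by blast
qed

text \<open>Among the submodules of \<open>W\<close> satisfying \<open>P\<close>, a maximal one must
  be \<open>W\<close>. The step is free to choose \<open>x\<close>, which
  \<open>primary_subspace_induct\<close> exploits to enlarge by one simple factor at a time.\<close>

lemma finite_subspace_induct [consumes 2, case_names zero adjoin]:
  assumes W: "subspace W" "finite W" and "P {0}"
    and step: "\<And>L. subspace L \<Longrightarrow> L \<subset> W \<Longrightarrow> P L \<Longrightarrow> \<exists>x\<in>W. x \<notin> L \<and> P (adjoin L x)"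
  shows "P W"
proof -
  define A where "A = {L. subspace L \<and> L \<subseteq> W \<and> P L}"
  have "finite A" using W(2) by (auto simp: A_def intro: finite_subset[of _ "Pow W"])
  moreover have "{0} \<in> A" using assms(3) subspace_0[OF W(1)] by (auto simp: A_def)
  ultimately obtain L where L: "L \<in> A" "\<And>L'. L' \<in> A \<Longrightarrow> L \<subseteq> L' \<Longrightarrow> L' = L"
    using finite_has_maximal[of A] by (metis empty_iff)
  show ?thesis
  proof (cases "L = W")
    case False
    then obtain x where x: "x \<in> W" "x \<notin> L" "P (adjoin L x)"
      using step[of L] L(1) unfolding A_def by blast
    then have "adjoin L x \<in> A"
      using L(1) by (auto simp: A_def subspace_adjoin intro: adjoin_least[THEN subsetD] W(1))
    then have "adjoin L x = L" using L(2) adjoin_superset by simp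
    then show ?thesis using x(2) L(1) adjoin_mem1[of L x] by (simp add: A_def)
  qed (use L in \<open>auto simp: A_def\<close>)
qed

text \<open>The dimension over the ground field, read off from the cardinality;
  \<open>card_subspace\<close> provides the exponent for finite submodules.\<close>

definition dm :: "'b set \<Rightarrow> nat" where
  "dm W = (THE k. card W = CARD('a) ^ k)"

lemma one_less_card: "1 < CARD('a)"
proof -
  have "card {0, 1 :: 'a} \<le> CARD('a)" by (intro card_mono) auto
  then show ?thesis by simp
qed

lemma dm_eq: "card W = CARD('a) ^ k \<Longrightarrow> dm W = k"
  unfolding dm_def using one_less_card by (auto intro!: the_equality)

lemma card_subspace:
  assumes "subspace W" "finite W"
  shows "card W = CARD('a) ^ dm W"
proof -
  have "\<exists>k. finite W \<and> card W = CARD('a) ^ k"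
    using assms
  proof (induction rule: finite_subspace_induct)
    case zero
    show ?case by (intro conjI exI[of _ 0]) auto
  next
    case (adjoin L)
    then obtain x where x: "x \<in> W" "x \<notin> L" by blast
    obtain f where f: "f \<noteq> 0" "\<And>r. r *s x \<in> L \<longleftrightarrow> f dvd r"
      using exists_conductor[OF adjoin(1) assms x(1)] by blast
    show ?case
      using x card_adjoin[OF adjoin(1) _ f(2,1)] adjoin(3) by (metis power_add)
  qed
  then obtain k where k: "card W = CARD('a) ^ k" by blast
  show ?thesis unfolding dm_eq[OF k] by (rule k)
qed

lemma dm_mult:
  assumes "subspace W" "finite W" "card W' = card W * CARD('a) ^ k"
  shows "dm W' = dm W + k"
proof (rule dm_eq)
  show "card W' = CARD('a) ^ (dm W + k)"
    unfolding assms(3) power_add by (subst card_subspace[OF assms(1,2)]) (rule refl)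
qed

section \<open>Generating functions of finite modules\<close>

definition subspaces_of :: "'b set \<Rightarrow> 'b set set" where
  "subspaces_of M = {W. subspace W \<and> W \<subseteq> M}"

definition gf :: "'b set \<Rightarrow> int poly" where
  "gf M = (\<Sum>W\<in>subspaces_of M. monom 1 (dm W))"

lemma finite_subspaces_of: "finite M \<Longrightarrow> finite (subspaces_of M)"
  by (auto simp: subspaces_of_def intro: finite_subset[of _ "Pow M"])

lemma subspaces_ofD: "W \<in> subspaces_of M \<Longrightarrow> subspace W" "W \<in> subspaces_of M \<Longrightarrow> W \<subseteq> M"
  by (auto simp: subspaces_of_def)

lemma gf_zero: "gf {0} = 1"
proof -
  have "W = {0}" if "subspace W" "W \<subseteq> {0}" for W
    using that subspace_0[OF that(1)] by blast
  then have "subspaces_of {0} = {{0}}"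
    unfolding subspaces_of_def using subspace_single_0 by blast
  moreover have "dm {0} = 0" by (rule dm_eq) simp
  ultimately show ?thesis by (simp add: gf_def)
qed

text \<open>The correspondence theorem: submodules above the kernel match the submodules of the
  image, and each dimension drops by that of the kernel. Linearity is asked on \<open>M\<close>
  only, since the map to which this is applied is determined only there.\<close>

lemma gf_kernel:
  assumes M: "subspace M" "finite M"
    and add: "\<And>x y. x \<in> M \<Longrightarrow> y \<in> M \<Longrightarrow> \<phi> (x + y) = \<phi> x + \<phi> y"
    and scale: "\<And>r x. x \<in> M \<Longrightarrow> \<phi> (r *s x) = r *s \<phi> x"
    and ker: "card {x \<in> M. \<phi> x = 0} = CARD('a) ^ k"
  shows "(\<Sum>W | W \<in> subspaces_of M \<and> {x \<in> M. \<phi> x = 0} \<subseteq> W. monom 1 (dm W)) =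
    monom 1 k * gf (\<phi> ` M)"
proof -
  let ?K = "{x \<in> M. \<phi> x = 0}"
  have diff: "\<phi> (x - y) = \<phi> x - \<phi> y" if "x \<in> M" "y \<in> M" for x y
    using add[of "x - y" y] that subspace_diff[OF M(1)] by simp
  have zero: "\<phi> 0 = 0" using diff[of 0 0] subspace_0[OF M(1)] by simp
  have img: "\<phi> ` W \<in> subspaces_of (\<phi> ` M)" if "W \<in> subspaces_of M" for W
  proof -
    have W: "subspace W" "W \<subseteq> M" using that by (auto simp: subspaces_of_def)
    have "subspace (\<phi> ` W)"
    proof (rule subspaceI)
      show "0 \<in> \<phi> ` W" using zero subspace_0[OF W(1)] by force
    next
      fix x y assume "x \<in> \<phi> ` W" "y \<in> \<phi> ` W"
      then obtain x' y' where "x' \<in> W" "y' \<in> W" "x = \<phi> x'" "y = \<phi> y'" by auto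
      moreover from this have "\<phi> (x' + y') = \<phi> x' + \<phi> y'" "x' + y' \<in> W"
        using add W subspace_add by blast+
      ultimately show "x + y \<in> \<phi> ` W" by (metis imageI)
    next
      fix c x assume "x \<in> \<phi> ` W"
      then obtain x' where "x' \<in> W" "x = \<phi> x'" by auto
      moreover from this have "\<phi> (c *s x') = c *s \<phi> x'" "c *s x' \<in> W"
        using scale W subspace_scale by blast+
      ultimately show "c *s x \<in> \<phi> ` W" by (metis imageI)
    qed
    then show ?thesis using W by (auto simp: subspaces_of_def)
  qed
  have sat: "x \<in> W" if asm: "W \<in> subspaces_of M" "?K \<subseteq> W" "x \<in> M" "\<phi> x \<in> \<phi> ` W" for x W
  proof -
    from asm(4) obtain y where y: "y \<in> W" "\<phi> x = \<phi> y" by auto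
    then have "x - y \<in> ?K"
      using asm(3) diff[of x y] subspaces_ofD(2)[OF asm(1)] subspace_diff[OF M(1), of x y] by auto
    then show ?thesis
      using asm(2) y(1) subspace_add[OF subspaces_ofD(1)[OF asm(1)], of "x - y" y] by auto
  qed
  have pre: "{x \<in> M. \<phi> x \<in> V} \<in> subspaces_of M" if "V \<in> subspaces_of (\<phi> ` M)" for V
  proof -
    note V = subspaces_ofD(1)[OF that]
    have "subspace {x \<in> M. \<phi> x \<in> V}"
      by (rule subspaceI) (simp_all add: add scale zero subspace_0 subspace_add subspace_scale V M(1))
    then show ?thesis by (auto simp: subspaces_of_def)
  qed
  have dim: "dm W = k + dm (\<phi> ` W)" if W: "W \<in> subspaces_of M" "?K \<subseteq> W" for W
  proof -
    have sub: "W \<subseteq> M" "subspace W" and fin: "finite W"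
      using W M finite_subset by (auto simp: subspaces_of_def)
    have "card {x' \<in> W. \<phi> x' = \<phi> x} = CARD('a) ^ k" if x: "x \<in> W" for x
    proof -
      have xM: "x \<in> M" using x sub by auto
      \<comment> \<open>The fibres on \<open>W\<close> are cosets of the kernel, which lies inside
        \<open>W\<close>.\<close>
      have "{x' \<in> W. \<phi> x' = \<phi> x} = (\<lambda>y. x + y) ` ?K"
      proof (intro equalityI subsetI)
        fix x' assume "x' \<in> {x' \<in> W. \<phi> x' = \<phi> x}"
        then show "x' \<in> (\<lambda>y. x + y) ` ?K"
          using xM sub diff[of x' x] subspace_diff[OF M(1), of x' x]
          by (intro image_eqI[of _ _ "x' - x"]) auto
      next
        fix x' assume "x' \<in> (\<lambda>y. x + y) ` ?K"
        then show "x' \<in> {x' \<in> W. \<phi> x' = \<phi> x}"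
          using W(2) x xM add[of x] by (auto intro!: subspace_add sub(2))
      qed
      then show ?thesis using ker by (simp add: card_image)
    qed
    then have "card W = CARD('a) ^ k * card (\<phi> ` W)" by (rule card_image_fibres[OF fin])
    then show ?thesis
      using dm_mult[of "\<phi> ` W" W k] subspaces_ofD(1)[OF img[OF W(1)]] fin by (simp add: mult.commute)
  qed
  have "(\<Sum>W | W \<in> subspaces_of M \<and> ?K \<subseteq> W. monom 1 (dm W)) =
      (\<Sum>V\<in>subspaces_of (\<phi> ` M). monom 1 k * monom (1::int) (dm V))"
  proof (rule sum.reindex_bij_witness[where j = "\<lambda>W. \<phi> ` W" and i = "\<lambda>V. {x \<in> M. \<phi> x \<in> V}"])
    fix W assume W: "W \<in> {W \<in> subspaces_of M. ?K \<subseteq> W}"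
    then show "{x \<in> M. \<phi> x \<in> \<phi> ` W} = W" using sat subspaces_ofD(2) by blast
    show "\<phi> ` W \<in> subspaces_of (\<phi> ` M)" using W img by auto
    show "monom 1 k * monom 1 (dm (\<phi> ` W)) = monom (1::int) (dm W)"
      using W dim by (simp add: mult_monom)
  next
    fix V assume V: "V \<in> subspaces_of (\<phi> ` M)"
    then show "\<phi> ` {x \<in> M. \<phi> x \<in> V} = V" using subspaces_ofD(2)[OF V] by auto
    show "{x \<in> M. \<phi> x \<in> V} \<in> {W \<in> subspaces_of M. ?K \<subseteq> W}"
      using pre[OF V] subspace_0[OF subspaces_ofD(1)[OF V]] by auto
  qed
  then show ?thesis by (simp add: gf_def sum_distrib_left)
qed

end

section \<open>Adjoining a cyclic summand\<close>

locale primary = poly_module scale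
  for scale :: "'a::{field,finite} poly \<Rightarrow> 'b::ab_group_add \<Rightarrow> 'b" (infixr \<open>*s\<close> 75) +
  fixes p :: "'a poly"
  assumes irred: "irreducible p"
begin

abbreviation d :: nat where "d \<equiv> degree p"

lemma p_nz: "p ^ k \<noteq> 0"
  using irred by auto

lemma p_nz1: "p \<noteq> 0"
  using irred by auto

lemma degree_p_power: "degree (p ^ k) = d * k"
  using p_nz[of 1] by (simp add: degree_power_eq)

lemma bezout_p:
  assumes "\<not> p dvd s"
  obtains u v where "u * s + v * p ^ k = 1"
  using comaximal_power[OF comaximal_sym[OF comaximal_irreducible[OF irred assms]], of k]
  unfolding comaximal_def by blast

text \<open>Write r = p^j s with s prime to p. If j were at most a, inverting s modulo p^(a+1) and
  multiplying by p^(a-j) would put p^a x into \<open>L\<close>.\<close>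

lemma exact_order:
  assumes L: "subspace L" and x: "p ^ Suc a *s x \<in> L" "p ^ a *s x \<notin> L"
  shows "r *s x \<in> L \<longleftrightarrow> p ^ Suc a dvd r"
proof
  assume r: "r *s x \<in> L"
  show "p ^ Suc a dvd r"
  proof (rule ccontr)
    assume "\<not> p ^ Suc a dvd r"
    then obtain j s where js: "j < Suc a" "r = p ^ j * s" "\<not> p dvd s"
      using not_power_dvdE[OF irred] by blast
    obtain u v where uv: "u * s + v * p ^ Suc a = 1" using bezout_p js(3) by blast
    have "p ^ a = p ^ (a - j) * p ^ j * (u * s + v * p ^ Suc a)"
      using js(1) uv by (simp flip: power_add)
    also have "\<dots> = (p ^ (a - j) * u) * r + (p ^ (a - j) * p ^ j * v) * p ^ Suc a"
      by (simp add: js(2) algebra_simps)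
    finally have "p ^ a *s x = (p ^ (a - j) * u) *s (r *s x) + (p ^ (a - j) * p ^ j * v) *s (p ^ Suc a *s x)"
      by (simp only: scale_left_distrib scale_scale)
    then show False
      using x r L subspace_add subspace_scale by metis
  qed
next
  assume "p ^ Suc a dvd r"
  then obtain s where "r = s * p ^ Suc a" by (metis dvd_def mult.commute)
  then show "r *s x \<in> L"
    using subspace_scale[OF L x(1), of s] by (simp only: scale_scale)
qed

text \<open>In the sequence y, p y, p^2 y, ... the last element outside \<open>L\<close> is an
  \<open>x\<close> with \<open>p *s x \<in> L\<close>. Thus \<open>L\<close> grows by one copy of
  R/(p) per step.\<close>

lemma primary_subspace_induct [consumes 2, case_names kill zero adjoin]:
  assumes W: "subspace W" "finite W" "\<And>x. x \<in> W \<Longrightarrow> p ^ k *s x = 0"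
    and "P {0}"
    and step: "\<And>L x. subspace L \<Longrightarrow> L \<subseteq> W \<Longrightarrow> x \<in> W \<Longrightarrow> x \<notin> L \<Longrightarrow> p *s x \<in> L \<Longrightarrow> P L \<Longrightarrow> P (adjoin L x)"
  shows "P W"
  using W(1,2) assms(4)
proof (induction rule: finite_subspace_induct)
  case (adjoin L)
  then obtain y where y: "y \<in> W" "y \<notin> L" by blast
  define j where "j = (LEAST j. p ^ j *s y \<in> L)"
  have "p ^ k *s y \<in> L" using W(3)[OF y(1)] subspace_0[OF adjoin(1)] by simp
  then have j: "p ^ j *s y \<in> L" unfolding j_def by (rule LeastI)
  moreover have "j \<noteq> 0"
  proof
    assume "j = 0"
    then show False using j y(2) by simp
  qed
  then obtain i where i: "j = Suc i" using not0_implies_Suc by blast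
  have "p ^ i *s y \<notin> L"
    using not_less_Least[of i "\<lambda>j. p ^ j *s y \<in> L"] i unfolding j_def by simp
  moreover have "p ^ i *s y \<in> W" using subspace_scale[OF W(1) y(1)] .
  moreover have "p *s (p ^ i *s y) \<in> L" using j i by simp
  ultimately show ?case
    using step[of L "p ^ i *s y"] adjoin by blast
qed

end

text \<open>Together \<open>ord\<close> and \<open>kill_b\<close> say that b has exact order p^(a+1)
  and that R b meets M' only in 0. By \<open>kill\<close> this order bounds those in M', so a + 1 is
  a largest part.\<close>

locale cyclic_summand = primary scale p
  for scale :: "'a::{field,finite} poly \<Rightarrow> 'b::ab_group_add \<Rightarrow> 'b" (infixr \<open>*s\<close> 75) and p +
  fixes a :: nat and b :: 'b and M' :: "'b set"
  assumes sub: "subspace M'" and fin: "finite M'"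
    and kill: "\<And>x. x \<in> M' \<Longrightarrow> p ^ Suc a *s x = 0"
    and kill_b: "p ^ Suc a *s b = 0"
    and ord: "\<And>r. r *s b \<in> M' \<longleftrightarrow> p ^ Suc a dvd r"
begin

definition M where "M = adjoin M' b"
definition N where "N = adjoin M' (p *s b)"

lemma kill_dvd: "p ^ Suc a dvd r \<Longrightarrow> r *s b = 0" "p ^ Suc a dvd r \<Longrightarrow> x \<in> M' \<Longrightarrow> r *s x = 0"
proof -
  assume "p ^ Suc a dvd r"
  then obtain s where s: "r = s * p ^ Suc a" by (metis dvd_def mult.commute)
  then have *: "r *s y = s *s (p ^ Suc a *s y)" for y by simp
  show "r *s b = 0" by (simp only: * kill_b scale_zero_right)
  show "r *s x = 0" if "x \<in> M'" by (simp only: * kill[OF that] scale_zero_right)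
qed

lemma ord_0: "r *s b = 0 \<longleftrightarrow> p ^ Suc a dvd r"
  using ord[of r] kill_dvd(1)[of r] subspace_0[OF sub] by metis

lemma indep: "m \<in> M' \<Longrightarrow> m' \<in> M' \<Longrightarrow> m + r *s b = m' + r' *s b \<longleftrightarrow> m = m' \<and> r *s b = r' *s b"
proof
  assume m: "m \<in> M'" "m' \<in> M'" and eq: "m + r *s b = m' + r' *s b"
  have "(r - r') *s b \<in> M'"
    using subspace_add_eq(1)[OF sub m eq] by (simp add: scale_left_diff_distrib)
  then have "(r - r') *s b = 0" using ord ord_0 by blast
  then show "m = m' \<and> r *s b = r' *s b" using eq by (simp add: scale_left_diff_distrib)
qed simp

lemma subM: "subspace M" and subN: "subspace N"
  by (simp_all add: M_def N_def subspace_adjoin sub)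

lemma M'_M: "M' \<subseteq> M" and M'_N: "M' \<subseteq> N" and b_M: "r *s b \<in> M"
  by (simp_all add: M_def N_def adjoin_superset adjoin_mem sub del: scale_scale)

lemma N_M: "N \<subseteq> M"
  unfolding N_def by (intro adjoin_least subM M'_M b_M)

lemma finM: "finite M" and cardM: "card M = card M' * CARD('a) ^ (d * Suc a)"
  using card_adjoin[OF sub fin, of b "p ^ Suc a"] ord p_nz[of "Suc a"]
  by (simp_all only: M_def degree_p_power not_False_eq_True simp_thms)

text \<open>p r b = 0 means that p^(a+1) divides p r, i.e. that p^a divides r. The left form gives
  the cardinality, the right form a test for membership.\<close>

lemma socle: "{r *s (p ^ a *s b) | r. True} = {x. \<exists>r. x = r *s b \<and> p *s x = 0}"
proof (intro equalityI subsetI)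
  fix x assume "x \<in> {r *s (p ^ a *s b) | r. True}"
  then obtain r where r: "x = r *s (p ^ a *s b)" by blast
  then have "x = (r * p ^ a) *s b" by simp
  moreover have "p *s x = r *s (p ^ Suc a *s b)" using r by (simp add: mult_ac)
  then have "p *s x = 0" by (simp only: kill_b scale_zero_right)
  ultimately show "x \<in> {x. \<exists>r. x = r *s b \<and> p *s x = 0}" by blast
next
  fix x assume "x \<in> {x. \<exists>r. x = r *s b \<and> p *s x = 0}"
  then obtain r where r: "x = r *s b" "(p * r) *s b = 0" by auto
  then have "p * p ^ a dvd p * r" using ord_0 by (metis power_Suc)
  then have "p ^ a dvd r" using p_nz[of 1] by (simp add: dvd_times_left_cancel_iff)
  then obtain s where "r = s * p ^ a" by (metis dvd_def mult.commute)
  then show "x \<in> {r *s (p ^ a *s b) | r. True}" using r by auto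
qed

lemma card_socle: "card {r *s (p ^ a *s b) | r. True} = CARD('a) ^ d"
proof -
  have "{r *s (p ^ a *s b) | r. True} = adjoin {0} (p ^ a *s b)"
    by (auto simp: adjoin_def)
  moreover have "r *s (p ^ a *s b) \<in> {0} \<longleftrightarrow> p dvd r" for r
  proof -
    have "r *s (p ^ a *s b) \<in> {0} \<longleftrightarrow> p ^ Suc a dvd r * p ^ a"
      using ord_0[of "r * p ^ a"] by simp
    also have "\<dots> \<longleftrightarrow> p ^ a * p dvd p ^ a * r" by (simp add: mult_ac)
    also have "\<dots> \<longleftrightarrow> p dvd r" using p_nz1 by (simp add: dvd_times_left_cancel_iff)
    finally show ?thesis .
  qed
  ultimately show ?thesis
    using card_adjoin(2)[of "{0}" "p ^ a *s b" p] p_nz1 by simp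
qed

text \<open>The coefficient \<open>r\<close> is determined only modulo p^(a+1), hence the
  description. The value is unique because the components m and r b are, and it equals m + p (r
  b).\<close>

definition \<phi> where "\<phi> x = (THE y. \<exists>m\<in>M'. \<exists>r. x = m + r *s b \<and> y = m + r *s (p *s b))"

lemma \<phi>: "m \<in> M' \<Longrightarrow> \<phi> (m + r *s b) = m + r *s (p *s b)"
  unfolding \<phi>_def
proof (rule the_equality)
  fix y assume m: "m \<in> M'" and "\<exists>m'\<in>M'. \<exists>r'. m + r *s b = m' + r' *s b \<and> y = m' + r' *s (p *s b)"
  then obtain m' r' where m': "m' \<in> M'" "m + r *s b = m' + r' *s b" "y = m' + r' *s (p *s b)"
    by blast
  then have "m = m'" "p *s (r *s b) = p *s (r' *s b)" using indep[OF m m'(1)] by auto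
  then show "y = m + r *s (p *s b)" using m'(3) by (simp add: mult_ac)
qed blast

lemma gf_above_socle:
  "(\<Sum>W | W \<in> subspaces_of M \<and> p ^ a *s b \<in> W. monom 1 (dm W)) = monom 1 d * gf N"
proof -
  have dec: "\<exists>m\<in>M'. \<exists>r. x = m + r *s b" if "x \<in> M" for x
    using that unfolding M_def by (elim adjoinE) blast
  have im: "\<phi> ` M = N"
  proof (intro equalityI subsetI)
    fix y assume "y \<in> \<phi> ` M"
    then obtain m r where "m \<in> M'" "y = m + r *s (p *s b)" using dec \<phi> by blast
    then show "y \<in> N" unfolding N_def using adjoinI by blast
  next
    fix y assume "y \<in> N"
    then obtain m r where m: "m \<in> M'" "y = m + r *s (p *s b)" unfolding N_def by (elim adjoinE)
    then have "y = \<phi> (m + r *s b)" using \<phi> by simp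
    then show "y \<in> \<phi> ` M" using m(1) unfolding M_def by (blast intro: adjoinI)
  qed
  have ker: "{x \<in> M. \<phi> x = 0} = {r *s (p ^ a *s b) | r. True}"
    unfolding socle
  proof (intro equalityI subsetI)
    fix x assume "x \<in> {x \<in> M. \<phi> x = 0}"
    then obtain m r where m: "m \<in> M'" "x = m + r *s b" "m + (r * p) *s b = 0 + 0 *s b"
      using dec \<phi> by force
    then have "m = 0" "(r * p) *s b = 0 *s b"
      using indep[OF m(1) subspace_0[OF sub]] by blast+
    then show "x \<in> {x. \<exists>r. x = r *s b \<and> p *s x = 0}"
      using m(2) by (auto simp: mult.commute)
  next
    fix x assume "x \<in> {x. \<exists>r. x = r *s b \<and> p *s x = 0}"
    then obtain r where r: "x = 0 + r *s b" "p *s x = 0" by auto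
    have "\<phi> x = 0 + r *s (p *s b)" unfolding r(1) by (rule \<phi>[OF subspace_0[OF sub]])
    also have "\<dots> = p *s x" using r(1) by (simp add: mult.commute)
    finally show "x \<in> {x \<in> M. \<phi> x = 0}" using r b_M[of r] by simp
  qed
  have eq: "{x \<in> M. \<phi> x = 0} \<subseteq> W \<longleftrightarrow> p ^ a *s b \<in> W" if "W \<in> subspaces_of M" for W
  proof
    assume "{x \<in> M. \<phi> x = 0} \<subseteq> W"
    moreover have "1 *s (p ^ a *s b) \<in> {r *s (p ^ a *s b) | r. True}" by blast
    ultimately show "p ^ a *s b \<in> W" unfolding ker by auto
  next
    assume "p ^ a *s b \<in> W"
    then show "{x \<in> M. \<phi> x = 0} \<subseteq> W"
      unfolding ker using subspace_scale[OF subspaces_ofD(1)[OF that]] by blast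
  qed
  have "(\<Sum>W | W \<in> subspaces_of M \<and> {x \<in> M. \<phi> x = 0} \<subseteq> W. monom 1 (dm W)) =
    monom 1 d * gf (\<phi> ` M)"
  proof (rule gf_kernel[OF subM finM])
    fix x y assume "x \<in> M" "y \<in> M"
    then obtain m r m' r' where x: "m \<in> M'" "x = m + r *s b" and y: "m' \<in> M'" "y = m' + r' *s b"
      using dec by blast
    then have "x + y = (m + m') + (r + r') *s b"
      by (simp add: scale_left_distrib algebra_simps)
    then have "\<phi> (x + y) = (m + m') + (r + r') *s (p *s b)"
      using \<phi>[OF subspace_add[OF sub x(1) y(1)]] by simp
    then show "\<phi> (x + y) = \<phi> x + \<phi> y"
      using \<phi>[OF x(1), of r] \<phi>[OF y(1), of r'] x(2) y(2)
      by (simp add: scale_left_distrib algebra_simps)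
  next
    fix c x assume "x \<in> M"
    then obtain m r where x: "m \<in> M'" "x = m + r *s b" using dec by blast
    then have "c *s x = c *s m + (c * r) *s b" by (simp add: scale_right_distrib)
    then have "\<phi> (c *s x) = c *s m + (c * r) *s (p *s b)"
      using \<phi>[OF subspace_scale[OF sub x(1)]] by simp
    then show "\<phi> (c *s x) = c *s \<phi> x"
      using \<phi>[OF x(1), of r] x(2) by (simp add: scale_right_distrib mult.assoc)
  next
    show "card {x \<in> M. \<phi> x = 0} = CARD('a) ^ d" unfolding ker by (rule card_socle)
  qed
  also have "{W. W \<in> subspaces_of M \<and> {x \<in> M. \<phi> x = 0} \<subseteq> W} =
      {W. W \<in> subspaces_of M \<and> p ^ a *s b \<in> W}"
    using eq by blast
  finally show ?thesis by (simp only: im)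
qed

end

section \<open>Submodules not contained in N, sorted by their intersection with M'\<close>

context cyclic_summand
begin

lemma M_E:
  assumes "x \<in> M"
  obtains m r where "m \<in> M'" "x = m + r *s b"
  using assms unfolding M_def by (elim adjoinE)

text \<open>Some w in \<open>W\<close> has a b-coefficient prime to p, as otherwise it would lie in
  \<open>N\<close>. Multiplying by an inverse modulo p^(a+1), the order of b, turns this coefficient
  into 1.\<close>

lemma not_N_contains:
  assumes W: "W \<in> subspaces_of M" "\<not> W \<subseteq> N"
  obtains x where "x \<in> M'" "b + x \<in> W"
proof -
  obtain w where w: "w \<in> W" "w \<notin> N" using W by blast
  obtain m r where m: "m \<in> M'" "w = m + r *s b"
    using w(1) subspaces_ofD(2)[OF W(1)] M_E by blast
  have "\<not> p dvd r"
  proof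
    assume "p dvd r"
    then obtain s where "r = s * p" by (metis dvd_def mult.commute)
    then have "w = m + s *s (p *s b)" using m by simp
    then show False using w(2) m(1) adjoinI unfolding N_def by blast
  qed
  then obtain u v where uv: "u * r + v * p ^ Suc a = 1" using bezout_p by blast
  have "u *s w = u *s m + (u * r) *s b" using m by (simp add: scale_right_distrib)
  also have "(u * r) *s b = (u * r) *s b + (v * p ^ Suc a) *s b"
    using kill_dvd(1)[of "v * p ^ Suc a"] by simp
  also have "\<dots> = b" by (simp only: uv scale_one flip: scale_left_distrib)
  finally have "b + u *s m = u *s w" by (simp add: add.commute)
  then show thesis
    using that[of "u *s m"] subspace_scale[OF sub m(1)]
      subspace_scale[OF subspaces_ofD(1)[OF W(1)] w(1)] by metis
qed

text \<open>Subtracting r (b + x) from w = m + r b cancels the b-component and leaves an element of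
  both \<open>W\<close> and M'.\<close>

lemma not_N_eq:
  assumes W: "W \<in> subspaces_of M" and x: "x \<in> M'" "b + x \<in> W"
  shows "W = adjoin (W \<inter> M') (b + x)"
proof
  note sW = subspaces_ofD(1)[OF W]
  show "W \<subseteq> adjoin (W \<inter> M') (b + x)"
  proof
    fix w assume w: "w \<in> W"
    obtain m r where m: "m \<in> M'" "w = m + r *s b"
      using w subspaces_ofD(2)[OF W] M_E by blast
    have "w - r *s (b + x) \<in> W"
      by (rule subspace_diff[OF sW w subspace_scale[OF sW x(2)]])
    moreover have "w - r *s (b + x) = m - r *s x"
      using m(2) by (simp add: scale_right_distrib)
    then have "w - r *s (b + x) \<in> M'"
      using subspace_diff[OF sub m(1) subspace_scale[OF sub x(1)]] by metis
    ultimately show "w \<in> adjoin (W \<inter> M') (b + x)"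
      using adjoinI[of "w - r *s (b + x)" "W \<inter> M'" r "b + x"] by simp
  qed
  show "adjoin (W \<inter> M') (b + x) \<subseteq> W"
    by (rule adjoin_least[OF sW _ x(2)]) simp
qed

lemma b_plus:
  assumes x: "x \<in> M'"
  shows "r *s (b + x) \<in> M' \<longleftrightarrow> p ^ Suc a dvd r" "p ^ Suc a dvd r \<Longrightarrow> r *s (b + x) = 0"
proof -
  show "p ^ Suc a dvd r \<Longrightarrow> r *s (b + x) = 0"
    using kill_dvd(1)[of r] kill_dvd(2)[OF _ x, of r] by (simp add: scale_right_distrib)
  show "r *s (b + x) \<in> M' \<longleftrightarrow> p ^ Suc a dvd r"
    using subspace_add_cancel(2)[OF sub subspace_scale[OF sub x], of "r *s b" r] ord
    by (simp only: scale_right_distrib)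
qed

text \<open>As p^(a+1) kills x as well as b, the element b + x has the order of b and its multiples
  meet M' only in 0. So every x in M' is admissible, and the size of the result depends on
  \<open>K\<close> alone.\<close>

lemma adjoin_b_plus:
  assumes K: "K \<in> subspaces_of M'" and x: "x \<in> M'"
  shows "adjoin K (b + x) \<in> subspaces_of M" "\<not> adjoin K (b + x) \<subseteq> N"
    "adjoin K (b + x) \<inter> M' = K" "card (adjoin K (b + x)) = card K * CARD('a) ^ (d * Suc a)"
proof -
  note sK = subspaces_ofD[OF K]
  have bx: "b + x \<in> M"
    using subspace_add[OF subM _ subsetD[OF M'_M x], of b] b_M[of 1] by simp
  show "adjoin K (b + x) \<in> subspaces_of M"
    unfolding subspaces_of_def using subspace_adjoin[OF sK(1)] adjoin_least[OF subM _ bx, of K] sK(2) M'_M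
    by blast
  have ord_K: "r *s (b + x) \<in> K \<longleftrightarrow> p ^ Suc a dvd r" for r
    using b_plus[OF x, of r] sK(2) subspace_0[OF sK(1)] by auto
  show "card (adjoin K (b + x)) = card K * CARD('a) ^ (d * Suc a)"
    unfolding degree_p_power[symmetric]
    by (rule card_adjoin[OF sK(1) finite_subset[OF sK(2) fin] ord_K p_nz])
  show "adjoin K (b + x) \<inter> M' = K"
  proof (intro equalityI subsetI)
    fix y assume y: "y \<in> adjoin K (b + x) \<inter> M'"
    then obtain l r where l: "l \<in> K" "y = l + r *s (b + x)" by (blast elim: adjoinE)
    then have "r *s (b + x) \<in> M'"
      using y sK(2) subspace_add_cancel(1)[OF sub, of l] by blast
    then have "r *s (b + x) = 0" using b_plus[OF x] by blast
    then show "y \<in> K" using l by simp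
  qed (use sK(2) adjoin_superset in auto)
  \<comment> \<open>If b were in \<open>N\<close>, then p^(a+1) would divide some 1 - r p, and p
    would be a unit.\<close>
  show "\<not> adjoin K (b + x) \<subseteq> N"
  proof
    assume "adjoin K (b + x) \<subseteq> N"
    then have "b + x \<in> N" using adjoin_mem1[OF sK(1)] by blast
    then have "b \<in> N" using subspace_add_cancel(2)[OF subN subsetD[OF M'_N x]] by blast
    then obtain m r where m: "m \<in> M'" "b = m + r *s (p *s b)" unfolding N_def by (elim adjoinE)
    then have "0 + 1 *s b = m + (r * p) *s b" by simp
    then have "1 *s b = (r * p) *s b" using indep[OF subspace_0[OF sub] m(1)] by blast
    then have "(1 - r * p) *s b = 0" by (simp only: scale_left_diff_distrib) simp
    then have "p ^ Suc a dvd 1 - r * p" using ord_0 by blast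
    then have "p dvd 1 - r * p" by (metis dvd_mult_left power_Suc)
    then have "p dvd 1" by (metis dvd_diffD1 dvd_diff_commute dvd_triv_right diff_add_cancel dvd_add)
    then show False using irred irreducible_not_unit by blast
  qed
qed

lemma gf_not_N:
  "(\<Sum>W | W \<in> subspaces_of M \<and> \<not> W \<subseteq> N. monom 1 (dm W)) =
    monom 1 (d * Suc a) * (\<Sum>K\<in>subspaces_of M'. monom (int (card M' div card K)) (dm K))"
proof -
  define F where "F = {W. W \<in> subspaces_of M \<and> \<not> W \<subseteq> N}"
  have finF: "finite F" unfolding F_def using finite_subspaces_of[OF finM] by simp
  have dim: "dm W = dm (W \<inter> M') + d * Suc a" and int: "W \<inter> M' \<in> subspaces_of M'" if "W \<in> F" for W
  proof -
    obtain x where x: "x \<in> M'" "b + x \<in> W" using \<open>W \<in> F\<close> not_N_contains unfolding F_def by blast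
    show K: "W \<inter> M' \<in> subspaces_of M'"
      using \<open>W \<in> F\<close> subspace_inter sub by (auto simp: F_def subspaces_of_def)
    have "W = adjoin (W \<inter> M') (b + x)"
      using \<open>W \<in> F\<close> x by (intro not_N_eq) (auto simp: F_def)
    then have "card W = card (W \<inter> M') * CARD('a) ^ (d * Suc a)"
      using adjoin_b_plus(4)[OF K x(1)] by metis
    then show "dm W = dm (W \<inter> M') + d * Suc a"
      using K fin by (intro dm_mult subspaces_ofD(1)[OF K]) auto
  qed
  have count: "card {W \<in> F. W \<inter> M' = K} = card M' div card K" if K: "K \<in> subspaces_of M'" for K
  proof -
    note sK = subspaces_ofD[OF K]
    have "{W \<in> F. W \<inter> M' = K} = (\<lambda>x. adjoin K (b + x)) ` M'"
    proof (intro equalityI subsetI)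
      fix W assume W: "W \<in> {W \<in> F. W \<inter> M' = K}"
      then obtain x where x: "x \<in> M'" "b + x \<in> W" using not_N_contains unfolding F_def by blast
      then have "W = adjoin K (b + x)" using not_N_eq[of W x] W unfolding F_def by blast
      then show "W \<in> (\<lambda>x. adjoin K (b + x)) ` M'" using x by blast
    qed (use adjoin_b_plus[OF K] in \<open>auto simp: F_def\<close>)
    moreover have "card M' = card K * card ((\<lambda>x. adjoin K (b + x)) ` M')"
    proof (rule card_image_fibres[OF fin])
      fix x assume x: "x \<in> M'"
      \<comment> \<open>Two elements x and x' give the same submodule exactly when x' - x lies in
        \<open>K\<close>.\<close>
      have "{x' \<in> M'. adjoin K (b + x') = adjoin K (b + x)} = (\<lambda>k. x + k) ` K"
      proof (intro equalityI subsetI)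
        fix x' assume "x' \<in> {x' \<in> M'. adjoin K (b + x') = adjoin K (b + x)}"
        then have x': "x' \<in> M'" "b + x' \<in> adjoin K (b + x)" "b + x \<in> adjoin K (b + x)"
          using adjoin_mem1[OF sK(1)] by blast+
        then have "(b + x') - (b + x) \<in> adjoin K (b + x)"
          by (intro subspace_diff subspace_adjoin sK(1))
        moreover have "(b + x') - (b + x) = x' - x" by simp
        moreover have "x' - x \<in> M'" using subspace_diff[OF sub x'(1) x] .
        ultimately have "x' - x \<in> K" using adjoin_b_plus(3)[OF K x] by auto
        then show "x' \<in> (\<lambda>k. x + k) ` K" by (intro image_eqI[of _ _ "x' - x"]) auto
      next
        fix x' assume "x' \<in> (\<lambda>k. x + k) ` K"
        then obtain k where k: "k \<in> K" "x' = x + k" by blast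
        then have x': "x' \<in> M'" using subspace_add[OF sub x] sK(2) by blast
        have "b + x' \<in> adjoin K (b + x)"
          using adjoinI[OF k(1), of 1 "b + x"] k(2) by (simp add: ac_simps)
        then have "adjoin K (b + x) = adjoin (adjoin K (b + x) \<inter> M') (b + x')"
          using not_N_eq[OF adjoin_b_plus(1)[OF K x] x'] by blast
        then show "x' \<in> {x' \<in> M'. adjoin K (b + x') = adjoin K (b + x)}"
          using x' adjoin_b_plus(3)[OF K x] by simp
      qed
      then show "card {x' \<in> M'. adjoin K (b + x') = adjoin K (b + x)} = card K"
        by (simp add: card_image)
    qed
    moreover have "card K > 0"
      using finite_subset[OF sK(2) fin] subspace_0[OF sK(1)] by (auto simp: card_gt_0_iff)
    ultimately show ?thesis by simp
  qed
  have "(\<Sum>W\<in>F. monom 1 (dm W)) =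
      (\<Sum>K\<in>subspaces_of M'. \<Sum>W\<in>{W \<in> F. W \<inter> M' = K}. monom (1::int) (dm W))"
    using int by (intro sum.group[symmetric] finF finite_subspaces_of fin) auto
  also have "\<dots> = (\<Sum>K\<in>subspaces_of M'. monom 1 (d * Suc a) * monom (int (card M' div card K)) (dm K))"
  proof (rule sum.cong[OF refl])
    fix K assume K: "K \<in> subspaces_of M'"
    have "(\<Sum>W\<in>{W \<in> F. W \<inter> M' = K}. monom (1::int) (dm W)) =
        (\<Sum>W\<in>{W \<in> F. W \<inter> M' = K}. monom 1 (dm K + d * Suc a))"
      using dim by (intro sum.cong) auto
    also have "\<dots> = monom 1 (d * Suc a) * monom (int (card M' div card K)) (dm K)"
      unfolding sum_constant count[OF K]
      by (simp add: mult_monom of_nat_monom add.commute)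
    finally show "(\<Sum>W\<in>{W \<in> F. W \<inter> M' = K}. monom (1::int) (dm W)) =
      monom 1 (d * Suc a) * monom (int (card M' div card K)) (dm K)" .
  qed
  finally show ?thesis unfolding F_def by (simp only: sum_distrib_left)
qed

end

section \<open>Submodules meeting R b trivially\<close>

context cyclic_summand
begin

lemma pab_notin: "p ^ a *s b \<notin> M'"
proof
  assume "p ^ a *s b \<in> M'"
  then have "p ^ a * p dvd p ^ a * 1" using ord[of "p ^ a"] by (simp add: mult.commute)
  then have "p dvd 1" using dvd_times_left_cancel_iff[OF p_nz[of a], of p 1] by blast
  then show False using irred irreducible_not_unit by blast
qed

lemma mem_iff_dvd:
  assumes "subspace W" "p ^ a *s b \<notin> W"
  shows "r *s b \<in> W \<longleftrightarrow> p ^ Suc a dvd r"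
proof (rule exact_order[OF assms(1) _ assms(2)])
  show "p ^ Suc a *s b \<in> W" using subspace_0[OF assms(1)] by (simp only: kill_b)
qed

lemma mem_imp_0:
  assumes "subspace W" "p ^ a *s b \<notin> W" "r *s b \<in> W"
  shows "r *s b = 0"
  using mem_iff_dvd[OF assms(1,2)] assms(3) kill_dvd(1) by blast

text \<open>The complements of \<open>R b\<close> in \<open>L + R b\<close>: as every non-zero submodule of \<open>R b\<close> contains \<open>p ^ a b\<close>,
  the second condition says that \<open>W \<inter> R b = 0\<close>.\<close>

definition compl :: "'b set \<Rightarrow> 'b set set" where
  "compl L = {W. subspace W \<and> p ^ a *s b \<notin> W \<and> adjoin W b = adjoin L b}"

lemma complD:
  assumes "W \<in> compl L"
  shows "subspace W" "p ^ a *s b \<notin> W" "adjoin W b = adjoin L b" "W \<subseteq> adjoin L b"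
  using assms adjoin_superset[of W b] unfolding compl_def by auto

text \<open>Both \<open>W\<close> and \<open>L\<close> have quotient R/(p^(a+1)) in the same module
  \<open>adjoin L b\<close>.\<close>

lemma card_compl_mem:
  assumes L: "subspace L" "L \<subseteq> M'" and W: "W \<in> compl L"
  shows "card W = card L"
proof -
  have "L \<subseteq> M" using L(2) M'_M by blast
  then have "adjoin L b \<subseteq> M" using adjoin_least[OF subM, of L b] b_M[of 1] by simp
  then have finW: "finite W" using complD(4)[OF W] finM by (meson rev_finite_subset subset_trans)
  have pL: "p ^ a *s b \<notin> L" using pab_notin L(2) by blast
  have "card (adjoin W b) = card W * CARD('a) ^ degree (p ^ Suc a)"
    by (rule card_adjoin[OF complD(1)[OF W] finW mem_iff_dvd[OF complD(1,2)[OF W]] p_nz])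
  moreover have "card (adjoin L b) = card L * CARD('a) ^ degree (p ^ Suc a)"
    by (rule card_adjoin[OF L(1) finite_subset[OF L(2) fin] mem_iff_dvd[OF L(1) pL] p_nz])
  ultimately show ?thesis by (simp add: complD(3)[OF W])
qed

lemma compl_zero: "compl {0} = {{0}}"
proof (intro equalityI subsetI)
  fix W assume W: "W \<in> compl {0}"
  have "w = 0" if w: "w \<in> W" for w
  proof -
    obtain l r where "l \<in> {0}" "w = l + r *s b"
      using complD(4)[OF W] w by (blast elim: adjoinE)
    then show ?thesis using mem_imp_0[OF complD(1,2)[OF W]] w by simp
  qed
  then show "W \<in> {{0}}" using subspace_0[OF complD(1)[OF W]] by blast
next
  fix W :: "'b set" assume "W \<in> {{0}}"
  then show "W \<in> compl {0}" using pab_notin subspace_0[OF sub] unfolding compl_def by auto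
qed

lemma adjoin_M'_cancel:
  assumes L: "subspace L" "L \<subseteq> M'" and x: "x \<in> M'" "x \<in> adjoin L b"
  shows "x \<in> L"
proof -
  obtain l r where l: "l \<in> L" "x = l + r *s b" using x(2) by (elim adjoinE)
  then have "x + 0 *s b = l + r *s b" by simp
  then have "x = l" using indep[of x l 0 r] x(1) L(2) l(1) by blast
  then show ?thesis using l(1) by simp
qed

text \<open>The generator x is moved along R b to some y with p y in \<open>W\<close>. If r y lies
  in L + R b, then p divides r, because x has order p modulo \<open>L\<close>; so r y is already in
  \<open>W\<close>. The extension therefore meets L + R b in \<open>W\<close> alone and, in
  particular, avoids p^a b.\<close>

lemma compl_step:
  assumes L: "subspace L" "L \<subseteq> M'" and x: "x \<in> M'" "x \<notin> L" "p *s x \<in> L"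
    and W: "W \<in> compl L" and y: "p *s (x + s *s b) \<in> W"
  shows "adjoin W (x + s *s b) \<in> compl (adjoin L x)"
    "adjoin W (x + s *s b) \<inter> adjoin L b = W"
proof -
  let ?A = "adjoin L b" and ?y = "x + s *s b"
  let ?V = "adjoin W ?y"
  note sW = complD(1)[OF W]
  have sA: "subspace ?A" and bA: "b \<in> ?A" and WA: "W \<subseteq> ?A"
    using subspace_adjoin[OF L(1)] adjoin_mem1[OF L(1)] complD(4)[OF W] by blast+
  have order: "r *s x \<in> L \<longleftrightarrow> p dvd r" for r
    using exact_order[OF L(1), of 0 x r] x by simp
  have mult: "r *s ?y \<in> W" if "r *s ?y \<in> ?A" for r
  proof -
    have "r *s x + (r * s) *s b \<in> ?A" using that by (simp add: scale_right_distrib)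
    then have "r *s x \<in> ?A"
      using subspace_add_cancel(2)[OF sA subspace_scale[OF sA bA, of "r * s"]] by blast
    then have "r *s x \<in> L" by (rule adjoin_M'_cancel[OF L subspace_scale[OF sub x(1)]])
    then obtain t where "r = t * p" using order by (metis dvd_def mult.commute)
    then have "r *s ?y = t *s (p *s ?y)" by (simp only: scale_scale)
    then show ?thesis using subspace_scale[OF sW y] by metis
  qed
  show int: "?V \<inter> ?A = W"
  proof (intro equalityI subsetI)
    fix v assume v: "v \<in> ?V \<inter> ?A"
    then obtain w r where w: "w \<in> W" "v = w + r *s ?y" by (blast elim: adjoinE)
    then have "r *s ?y \<in> ?A" using v WA subspace_add_cancel(1)[OF sA, of w] by blast
    then show "v \<in> W" using subspace_add[OF sW w(1) mult] w(2) by blast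
  qed (use WA adjoin_superset in blast)
  let ?B = "adjoin (adjoin L x) b"
  have sB: "subspace ?B" and bB: "r *s b \<in> ?B" and LB: "adjoin L x \<subseteq> ?B" for r
    using subspace_adjoin[OF subspace_adjoin[OF L(1)]] adjoin_mem[OF subspace_adjoin[OF L(1)]]
      adjoin_superset by blast+
  have xB: "x \<in> ?B" using LB adjoin_mem1[OF L(1)] by blast
  have AB: "?A \<subseteq> ?B"
    using adjoin_least[OF sB, of L b] LB adjoin_superset[of L x] bB[of 1] by simp
  have sV: "subspace ?V" by (rule subspace_adjoin[OF sW])
  let ?C = "adjoin ?V b"
  have sC: "subspace ?C" and bC: "r *s b \<in> ?C" and VC: "?V \<subseteq> ?C" for r
    using subspace_adjoin[OF sV] adjoin_mem[OF sV] adjoin_superset by blast+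
  have "?C = ?B"
  proof
    have "?y \<in> ?B" by (rule subspace_add[OF sB xB bB])
    then have "?V \<subseteq> ?B" using adjoin_least[OF sB, of W ?y] WA AB by blast
    then show "?C \<subseteq> ?B" using adjoin_least[OF sB, of ?V b] bB[of 1] by simp
    have "?y - s *s b \<in> ?C"
      by (rule subspace_diff[OF sC subsetD[OF VC adjoin_mem1[OF sW]] bC])
    then have xC: "x \<in> ?C" by simp
    have "?A \<subseteq> ?C"
      unfolding complD(3)[OF W, symmetric]
      using adjoin_least[OF sC, of W b] adjoin_superset[of W ?y] VC bC[of 1] by simp
    then have "L \<subseteq> ?C" using adjoin_superset by blast
    then have "adjoin L x \<subseteq> ?C" by (rule adjoin_least[OF sC _ xC])
    then show "?B \<subseteq> ?C" using adjoin_least[OF sC, of "adjoin L x" b] bC[of 1] by simp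
  qed
  moreover have "p ^ a *s b \<notin> ?V"
    using int complD(2)[OF W] subspace_scale[OF sA bA, of "p ^ a"] by blast
  ultimately show "?V \<in> compl (adjoin L x)" unfolding compl_def using sV by blast
qed

text \<open>Dedekind's modular law: if l = w + r b with w in \<open>W\<close>, then w = l - r b lies
  in the intersection.\<close>

lemma compl_restrict:
  assumes L: "subspace L" "L \<subseteq> M'" and W: "W \<in> compl (adjoin L x)"
  shows "W \<inter> adjoin L b \<in> compl L"
proof -
  let ?A = "adjoin L b"
  have sA: "subspace ?A" and bA: "r *s b \<in> ?A" for r
    using subspace_adjoin[OF L(1)] adjoin_mem[OF L(1)] by blast+
  have sI: "subspace (W \<inter> ?A)" by (rule subspace_inter[OF complD(1)[OF W] sA])
  have "adjoin (W \<inter> ?A) b = ?A"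
  proof
    show "adjoin (W \<inter> ?A) b \<subseteq> ?A" using adjoin_least[OF sA, of "W \<inter> ?A" b] bA[of 1] by simp
    have "L \<subseteq> adjoin (W \<inter> ?A) b"
    proof
      fix l assume l: "l \<in> L"
      then have "l \<in> adjoin W b"
        using complD(3)[OF W] adjoin_superset by blast
      then obtain w r where w: "w \<in> W" "l = w + r *s b" by (elim adjoinE)
      then have "w = l - r *s b" by simp
      then have "w \<in> ?A" using subspace_diff[OF sA subsetD[OF adjoin_superset l] bA] by blast
      then show "l \<in> adjoin (W \<inter> ?A) b" using w adjoinI[of w "W \<inter> ?A" r b] by simp
    qed
    then show "?A \<subseteq> adjoin (W \<inter> ?A) b"
      by (intro adjoin_least subspace_adjoin sI adjoin_mem1)
  qed
  then show ?thesis unfolding compl_def using sI complD(2)[OF W] by blast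
qed

text \<open>Let p x = w + r b. Multiplication by p^a kills the left side, because p^(a+1) x = 0, so
  p^a r b lies in \<open>W\<close> and p divides r. The required shift is s = -r/p.\<close>

lemma compl_base:
  assumes L: "subspace L" "L \<subseteq> M'" and x: "x \<in> M'" "p *s x \<in> L" and W: "W \<in> compl L"
  obtains s where "p *s (x + s *s b) \<in> W"
proof -
  have "p *s x \<in> adjoin W b" using x(2) complD(3)[OF W] adjoin_superset by blast
  then obtain w r where w: "w \<in> W" "p *s x = w + r *s b" by (elim adjoinE)
  have "p ^ a *s (p *s x) = 0" using kill[OF x(1)] by (simp add: mult.commute)
  then have "(p ^ a * r) *s b = - (p ^ a *s w)"
    using w(2) by (simp add: scale_right_distrib eq_neg_iff_add_eq_0 add.commute)
  moreover have "- (p ^ a *s w) \<in> W"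
    using complD(1)[OF W] w(1) by (intro subspace_neg subspace_scale)
  ultimately have "p ^ Suc a dvd p ^ a * r" using mem_iff_dvd[OF complD(1,2)[OF W]] by metis
  then have "p ^ a * p dvd p ^ a * r" by (simp add: mult.commute)
  then have "p dvd r" using p_nz1 by (simp add: dvd_times_left_cancel_iff)
  then obtain s where s: "r = p * s" ..
  have "p *s (x + (- s) *s b) = w"
    using w(2) s by (simp add: scale_right_diff_distrib)
  then show thesis using that[of "- s"] w(1) by metis
qed

text \<open>An extension of \<open>W\<close> is generated over \<open>W\<close> by a lift x + t b of
  x with p (x + t b) in \<open>W\<close>. Two such lifts differ by an element of the socle of R b,
  and different lifts give different extensions because \<open>W\<close> meets R b trivially. Hence
  there are as many as socle elements.\<close>

lemma compl_fibre:
  assumes L: "subspace L" "L \<subseteq> M'" and x: "x \<in> M'" "x \<notin> L" "p *s x \<in> L"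
    and W: "W \<in> compl L"
  shows "card {V \<in> compl (adjoin L x). V \<inter> adjoin L b = W} = CARD('a) ^ d"
proof -
  let ?A = "adjoin L b" and ?S = "{r *s (p ^ a *s b) | r. True}"
  note sW = complD(1)[OF W]
  have sA: "subspace ?A" and bA: "r *s b \<in> ?A" and LA: "L \<subseteq> ?A" for r
    using subspace_adjoin[OF L(1)] adjoin_mem[OF L(1)] adjoin_superset by blast+
  obtain s where s: "p *s (x + s *s b) \<in> W" using compl_base[OF L x(1,3) W] .
  define y where "y = x + s *s b"
  have shift: "\<exists>t. y + e = x + t *s b \<and> p *s (x + t *s b) \<in> W" if "e \<in> ?S" for e
  proof -
    obtain r where r: "e = r *s b" "p *s e = 0" using \<open>e \<in> ?S\<close> unfolding socle by blast
    have "y + e = x + (s + r) *s b"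
      unfolding y_def r(1) by (simp add: scale_left_distrib add.assoc)
    moreover have "p *s (y + e) \<in> W" using s r(2) by (simp add: scale_right_distrib y_def)
    ultimately show ?thesis by metis
  qed
  have "bij_betw (\<lambda>e. adjoin W (y + e)) ?S {V \<in> compl (adjoin L x). V \<inter> ?A = W}"
    unfolding bij_betw_def
  proof (intro conjI inj_onI equalityI subsetI)
    fix e e' assume e: "e \<in> ?S" "e' \<in> ?S" and eq: "adjoin W (y + e) = adjoin W (y + e')"
    obtain t where t: "y + e = x + t *s b" "p *s (x + t *s b) \<in> W" using shift[OF e(1)] by blast
    have "(y + e) - (y + e') \<in> adjoin W (y + e)"
      using adjoin_mem1[OF sW, of "y + e"] adjoin_mem1[OF sW, of "y + e'"] eq
      by (intro subspace_diff subspace_adjoin sW) auto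
    then have "e - e' \<in> adjoin W (y + e)" by simp
    moreover have "\<exists>r. e - e' = r *s b"
    proof -
      obtain r r' where "e = r *s b" "e' = r' *s b" using e unfolding socle by blast
      then have "e - e' = (r - r') *s b" by (simp add: scale_left_diff_distrib)
      then show ?thesis ..
    qed
    then obtain r where r: "e - e' = r *s b" ..
    moreover have "r *s b \<in> ?A" by (rule bA)
    ultimately have "r *s b \<in> W" using compl_step(2)[OF L x W t(2)] t(1) by auto
    then have "r *s b = 0" by (rule mem_imp_0[OF complD(1,2)[OF W]])
    then show "e = e'" using r by simp
  next
    fix V assume "V \<in> (\<lambda>e. adjoin W (y + e)) ` ?S"
    then obtain e where e: "e \<in> ?S" "V = adjoin W (y + e)" by blast
    obtain t where t: "y + e = x + t *s b" "p *s (x + t *s b) \<in> W" using shift[OF e(1)] by blast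
    show "V \<in> {V \<in> compl (adjoin L x). V \<inter> ?A = W}"
      unfolding e(2) t(1) using compl_step[OF L x W t(2)] by blast
  next
    fix V assume "V \<in> {V \<in> compl (adjoin L x). V \<inter> ?A = W}"
    then have V: "V \<in> compl (adjoin L x)" "V \<inter> ?A = W" by auto
    note sV = complD(1)[OF V(1)]
    have "x \<in> adjoin V b"
      unfolding complD(3)[OF V(1)] using adjoin_mem1[OF L(1)] adjoin_superset by blast
    \<comment> \<open>The component of x in \<open>V\<close> serves as generator. Its difference
      \<open>e\<close> from \<open>y\<close> is a multiple of b, and p e lies in \<open>W\<close>,
      which forces p e = 0.\<close>
    then obtain w r where w: "w \<in> V" "x = w + r *s b" by (elim adjoinE)
    have "p *s w = p *s x - (p * r) *s b" using w(2) by (simp add: scale_right_distrib)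
    then have "p *s w \<in> ?A" using subspace_diff[OF sA subsetD[OF LA x(3)] bA] by metis
    then have pw: "p *s w \<in> W" using V(2) subspace_scale[OF sV w(1)] by blast
    define e where "e = w - y"
    have eb: "e = (- r - s) *s b"
      unfolding e_def y_def using w(2) by (simp add: scale_left_diff_distrib)
    have "p *s e = (p * (- r - s)) *s b" unfolding eb by simp
    moreover have "p *s e \<in> W"
      unfolding e_def using subspace_diff[OF sW pw s] by (simp add: scale_right_diff_distrib y_def)
    ultimately have "p *s e = 0" using mem_imp_0[OF complD(1,2)[OF W]] by metis
    then have eS: "e \<in> ?S" unfolding socle using eb by blast
    have ye: "y + e = w" by (simp add: e_def)
    have "V = adjoin W (y + e)"
      unfolding ye
    proof
      show "adjoin W w \<subseteq> V" using adjoin_least[OF sV _ w(1), of W] V(2) by blast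
      show "V \<subseteq> adjoin W w"
      proof
        fix v assume v: "v \<in> V"
        obtain m t where m: "m \<in> adjoin L x" "v = m + t *s b"
          using complD(4)[OF V(1)] v by (blast elim: adjoinE)
        obtain l c where l: "l \<in> L" "m = l + c *s x" using m(1) by (elim adjoinE)
        \<comment> \<open>Removing the x-coordinate of v leaves an element of \<open>V\<close>
          inside L + R b, that is, of \<open>W\<close>.\<close>
        have "v - c *s w \<in> V" by (rule subspace_diff[OF sV v subspace_scale[OF sV w(1)]])
        moreover have "v - c *s w = l + (c * r + t) *s b"
          using m(2) l(2) w(2) by (simp add: scale_right_distrib scale_left_distrib)
        then have "v - c *s w \<in> ?A" using adjoinI[OF l(1)] by metis
        ultimately have "v - c *s w \<in> W" using V(2) by blast
        then show "v \<in> adjoin W w" using adjoinI[of "v - c *s w" W c w] by simp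
      qed
    qed
    then show "V \<in> (\<lambda>e. adjoin W (y + e)) ` ?S" using eS by blast
  qed
  from bij_betw_same_card[OF this, unfolded card_socle] show ?thesis ..
qed

text \<open>Complements correspond to homomorphisms from \<open>L\<close> to R/(p^(a+1)), and a
  module killed by p^(a+1) has as many of these as elements. The induction counts them directly:
  adding a copy of R/(p) to \<open>L\<close> multiplies both sides by q^d.\<close>

lemma card_compl:
  assumes "subspace L" "L \<subseteq> M'"
  shows "card (compl L) = card L"
proof -
  have finite_compl: "finite (compl K)" if "K \<subseteq> M'" for K
  proof -
    have "K \<subseteq> M" using that M'_M by blast
    then have "adjoin K b \<subseteq> M" using adjoin_least[OF subM, of K b] b_M[of 1] by simp
    then have "compl K \<subseteq> Pow M" using complD(4) by blast
    then show ?thesis by (rule finite_subset) (simp add: finM)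
  qed
  show ?thesis
    using assms(1) finite_subset[OF assms(2) fin]
  proof (induction rule: primary_subspace_induct[where k = "Suc a"])
    case (kill x)
    then show ?case using cyclic_summand_axioms assms(2) by (auto dest: cyclic_summand.kill)
  next
    case zero
    show ?case by (simp add: compl_zero)
  next
    case (adjoin K x)
    have K: "subspace K" "K \<subseteq> M'" and x: "x \<in> M'" "x \<notin> K" "p *s x \<in> K"
      using adjoin assms(2) by blast+
    let ?K = "adjoin K x" and ?g = "\<lambda>W. W \<inter> adjoin K b"
    have K': "?K \<subseteq> M'" by (rule adjoin_least[OF sub K(2) x(1)])
    have "?g ` compl ?K = compl K"
    proof (intro equalityI subsetI)
      fix W assume W: "W \<in> compl K"
      obtain s where s: "p *s (x + s *s b) \<in> W" using compl_base[OF K x(1,3) W] .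
      show "W \<in> ?g ` compl ?K"
        using compl_step[OF K x W s] by (intro image_eqI[of _ _ "adjoin W (x + s *s b)"]) simp_all
    qed (use compl_restrict[OF K] in blast)
    moreover have "card (compl ?K) = CARD('a) ^ d * card (?g ` compl ?K)"
      using compl_fibre[OF K x compl_restrict[OF K]]
      by (intro card_image_fibres finite_compl K')
    moreover have "card ?K = card K * CARD('a) ^ d"
    proof (rule card_adjoin[OF K(1) finite_subset[OF K(2) fin] _ p_nz1])
      show "r *s x \<in> K \<longleftrightarrow> p dvd r" for r
        using exact_order[OF K(1), of 0 x r] x by simp
    qed
    ultimately show ?case using adjoin.IH by (simp add: mult.commute)
  qed
qed

text \<open>Put L = (W + R b) \<inter> M'. By the modular law W + R b = L + R b, so \<open>W\<close>
  is one of the complements counted for this \<open>L\<close>.\<close>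

lemma gf_compl:
  "(\<Sum>W | W \<in> subspaces_of M \<and> p ^ a *s b \<notin> W. monom 1 (dm W)) =
    (\<Sum>L\<in>subspaces_of M'. monom (int (card L)) (dm L))"
proof -
  define F where "F = {W. W \<in> subspaces_of M \<and> p ^ a *s b \<notin> W}"
  let ?g = "\<lambda>W. adjoin W b \<inter> M'"
  have finF: "finite F" unfolding F_def using finite_subspaces_of[OF finM] by simp
  have adj_M: "adjoin W b \<subseteq> M" if "W \<subseteq> M" for W
    using adjoin_least[OF subM that, of b] b_M[of 1] by simp
  have g: "?g W \<in> subspaces_of M'" if "W \<in> F" for W
    using that subspace_inter[OF subspace_adjoin sub] unfolding F_def subspaces_of_def by blast
  have fibre: "{W \<in> F. ?g W = L} = compl L" if L: "L \<in> subspaces_of M'" for L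
  proof (intro equalityI subsetI)
    note sL = subspaces_ofD[OF L]
    fix W assume "W \<in> {W \<in> F. ?g W = L}"
    then have W: "subspace W" "W \<subseteq> M" "p ^ a *s b \<notin> W" "?g W = L"
      by (auto simp: F_def subspaces_of_def)
    let ?A = "adjoin W b"
    have sA: "subspace ?A" and bA: "r *s b \<in> ?A" for r
      using subspace_adjoin[OF W(1)] adjoin_mem[OF W(1)] by blast+
    have "?A = adjoin L b"
    proof
      have "W \<subseteq> adjoin L b"
      proof
        fix w assume w: "w \<in> W"
        obtain m r where m: "m \<in> M'" "w = m + r *s b" using W(2) w M_E by blast
        then have "m = w - r *s b" by simp
        then have "m \<in> ?A" using subspace_diff[OF sA subsetD[OF adjoin_superset w] bA] by metis
        then have "m \<in> L" using W(4) m(1) by blast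
        then show "w \<in> adjoin L b" using m(2) adjoinI by blast
      qed
      then show "?A \<subseteq> adjoin L b"
        by (rule adjoin_least[OF subspace_adjoin[OF sL(1)] _ adjoin_mem1[OF sL(1)]])
      have "L \<subseteq> ?A" using W(4) by blast
      then show "adjoin L b \<subseteq> ?A" using adjoin_least[OF sA, of L b] bA[of 1] by simp
    qed
    then show "W \<in> compl L" using W unfolding compl_def by blast
  next
    note sL = subspaces_ofD[OF L]
    fix W assume W: "W \<in> compl L"
    have "W \<subseteq> M" using complD(4)[OF W] adj_M[of L] sL(2) M'_M by blast
    then have "W \<in> F" unfolding F_def subspaces_of_def using complD(1,2)[OF W] by blast
    moreover have "?g W = L"
      unfolding complD(3)[OF W]
      using adjoin_M'_cancel[OF sL] sL(2) adjoin_superset[of L b] by blast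
    ultimately show "W \<in> {W \<in> F. ?g W = L}" by blast
  qed
  have "(\<Sum>W\<in>F. monom 1 (dm W)) =
      (\<Sum>L\<in>subspaces_of M'. \<Sum>W\<in>{W \<in> F. ?g W = L}. monom (1::int) (dm W))"
    using g by (intro sum.group[symmetric] finF finite_subspaces_of fin) auto
  also have "\<dots> = (\<Sum>L\<in>subspaces_of M'. monom (int (card L)) (dm L))"
  proof (rule sum.cong[OF refl])
    fix L assume L: "L \<in> subspaces_of M'"
    \<comment> \<open>\<open>dm\<close> depends only on the cardinality, so all complements have the
      dimension of \<open>L\<close>.\<close>
    have "(\<Sum>W\<in>compl L. monom (1::int) (dm W)) = (\<Sum>W\<in>compl L. monom 1 (dm L))"
      using card_compl_mem[OF subspaces_ofD[OF L]] unfolding dm_def by (intro sum.cong) simp_all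
    also have "\<dots> = monom (int (card L)) (dm L)"
      using card_compl[OF subspaces_ofD[OF L]] by (simp add: of_nat_monom mult_monom)
    finally show "(\<Sum>W\<in>{W \<in> F. ?g W = L}. monom (1::int) (dm W)) = monom (int (card L)) (dm L)"
      using fibre[OF L] by simp
  qed
  finally show ?thesis unfolding F_def .
qed

text \<open>Multiplying the first count by t^d makes its \<open>gf N\<close> term equal to that of
  the second. The exponent d (a + 2) is d (a + 1) from \<open>gf_not_N\<close> plus this d; for the
  part a + 1 it is t^(lambda_1 + 1) with t^d in place of t.\<close>

theorem gf_recurrence:
  "(monom 1 d - 1) * gf M =
    monom 1 (d * Suc (Suc a)) * (\<Sum>K\<in>subspaces_of M'. monom (int (card M' div card K)) (dm K))
    - (\<Sum>L\<in>subspaces_of M'. monom (int (card L)) (dm L))"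
proof -
  let ?w = "\<lambda>W. monom (1::int) (dm W)"
  have split: "gf M = (\<Sum>W | W \<in> subspaces_of M \<and> P W. ?w W) + (\<Sum>W | W \<in> subspaces_of M \<and> \<not> P W. ?w W)" for P
    unfolding gf_def using sum.inter_filter[OF finite_subspaces_of[OF finM], of ?w]
    by (subst sum.union_disjoint[symmetric])
      (auto intro!: sum.cong simp: finite_subspaces_of[OF finM])
  have "{W. W \<in> subspaces_of M \<and> W \<subseteq> N} = subspaces_of N"
    using N_M by (auto simp: subspaces_of_def)
  then have 1: "gf M = gf N + monom 1 (d * Suc a) * (\<Sum>K\<in>subspaces_of M'. monom (int (card M' div card K)) (dm K))"
    using split[of "\<lambda>W. W \<subseteq> N"] gf_not_N by (simp add: gf_def)
  have 2: "gf M = monom 1 d * gf N + (\<Sum>L\<in>subspaces_of M'. monom (int (card L)) (dm L))"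
    using split[of "\<lambda>W. p ^ a *s b \<in> W"] gf_compl gf_above_socle by simp
  have "monom 1 d * gf M = monom 1 d * gf N +
      (monom 1 d * monom 1 (d * Suc a)) * (\<Sum>K\<in>subspaces_of M'. monom (int (card M' div card K)) (dm K))"
    unfolding 1 by (simp only: distrib_left mult.assoc)
  then have "monom 1 d * gf M - gf M =
      (monom 1 d * monom 1 (d * Suc a)) * (\<Sum>K\<in>subspaces_of M'. monom (int (card M' div card K)) (dm K))
      - (\<Sum>L\<in>subspaces_of M'. monom (int (card L)) (dm L))"
    using 2 by (simp only: add_diff_cancel_left)
  moreover have "(monom 1 d - 1) * gf M = monom 1 d * gf M - gf M"
    by (simp only: left_diff_distrib mult_1)
  ultimately have "(monom 1 d - 1) * gf M =
      (monom 1 d * monom 1 (d * Suc a)) * (\<Sum>K\<in>subspaces_of M'. monom (int (card M' div card K)) (dm K))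
      - (\<Sum>L\<in>subspaces_of M'. monom (int (card L)) (dm L))"
    by simp
  also have "monom 1 d * monom (1::int) (d * Suc a) = monom 1 (d * Suc (Suc a))"
    by (simp add: mult_monom)
  finally show ?thesis .
qed

end

section \<open>Types of finite primary modules\<close>

context primary
begin

text \<open>The list grows at its head. Since \<open>cyclic_summand\<close> requires p^(a+1) to kill
  M', every new part is at least as large as those already present.\<close>

inductive htype :: "nat list \<Rightarrow> 'b set \<Rightarrow> bool" where
  Nil: "htype [] {0}"
| Cons: "htype l M' \<Longrightarrow> cyclic_summand scale p a b M' \<Longrightarrow> htype (Suc a # l) (adjoin M' b)"

lemma htype_card:
  assumes "htype l M"
  shows "card M = CARD('a) ^ (d * sum_list l)"
  using assms
proof induction
  case (Cons l M' a b)
  interpret cyclic_summand scale p a b M' by fact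
  show ?case using cardM Cons.IH by (simp add: M_def algebra_simps flip: power_add)
qed simp

lemma d_pos: "d > 0"
  using irred p_nz1 by (metis irreducible_not_unit is_unit_iff_degree neq0_conv)

end

text \<open>This is F(q^d; t^d): the residue field of a prime of degree d has q^d elements, and a
  primary module of length k for it has dimension d k.\<close>

definition eval_scaled :: "nat \<Rightarrow> nat \<Rightarrow> int poly poly \<Rightarrow> int poly" where
  "eval_scaled q d F = pcompose (map_poly (\<lambda>c. poly c (int q ^ d)) F) (monom 1 d)"

lemma poly_hom_at: "comm_ring_hom (\<lambda>c :: int poly. poly c x)"
  by unfold_locales auto

lemma eval_scaled_hom: "comm_ring_hom (eval_scaled q d)"
proof -
  interpret e: comm_ring_hom "\<lambda>c :: int poly. poly c (int q ^ d)" by (rule poly_hom_at)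
  interpret E: map_poly_comm_ring_hom "\<lambda>c :: int poly. poly c (int q ^ d)" ..
  show ?thesis
    unfolding eval_scaled_def
    by unfold_locales (simp_all add: E.hom_mult E.hom_add pcompose_mult pcompose_add)
qed

lemma pcompose_monom:
  fixes P :: "'r::comm_ring_1 poly"
  shows "pcompose (monom c i) P = Polynomial.smult c (P ^ i)"
  by (induction i) (simp_all add: monom_0 monom_Suc pcompose_pCons)

lemma coeff_pcompose_monom:
  fixes P :: "'r::comm_ring_1 poly"
  assumes "d > 0"
  shows "coeff (pcompose P (monom 1 d)) j = (if d dvd j then coeff P (j div d) else 0)"
proof -
  have "pcompose P (monom 1 d) = (\<Sum>i\<le>degree P. pcompose (monom (coeff P i) i) (monom 1 d))"
    by (subst poly_as_sum_of_monoms[symmetric, of P]) (simp add: pcompose_sum)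
  also have "\<dots> = (\<Sum>i\<le>degree P. monom (coeff P i) (d * i))"
    by (simp add: pcompose_monom monom_power smult_monom)
  finally have eq: "coeff (pcompose P (monom 1 d)) j = (\<Sum>i\<le>degree P. if d * i = j then coeff P i else 0)"
    by (simp add: coeff_sum)
  show ?thesis
  proof (cases "d dvd j")
    case True
    then obtain k where k: "j = d * k" ..
    have "(\<Sum>i\<le>degree P. if d * i = j then coeff P i else 0) =
        (\<Sum>i\<le>degree P. if i = k then coeff P i else 0)"
      using assms k by (intro sum.cong) auto
    also have "\<dots> = coeff P k" by (auto simp: coeff_eq_0)
    finally show ?thesis using eq k assms by simp
  next
    case False
    then have "(\<Sum>i\<le>degree P. if d * i = j then coeff P i else 0) = 0"
      by (intro sum.neutral) auto
    then show ?thesis using eq False by simp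
  qed
qed

lemma coeff_eval_scaled:
  assumes "d > 0"
  shows "coeff (eval_scaled q d F) j =
    (if d dvd j then poly (coeff F (j div d)) (int q ^ d) else 0)"
  unfolding eval_scaled_def by (simp add: coeff_pcompose_monom[OF assms] coeff_map_poly)

text \<open>A weight that depends only on the exponent rescales coefficients. With |K| = q^dim K
  this turns the sums in \<open>gf_recurrence\<close> into \<open>homog\<close> and
  \<open>scale_t\<close>.\<close>

lemma coeff_weighted_sum:
  fixes g :: "nat \<Rightarrow> int"
  shows "coeff (\<Sum>x\<in>A. monom (g (f x)) (f x)) j = g j * coeff (\<Sum>x\<in>A. monom 1 (f x)) j"
  unfolding coeff_sum sum_distrib_left by (intro sum.cong) auto

section \<open>Generating functions and cyclic decompositions of primary modules\<close>

context primary
begin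

theorem gf_htype:
  assumes "htype l W"
  shows "gf W = eval_scaled CARD('a) d (f_part l)"
  using assms
proof induction
  case Nil
  interpret E: comm_ring_hom "eval_scaled CARD('a) d" by (rule eval_scaled_hom)
  show ?case by (simp add: gf_zero)
next
  case (Cons l M' a b)
  interpret cyclic_summand scale p a b M' by fact
  interpret E: comm_ring_hom "eval_scaled CARD('a) d" by (rule eval_scaled_hom)
  let ?q = "CARD('a)" and ?F = "f_part l" and ?m = "sum_list l"
  let ?E = "eval_scaled ?q d"
  have q0: "?q \<noteq> 0" by simp
  have c: "card K = ?q ^ dm K" if "K \<in> subspaces_of M'" for K
    using card_subspace subspaces_ofD[OF that] finite_subset[OF _ fin] by blast
  have IH: "(\<Sum>K\<in>subspaces_of M'. monom 1 (dm K)) = ?E ?F"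
    using Cons.IH by (simp add: gf_def)
  have F0: "coeff ?F k = 0" if "k > ?m" for k
    using f_part_aux[of l] that by (auto simp: palin_def)
  have E_monom: "?E (monom 1 k) = monom 1 (d * k)" for k
  proof (rule poly_eqI)
    show "coeff (?E (monom 1 k)) j = coeff (monom 1 (d * k)) j" for j
      using d_pos by (cases "d dvd j") (auto simp: coeff_eval_scaled elim!: dvdE)
  qed
  have "(\<Sum>K\<in>subspaces_of M'. monom (int (card M' div card K)) (dm K)) =
      (\<Sum>K\<in>subspaces_of M'. monom (int (?q ^ (d * ?m) div ?q ^ dm K)) (dm K))"
    using c htype_card[OF Cons.hyps(1)] by (intro sum.cong) simp_all
  also have "\<dots> = ?E (homog ?m ?F)"
  proof (rule poly_eqI)
    fix j
    have "coeff (\<Sum>K\<in>subspaces_of M'. monom (int (?q ^ (d * ?m) div ?q ^ dm K)) (dm K)) j =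
        int (?q ^ (d * ?m) div ?q ^ j) * coeff (?E ?F) j"
      unfolding IH[symmetric] by (rule coeff_weighted_sum)
    \<comment> \<open>Only exponents j = d k contribute. For k at most \<open>?m\<close> the
      division of powers of q is exact; beyond that the coefficient of \<open>?F\<close>
      vanishes.\<close>
    also have "\<dots> = coeff (?E (homog ?m ?F)) j"
    proof (cases "d dvd j")
      case True
      then obtain k where k: "j = d * k" ..
      show ?thesis
      proof (cases "k \<le> ?m")
        case True
        then have "?q ^ (d * ?m) div ?q ^ j = ?q ^ (d * (?m - k))"
          unfolding k using q0 by (simp add: diff_mult_distrib2 flip: power_diff)
        then show ?thesis
          using True k d_pos
          by (simp add: coeff_eval_scaled coeff_homog poly_monom power_mult)
      next
        case False
        then show ?thesis using k d_pos F0 by (simp add: coeff_eval_scaled coeff_homog)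
      qed
    qed (simp add: coeff_eval_scaled[OF d_pos])
    finally show "coeff (\<Sum>K\<in>subspaces_of M'. monom (int (?q ^ (d * ?m) div ?q ^ dm K)) (dm K)) j =
      coeff (?E (homog ?m ?F)) j" .
  qed
  finally have G: "(\<Sum>K\<in>subspaces_of M'. monom (int (card M' div card K)) (dm K)) = ?E (homog ?m ?F)" .
  have "(\<Sum>L\<in>subspaces_of M'. monom (int (card L)) (dm L)) =
      (\<Sum>L\<in>subspaces_of M'. monom (int (?q ^ dm L)) (dm L))"
    using c by (intro sum.cong) simp_all
  also have "\<dots> = ?E (scale_t ?F)"
  proof (rule poly_eqI)
    fix j
    have "coeff (\<Sum>L\<in>subspaces_of M'. monom (int (?q ^ dm L)) (dm L)) j = int (?q ^ j) * coeff (?E ?F) j"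
      unfolding IH[symmetric] by (rule coeff_weighted_sum)
    also have "\<dots> = coeff (?E (scale_t ?F)) j"
      using d_pos by (auto simp: coeff_eval_scaled coeff_scale_t poly_monom simp flip: power_mult)
    finally show "coeff (\<Sum>L\<in>subspaces_of M'. monom (int (?q ^ dm L)) (dm L)) j =
      coeff (?E (scale_t ?F)) j" .
  qed
  finally have H: "(\<Sum>L\<in>subspaces_of M'. monom (int (card L)) (dm L)) = ?E (scale_t ?F)" .
  have "?E ((monom 1 1 - 1) * f_part (Suc a # l)) =
      ?E (monom 1 (Suc a + 1) * homog ?m ?F - scale_t ?F)"
    by (simp only: f_part_recurrence)
  then have "(monom 1 d - 1) * ?E (f_part (Suc a # l)) =
      monom 1 (d * Suc (Suc a)) * ?E (homog ?m ?F) - ?E (scale_t ?F)"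
    by (simp only: E.hom_mult E.hom_minus E.hom_one E_monom) simp
  then have "(monom 1 d - 1) * ?E (f_part (Suc a # l)) = (monom 1 d - 1) * gf M"
    by (simp only: gf_recurrence G H)
  \<comment> \<open>The factor t^d - 1 can be cancelled because d > 0.\<close>
  moreover have "monom 1 d - 1 \<noteq> (0 :: int poly)"
  proof
    assume "monom 1 d - 1 = (0 :: int poly)"
    then have "coeff (monom 1 d :: int poly) d = coeff 1 d" by simp
    then show False using d_pos by simp
  qed
  ultimately show ?case unfolding M_def by (metis mult_left_cancel)
qed

text \<open>An element of maximal order generates a direct summand. A submodule avoiding p^a b meets
  R b only in 0, and one that is maximal with this property is a complement.\<close>

lemma exists_cyclic_summand:
  assumes M: "subspace M" "finite M" "b \<in> M"
    and killM: "\<And>x. x \<in> M \<Longrightarrow> p ^ Suc a *s x = 0" and b: "p ^ a *s b \<noteq> 0"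
  shows "\<exists>M'\<subseteq>M. cyclic_summand scale p a b M' \<and> M = adjoin M' b \<and> b \<notin> M'"
proof -
  define S where "S = {L. subspace L \<and> L \<subseteq> M \<and> p ^ a *s b \<notin> L}"
  have "finite S" using M(2) by (auto simp: S_def intro: finite_subset[of _ "Pow M"])
  moreover have "{0} \<in> S" using b subspace_0[OF M(1)] by (auto simp: S_def)
  ultimately obtain M' where M': "M' \<in> S" "\<And>L. L \<in> S \<Longrightarrow> M' \<subseteq> L \<Longrightarrow> L = M'"
    using finite_has_maximal[of S] by (metis empty_iff)
  then have M'_sub: "subspace M'" "M' \<subseteq> M" "p ^ a *s b \<notin> M'" by (auto simp: S_def)
  have "p ^ Suc a *s b \<in> M'" using killM[OF M(3)] subspace_0[OF M'_sub(1)] by simp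
  note ord = exact_order[OF M'_sub(1) this M'_sub(3)]
  interpret cyclic_summand scale p a b M'
    using M'_sub(1) finite_subset[OF M'_sub(2) M(2)] killM[OF subsetD[OF M'_sub(2)]] killM[OF M(3)] ord
    by unfold_locales
  let ?A = "adjoin M' b"
  have sA: "subspace ?A" and bA: "r *s b \<in> ?A" and M'A: "M' \<subseteq> ?A" for r
    using subspace_adjoin[OF M'_sub(1)] adjoin_mem[OF M'_sub(1)] adjoin_superset by blast+
  have A_M: "?A \<subseteq> M" by (rule adjoin_least[OF M(1) M'_sub(2) M(3)])
  \<comment> \<open>This excludes elements of order p modulo \<open>?A\<close>. Subtracting a
    multiple of b gives y with p y in M'. If y is outside M', maximality puts p^a b into M' + R y
    with a coefficient of y prime to p; inverting it modulo p yields y in \<open>?A\<close>.\<close>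
  have step: "x \<in> ?A" if x: "x \<in> M" "p *s x \<in> ?A" for x
  proof -
    obtain m r where m: "m \<in> M'" "p *s x = m + r *s b" using x(2) by (elim adjoinE)
    have "p ^ a *s (p *s x) = 0" using killM[OF x(1)] by (simp add: mult.commute)
    then have "(p ^ a * r) *s b = - (p ^ a *s m)"
      using m(2) by (simp add: scale_right_distrib eq_neg_iff_add_eq_0 add.commute)
    moreover have "- (p ^ a *s m) \<in> M'"
      using M'_sub(1) m(1) by (intro subspace_neg subspace_scale)
    ultimately have "p ^ Suc a dvd p ^ a * r" using ord by metis
    then have "p ^ a * p dvd p ^ a * r" by (simp add: mult.commute)
    then have "p dvd r" using p_nz1 by (simp add: dvd_times_left_cancel_iff)
    then obtain s where s: "r = p * s" ..
    define y where "y = x - s *s b"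
    have py: "p *s y = m" using m(2) s by (simp add: y_def scale_right_diff_distrib)
    have yM: "y \<in> M" unfolding y_def by (intro subspace_diff subspace_scale M(1,3) x(1))
    have "y \<in> ?A"
    proof (cases "y \<in> M'")
      case False
      have "adjoin M' y \<notin> S"
        using M'(2)[of "adjoin M' y"] adjoin_superset[of M' y] adjoin_mem1[OF M'_sub(1), of y] False by blast
      then have "p ^ a *s b \<in> adjoin M' y"
        using subspace_adjoin[OF M'_sub(1)] adjoin_least[OF M(1) M'_sub(2) yM] unfolding S_def by blast
      then obtain m' c where m': "m' \<in> M'" "p ^ a *s b = m' + c *s y" by (elim adjoinE)
      have "\<not> p dvd c"
      proof
        assume "p dvd c"
        then obtain t where "c = t * p" by (metis dvd_def mult.commute)
        then have "c *s y = t *s m" using py by (simp flip: scale_scale)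
        then show False
          using m' M'_sub(3) subspace_add[OF M'_sub(1) m'(1) subspace_scale[OF M'_sub(1) m(1)]] by metis
      qed
      then obtain u v where uv: "u * c + v * p ^ 1 = 1" using bezout_p by blast
      have "c *s y = p ^ a *s b - m'" using m'(2) by simp
      then have cy: "c *s y \<in> ?A" using subspace_diff[OF sA bA subsetD[OF M'A m'(1)]] by metis
      have "y = (u * c + v * p) *s y" using uv by simp
      also have "\<dots> = u *s (c *s y) + v *s m" using py by (simp add: scale_left_distrib flip: scale_scale)
      finally show ?thesis
        using subspace_add[OF sA subspace_scale[OF sA cy] subspace_scale[OF sA subsetD[OF M'A m(1)]]] by metis
    qed (use M'A in blast)
    then have "y + s *s b \<in> ?A" using subspace_add[OF sA _ bA] by blast
    then show "x \<in> ?A" by (simp add: y_def)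
  qed
  have "x \<in> ?A" if x: "x \<in> M" for x
  proof -
    \<comment> \<open>From p^(a+1) x = 0 the exponent is lowered one by one until x itself is
      reached.\<close>
    have "p ^ (Suc a - j) *s x \<in> ?A" if "j \<le> Suc a" for j
      using that
    proof (induction j)
      case 0
      show ?case using killM[OF x] subspace_0[OF sA] by simp
    next
      case (Suc j)
      have "p *s (p ^ (Suc a - Suc j) *s x) = p ^ (Suc a - j) *s x"
        using Suc.prems by (simp add: Suc_diff_le flip: power_Suc)
      then show ?case using step[OF subspace_scale[OF M(1) x]] Suc by simp
    qed
    from this[of "Suc a"] show ?thesis by simp
  qed
  then have "M = ?A" using A_M by blast
  moreover have "b \<notin> M'" using M'_sub(1,3) subspace_scale by blast
  ultimately show ?thesis using M'_sub(2) cyclic_summand_axioms by blast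
qed

text \<open>Splitting off a generator of maximal order leaves a smaller module killed by the same
  power of p. The bound on the parts is carried along because it makes the resulting list
  decreasing.\<close>

lemma exists_htype:
  assumes "subspace M" "finite M" "\<And>x. x \<in> M \<Longrightarrow> p ^ k *s x = 0"
  shows "\<exists>l. int_partition l \<and> htype l M \<and> (\<forall>c\<in>set l. c \<le> k)"
  using assms
proof (induction "card M" arbitrary: M k rule: less_induct)
  case less
  show ?case
  proof (cases "M = {0}")
    case True
    then show ?thesis using htype.Nil by (intro exI[of _ "[]"]) (simp add: int_partition_def)
  next
    case False
    define e where "e = (LEAST j. \<forall>x\<in>M. p ^ j *s x = 0)"
    let ?P = "\<lambda>j. \<forall>x\<in>M. p ^ j *s x = 0"
    have ex: "?P k" using less.prems(3) by blast
    have e: "\<forall>x\<in>M. p ^ e *s x = 0" and "e \<le> k"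
      unfolding e_def using LeastI[of ?P k, OF ex] Least_le[of ?P k, OF ex] by blast+
    have "e \<noteq> 0"
    proof
      assume "e = 0"
      then have "\<forall>x\<in>M. x = 0" using e by simp
      then show False using False subspace_0[OF less.prems(1)] by blast
    qed
    then obtain a where a: "e = Suc a" using not0_implies_Suc by blast
    then obtain b where b: "b \<in> M" "p ^ a *s b \<noteq> 0"
      using not_less_Least[of a "\<lambda>j. \<forall>x\<in>M. p ^ j *s x = 0"] unfolding e_def by auto
    obtain M' where M': "M' \<subseteq> M" "cyclic_summand scale p a b M'" "M = adjoin M' b" "b \<notin> M'"
      using exists_cyclic_summand[OF less.prems(1,2) b(1) _ b(2)] e a by blast
    interpret cyclic_summand scale p a b M' by fact
    have "card M' < card M" using M'(1,4) b(1) less.prems(2) by (intro psubset_card_mono) auto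
    then obtain l where l: "int_partition l" "htype l M'" "\<forall>c\<in>set l. c \<le> Suc a"
      using less.hyps[of M' "Suc a"] sub fin kill by blast
    have "htype (Suc a # l) M" unfolding M'(3) using l(2) M'(2) by (rule htype.Cons)
    then show ?thesis using l \<open>e \<le> k\<close> a
      by (intro exI[of _ "Suc a # l"]) (auto simp: int_partition_def)
  qed
qed

text \<open>The map sends (g_1, g_2, ...) to the sum of the g_i b_i over the chosen cyclic
  generators. Its inverse provides the isomorphism in the definition of
  \<open>primary_partition\<close>.\<close>

lemma htype_iso:
  assumes "htype l M"
  shows "\<exists>h. bij_betw h (carrier (cyclic_sum p l)) M \<and>
    (\<forall>gs\<in>carrier (cyclic_sum p l). \<forall>gs'\<in>carrier (cyclic_sum p l). h (map2 (+) gs gs') = h gs + h gs') \<and>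
    (\<forall>f. \<forall>gs\<in>carrier (cyclic_sum p l). h (map2 (\<lambda>k g. (f * g) mod p ^ k) l gs) = f *s h gs)"
  using assms
proof induction
  case Nil
  show ?case by (intro exI[of _ "\<lambda>_. 0"]) (auto simp: cyclic_sum_def bij_betw_def)
next
  case (Cons l M' a b)
  interpret cyclic_summand scale p a b M' by fact
  let ?C = "carrier (cyclic_sum p l)" and ?D = "carrier (cyclic_sum p (Suc a # l))"
  obtain h where h: "bij_betw h ?C M'" "\<And>gs gs'. gs \<in> ?C \<Longrightarrow> gs' \<in> ?C \<Longrightarrow> h (map2 (+) gs gs') = h gs + h gs'"
    "\<And>f gs. gs \<in> ?C \<Longrightarrow> h (map2 (\<lambda>k g. (f * g) mod p ^ k) l gs) = f *s h gs"
    using Cons.IH by blast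
  have D: "?D = {g # gs | g gs. g mod p ^ Suc a = g \<and> gs \<in> ?C}"
    by (auto simp: cyclic_sum_def list_all2_Cons1)
  define H where "H = (\<lambda>gs. h (tl gs) + hd gs *s b)"
  have H: "H (g # gs) = h gs + g *s b" for g gs by (simp add: H_def)
  \<comment> \<open>Reduction modulo p^(a+1) does not change the action on b, so the reduced
    products of \<open>cyclic_sum\<close> act like ordinary ones.\<close>
  have mod: "(r mod p ^ Suc a) *s b = r *s b" for r
  proof -
    have "r *s b = (p ^ Suc a * (r div p ^ Suc a)) *s b + (r mod p ^ Suc a) *s b"
      by (simp only: mult_div_mod_eq flip: scale_left_distrib)
    then show ?thesis using kill_dvd(1)[of "p ^ Suc a * (r div p ^ Suc a)"] by simp
  qed
  have hM: "h gs \<in> M'" if "gs \<in> ?C" for gs using h(1) that by (rule bij_betw_apply)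
  have "bij_betw H ?D (adjoin M' b)"
    unfolding bij_betw_def
  proof (intro conjI inj_onI equalityI subsetI)
    fix xs ys assume "xs \<in> ?D" "ys \<in> ?D" and eq: "H xs = H ys"
    then obtain g gs g' gs' where xs: "xs = g # gs" "g mod p ^ Suc a = g" "gs \<in> ?C"
      and ys: "ys = g' # gs'" "g' mod p ^ Suc a = g'" "gs' \<in> ?C" unfolding D by blast
    have "h gs = h gs'" "g *s b = g' *s b"
      using indep[OF hM[OF xs(3)] hM[OF ys(3)]] eq unfolding xs(1) ys(1) H by blast+
    moreover from this have "(g - g') *s b = 0" by (simp add: scale_left_diff_distrib)
    then have "g = g'" using ord_0 xs(2) ys(2) by (metis mod_eq_dvd_iff)
    ultimately show "xs = ys" using xs ys h(1) by (auto simp: bij_betw_def inj_on_def)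
  next
    fix y assume "y \<in> H ` ?D"
    then show "y \<in> adjoin M' b" unfolding D using hM adjoinI by (auto simp only: H)
  next
    fix y assume "y \<in> adjoin M' b"
    then obtain m r where m: "m \<in> M'" "y = m + r *s b" by (elim adjoinE)
    then obtain gs where gs: "gs \<in> ?C" "m = h gs" using h(1) by (auto simp: bij_betw_def)
    have "y = H ((r mod p ^ Suc a) # gs)" unfolding H mod using m gs by simp
    moreover have "(r mod p ^ Suc a) # gs \<in> ?D" unfolding D using gs(1) by simp
    ultimately show "y \<in> H ` ?D" by blast
  qed
  moreover have "H (map2 (+) xs ys) = H xs + H ys" if D2: "xs \<in> ?D" "ys \<in> ?D" for xs ys
  proof -
    obtain g gs g' gs' where xs: "xs = g # gs" "gs \<in> ?C" and ys: "ys = g' # gs'" "gs' \<in> ?C"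
      using D2 unfolding D by blast
    show ?thesis unfolding xs(1) ys(1)
      using h(2)[OF xs(2) ys(2)] by (simp add: H scale_left_distrib algebra_simps)
  qed
  moreover have "H (map2 (\<lambda>k g. (f * g) mod p ^ k) (Suc a # l) xs) = f *s H xs" if xs: "xs \<in> ?D" for f xs
  proof -
    obtain g gs where xs: "xs = g # gs" "gs \<in> ?C" using xs unfolding D by blast
    have "H (map2 (\<lambda>k g. (f * g) mod p ^ k) (Suc a # l) xs) =
        h (map2 (\<lambda>k g. (f * g) mod p ^ k) l gs) + ((f * g) mod p ^ Suc a) *s b"
      unfolding xs(1) by (simp add: H)
    then show ?thesis
      unfolding mod h(3)[OF xs(2)] xs(1) H by (simp add: scale_right_distrib)
  qed
  ultimately show ?case by blast
qed

end

section \<open>Primary decomposition\<close>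

context poly_module
begin

text \<open>If u f + v g = 1, then x -> v g x and x -> u f x are the projections of \<open>M\<close>
  onto the two kernels. Being scalar multiplications, they preserve every submodule, which is
  therefore the sum of its intersections with the kernels.\<close>

lemma gf_comaximal:
  assumes M: "subspace M" "finite M" and fg: "comaximal f g"
    and kill: "\<And>x. x \<in> M \<Longrightarrow> (f * g) *s x = 0"
  shows "gf M = gf {x \<in> M. f *s x = 0} * gf {x \<in> M. g *s x = 0}"
proof -
  let ?A = "{x \<in> M. f *s x = 0}" and ?B = "{x \<in> M. g *s x = 0}"
  obtain u v where uv: "u * f + v * g = 1" using fg unfolding comaximal_def by blast
  have dec: "x = (v * g) *s x + (u * f) *s x" for x
    using uv by (metis add.commute scale_left_distrib scale_one)
  have zero: "x = 0" if "f *s x = 0" "g *s x = 0" for x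
  proof -
    have "(v * g) *s x = v *s (g *s x)" "(u * f) *s x = u *s (f *s x)" by simp_all
    then show ?thesis using dec[of x] that by simp
  qed
  have sA: "subspace ?A" and sB: "subspace ?B"
    by (rule subspaceI; simp add: subspace_0[OF M(1)] subspace_add[OF M(1)] subspace_scale[OF M(1)]
      scale_right_distrib mult.commute; metis mult.commute scale_scale scale_zero_right)+
  define S where "S = (\<lambda>(U, V). {x + y | x y :: 'b. x \<in> U \<and> y \<in> V})"
  have S: "subspace (S (U, V))" "S (U, V) \<subseteq> M" "S (U, V) \<inter> ?A = U" "S (U, V) \<inter> ?B = V"
    "card (S (U, V)) = card U * card V"
    if UV: "U \<in> subspaces_of ?A" "V \<in> subspaces_of ?B" for U V
  proof -
    have U: "subspace U" "U \<subseteq> ?A" and V: "subspace V" "V \<subseteq> ?B"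
      using UV by (auto simp: subspaces_of_def)
    show "subspace (S (U, V))"
    proof (rule subspaceI)
      show "0 \<in> S (U, V)" using subspace_0[OF U(1)] subspace_0[OF V(1)] unfolding S_def by force
    next
      fix z z' assume "z \<in> S (U, V)" "z' \<in> S (U, V)"
      then obtain x y x' y' where z: "x \<in> U" "y \<in> V" "z = x + y" "x' \<in> U" "y' \<in> V" "z' = x' + y'"
        unfolding S_def by auto
      then have "z + z' = (x + x') + (y + y')" by (simp add: ac_simps)
      then show "z + z' \<in> S (U, V)"
        using subspace_add[OF U(1) z(1,4)] subspace_add[OF V(1) z(2,5)] unfolding S_def by blast
    next
      fix c z assume "z \<in> S (U, V)"
      then obtain x y where z: "x \<in> U" "y \<in> V" "z = x + y" unfolding S_def by auto
      then have "c *s z = c *s x + c *s y" by (simp add: scale_right_distrib)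
      then show "c *s z \<in> S (U, V)"
        using subspace_scale[OF U(1) z(1)] subspace_scale[OF V(1) z(2)] unfolding S_def by blast
    qed
    show "S (U, V) \<subseteq> M"
      using U V subspace_add[OF M(1)] unfolding S_def by auto
    have uniq: "x = x' \<and> y = y'" if "x \<in> ?A" "y \<in> ?B" "x' \<in> ?A" "y' \<in> ?B" "x + y = x' + y'" for x y x' y'
    proof -
      have "x - x' \<in> ?A" using subspace_diff[OF sA] that by blast
      moreover have "y' - y \<in> ?B" using subspace_diff[OF sB] that by blast
      moreover have "x - x' = y' - y" using that(5) by (metis add_diff_cancel_left' diff_diff_eq2 diff_add_eq)
      ultimately have "f *s (x - x') = 0" "g *s (x - x') = 0" by simp_all
      then have "x - x' = 0" by (rule zero)
      then show ?thesis using that(5) by simp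
    qed
    have 0: "0 \<in> ?A" "0 \<in> ?B" using subspace_0[OF sA] subspace_0[OF sB] by blast+
    show "S (U, V) \<inter> ?A = U"
    proof (intro equalityI subsetI)
      fix z assume z: "z \<in> S (U, V) \<inter> ?A"
      then obtain x y where xy: "x \<in> U" "y \<in> V" "z = x + y" unfolding S_def by auto
      have "z \<in> ?A" "x + y = z + 0" using z xy(3) by simp_all
      then have "x = z"
        using uniq[OF subsetD[OF U(2) xy(1)] subsetD[OF V(2) xy(2)] _ 0(2)] by blast
      then show "z \<in> U" using xy by simp
    next
      fix z assume z: "z \<in> U"
      then have "z + 0 \<in> S (U, V)" using subspace_0[OF V(1)] unfolding S_def by blast
      then show "z \<in> S (U, V) \<inter> ?A" using z U(2) by auto
    qed
    show "S (U, V) \<inter> ?B = V"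
    proof (intro equalityI subsetI)
      fix z assume z: "z \<in> S (U, V) \<inter> ?B"
      then obtain x y where xy: "x \<in> U" "y \<in> V" "z = x + y" unfolding S_def by auto
      have "z \<in> ?B" "x + y = 0 + z" using z xy(3) by simp_all
      then have "y = z"
        using uniq[OF subsetD[OF U(2) xy(1)] subsetD[OF V(2) xy(2)] 0(1)] by blast
      then show "z \<in> V" using xy by simp
    next
      fix z assume z: "z \<in> V"
      then have "0 + z \<in> S (U, V)" using subspace_0[OF U(1)] unfolding S_def by blast
      then show "z \<in> S (U, V) \<inter> ?B" using z V(2) by auto
    qed
    have "inj_on (\<lambda>(x, y). x + y) (U \<times> V)"
    proof (rule inj_onI)
      fix z z' assume z: "z \<in> U \<times> V" "z' \<in> U \<times> V"
        and eq: "(case z of (x, y) \<Rightarrow> x + y) = (case z' of (x, y) \<Rightarrow> x + y)"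
      obtain x y x' y' where xy: "z = (x, y)" "z' = (x', y')" "x \<in> U" "y \<in> V" "x' \<in> U" "y' \<in> V"
        using z by blast
      have "x + y = x' + y'" using eq xy(1,2) by simp
      then have "x = x' \<and> y = y'"
        using uniq[OF subsetD[OF U(2) xy(3)] subsetD[OF V(2) xy(4)] subsetD[OF U(2) xy(5)]
          subsetD[OF V(2) xy(6)]] by blast
      then show "z = z'" using xy(1,2) by simp
    qed
    moreover have "(\<lambda>(x, y). x + y) ` (U \<times> V) = S (U, V)" unfolding S_def by auto
    ultimately show "card (S (U, V)) = card U * card V"
      using card_image[of "\<lambda>(x, y). x + y" "U \<times> V"] by (simp add: card_cartesian_product)
  qed
  have W: "W \<inter> ?A \<in> subspaces_of ?A" "W \<inter> ?B \<in> subspaces_of ?B" "S (W \<inter> ?A, W \<inter> ?B) = W"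
    if W: "W \<in> subspaces_of M" for W
  proof -
    note sW = subspaces_ofD[OF W]
    show "W \<inter> ?A \<in> subspaces_of ?A" "W \<inter> ?B \<in> subspaces_of ?B"
      using subspace_inter[OF sW(1) sA] subspace_inter[OF sW(1) sB] by (auto simp: subspaces_of_def)
    show "S (W \<inter> ?A, W \<inter> ?B) = W"
    proof (intro equalityI subsetI)
      fix z assume "z \<in> S (W \<inter> ?A, W \<inter> ?B)"
      then show "z \<in> W" using subspace_add[OF sW(1)] unfolding S_def by auto
    next
      fix z assume z: "z \<in> W"
      have "f *s ((v * g) *s z) = v *s ((f * g) *s z)" "g *s ((u * f) *s z) = u *s ((f * g) *s z)"
        by (simp_all add: mult_ac)
      then have "f *s ((v * g) *s z) = 0" "g *s ((u * f) *s z) = 0"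
        using kill[OF subsetD[OF sW(2) z]] by (metis scale_zero_right)+
      then have "(v * g) *s z \<in> W \<inter> ?A" "(u * f) *s z \<in> W \<inter> ?B"
        using subspace_scale[OF sW(1) z] sW(2) by blast+
      then show "z \<in> S (W \<inter> ?A, W \<inter> ?B)" unfolding S_def using dec[of z] by blast
    qed
  qed
  have "gf M = (\<Sum>(U, V)\<in>subspaces_of ?A \<times> subspaces_of ?B. monom 1 (dm U) * monom 1 (dm V))"
    unfolding gf_def
  proof (rule sum.reindex_bij_witness[where j = "\<lambda>W. (W \<inter> ?A, W \<inter> ?B)" and i = S])
    fix W assume w: "W \<in> subspaces_of M"
    show "S (W \<inter> ?A, W \<inter> ?B) = W" using W(3)[OF w] .
    show "(W \<inter> ?A, W \<inter> ?B) \<in> subspaces_of ?A \<times> subspaces_of ?B" using W(1,2)[OF w] by blast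
    have fin: "finite (W \<inter> ?A)" "finite (W \<inter> ?B)" using M(2) by auto
    have "dm W = dm (W \<inter> ?A) + dm (W \<inter> ?B)"
    proof (rule dm_mult)
      show "card W = card (W \<inter> ?A) * CARD('a) ^ dm (W \<inter> ?B)"
        using S(5)[OF W(1)[OF w] W(2)[OF w]] W(3)[OF w] card_subspace[OF subspaces_ofD(1)[OF W(2)[OF w]] fin(2)]
        by simp
    qed (use fin subspaces_ofD(1)[OF W(1)[OF w]] in auto)
    then show "(case (W \<inter> ?A, W \<inter> ?B) of (U, V) \<Rightarrow> monom 1 (dm U) * monom 1 (dm V)) = monom (1::int) (dm W)"
      by (simp add: mult_monom)
  next
    fix UV assume "UV \<in> subspaces_of ?A \<times> subspaces_of ?B"
    then obtain U V where UV: "UV = (U, V)" "U \<in> subspaces_of ?A" "V \<in> subspaces_of ?B" by blast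
    show "(S UV \<inter> ?A, S UV \<inter> ?B) = UV" "S UV \<in> subspaces_of M"
      using S[OF UV(2,3)] UV(1) by (auto simp: subspaces_of_def)
  qed
  then show ?thesis by (simp add: gf_def sum_product sum.cartesian_product)
qed

definition tors :: "'b set \<Rightarrow> 'a poly \<Rightarrow> 'b set" where
  "tors M h = {x \<in> M. \<exists>k. h ^ k *s x = 0}"

lemma power_kill_mono:
  assumes "h ^ j *s x = 0" "j \<le> k"
  shows "h ^ k *s x = 0"
proof -
  have "h ^ k *s x = h ^ (k - j) *s (h ^ j *s x)" using assms(2) by (simp flip: power_add)
  then show ?thesis using assms(1) by simp
qed

text \<open>Finitely many exponents have a maximum; the form with \<open>k \<le> m\<close> allows
  one common exponent for several choices of \<open>h\<close>.\<close>

lemma tors_uniform: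
  assumes "finite M"
  obtains k where "\<And>x j m. x \<in> M \<Longrightarrow> h ^ j *s x = 0 \<Longrightarrow> k \<le> m \<Longrightarrow> h ^ m *s x = 0"
proof -
  define e where "e = (\<lambda>x. LEAST j. h ^ j *s x = 0)"
  have "h ^ m *s x = 0" if "x \<in> M" "h ^ j *s x = 0" "Max (e ` M) \<le> m" for x j m
  proof -
    have "h ^ e x *s x = 0" unfolding e_def by (rule LeastI[of "\<lambda>j. h ^ j *s x = 0", OF that(2)])
    moreover have "e x \<le> m" using that(1,3) assms by (meson Max_ge finite_imageI image_eqI le_trans)
    ultimately show ?thesis by (rule power_kill_mono)
  qed
  then show thesis by (rule that)
qed

lemma subspace_tors:
  assumes "subspace M"
  shows "subspace (tors M h)"
proof (rule subspaceI)
  show "0 \<in> tors M h" using subspace_0[OF assms] by (simp add: tors_def)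
next
  fix x y assume "x \<in> tors M h" "y \<in> tors M h"
  then obtain i j where x: "x \<in> M" "h ^ i *s x = 0" and y: "y \<in> M" "h ^ j *s y = 0"
    unfolding tors_def by blast
  have "h ^ max i j *s (x + y) = 0"
    using power_kill_mono[OF x(2), of "max i j"] power_kill_mono[OF y(2), of "max i j"]
    by (simp add: scale_right_distrib)
  then show "x + y \<in> tors M h" using subspace_add[OF assms x(1) y(1)] unfolding tors_def by blast
next
  fix c x assume "x \<in> tors M h"
  then obtain i where x: "x \<in> M" "h ^ i *s x = 0" unfolding tors_def by blast
  have "h ^ i *s (c *s x) = c *s (h ^ i *s x)" by (simp add: mult.commute)
  then have "h ^ i *s (c *s x) = 0" using x(2) by simp
  then show "c *s x \<in> tors M h" using subspace_scale[OF assms x(1)] unfolding tors_def by blast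
qed

lemma tors_subset: "tors M h \<subseteq> M"
  by (auto simp: tors_def)

text \<open>For a large common exponent k the torsion parts for f and g are the kernels of f^k and
  g^k in the torsion part for f g, which (f g)^k annihilates. So \<open>gf_comaximal\<close>
  applies.\<close>

lemma gf_tors_mult:
  assumes M: "subspace M" "finite M" and fg: "comaximal f g"
  shows "gf (tors M (f * g)) = gf (tors M f) * gf (tors M g)"
proof -
  obtain k1 where k1: "\<And>x j m. x \<in> M \<Longrightarrow> (f * g) ^ j *s x = 0 \<Longrightarrow> k1 \<le> m \<Longrightarrow> (f * g) ^ m *s x = 0"
    using tors_uniform[OF M(2)] by blast
  obtain k2 where k2: "\<And>x j m. x \<in> M \<Longrightarrow> f ^ j *s x = 0 \<Longrightarrow> k2 \<le> m \<Longrightarrow> f ^ m *s x = 0"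
    using tors_uniform[OF M(2)] by blast
  obtain k3 where k3: "\<And>x j m. x \<in> M \<Longrightarrow> g ^ j *s x = 0 \<Longrightarrow> k3 \<le> m \<Longrightarrow> g ^ m *s x = 0"
    using tors_uniform[OF M(2)] by blast
  define k where "k = max k1 (max k2 k3)"
  let ?N = "tors M (f * g)"
  have fgk: "comaximal (f ^ k) (g ^ k)"
    using comaximal_power[OF comaximal_sym[OF comaximal_power[OF fg, of k]], of k]
    by (rule comaximal_sym)
  have "gf ?N = gf {x \<in> ?N. f ^ k *s x = 0} * gf {x \<in> ?N. g ^ k *s x = 0}"
  proof (rule gf_comaximal[OF subspace_tors[OF M(1)] finite_subset[OF tors_subset M(2)] fgk])
    fix x assume "x \<in> ?N"
    then obtain j where "x \<in> M" "(f * g) ^ j *s x = 0" unfolding tors_def by blast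
    then have "(f * g) ^ k *s x = 0" by (rule k1) (simp add: k_def)
    then show "(f ^ k * g ^ k) *s x = 0" by (simp only: power_mult_distrib)
  qed
  moreover have "{x \<in> ?N. f ^ k *s x = 0} = tors M f"
  proof (intro equalityI subsetI)
    fix x assume "x \<in> tors M f"
    then obtain j where x: "x \<in> M" "f ^ j *s x = 0" unfolding tors_def by blast
    then have "f ^ k *s x = 0" by (rule k2) (simp add: k_def)
    moreover from this have "(f * g) ^ k *s x = 0"
      by (metis mult.commute power_mult_distrib scale_scale scale_zero_right)
    ultimately show "x \<in> {x \<in> ?N. f ^ k *s x = 0}" using x(1) unfolding tors_def by blast
  qed (auto simp: tors_def)
  moreover have "{x \<in> ?N. g ^ k *s x = 0} = tors M g"
  proof (intro equalityI subsetI)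
    fix x assume "x \<in> tors M g"
    then obtain j where x: "x \<in> M" "g ^ j *s x = 0" unfolding tors_def by blast
    then have "g ^ k *s x = 0" by (rule k3) (simp add: k_def)
    moreover from this have "(f * g) ^ k *s x = 0"
      by (metis power_mult_distrib scale_scale scale_zero_right)
    ultimately show "x \<in> {x \<in> ?N. g ^ k *s x = 0}" using x(1) unfolding tors_def by blast
  qed (auto simp: tors_def)
  ultimately show ?thesis by simp
qed

lemma tors_one:
  assumes "subspace M"
  shows "tors M 1 = {0}"
  using subspace_0[OF assms] by (auto simp: tors_def)

lemma gf_tors_prod:
  assumes M: "subspace M" "finite M" and "finite P"
    and "\<And>p. p \<in> P \<Longrightarrow> irreducible p \<and> lead_coeff p = 1"
  shows "gf (tors M (\<Prod>P)) = (\<Prod>p\<in>P. gf (tors M p))"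
  using assms(3,4)
proof (induction P rule: finite_induct)
  case empty
  show ?case by (simp add: tors_one[OF M(1)] gf_zero)
next
  case (insert p P)
  have "comaximal p (\<Prod>P)"
    using insert by (intro comaximal_prod comaximal_irreducibles) auto
  then show ?case using gf_tors_mult[OF M] insert by simp
qed

text \<open>A product of annihilators of all elements divides a power of the product of a finite set
  \<open>P\<close> of primes, so \<open>M\<close> is torsion for the product of \<open>P\<close>. A
  prime outside \<open>P\<close> is comaximal to it and has zero torsion.\<close>

lemma primary_decomposition:
  assumes M: "subspace M" "finite M"
  defines "S \<equiv> {p. irreducible p \<and> lead_coeff p = 1 \<and> tors M p \<noteq> {0}}"
  shows "finite S" "gf M = (\<Prod>p\<in>S. gf (tors M p))"
proof -
  have "\<forall>x\<in>M. \<exists>f. f \<noteq> 0 \<and> f *s x = 0"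
    using exists_conductor[OF subspace_single_0 M] by (metis dvd_refl singletonD)
  then obtain f where f: "\<And>x. x \<in> M \<Longrightarrow> f x \<noteq> 0 \<and> f x *s x = 0" by metis
  have "prod f M \<noteq> 0" using f M(2) by simp
  from dvd_power_prod_irreducibles[OF this] obtain P k where P: "finite P" "\<forall>p\<in>P. irreducible p \<and> lead_coeff p = 1" "prod f M dvd \<Prod>P ^ k"
    by (elim exE conjE)
  have kill: "\<Prod>P ^ k *s x = 0" if x: "x \<in> M" for x
  proof -
    have "f x dvd \<Prod>P ^ k" using dvd_trans[OF dvd_prodI[OF M(2) x] P(3)] .
    then obtain s where "\<Prod>P ^ k = s * f x" by (metis dvd_def mult.commute)
    then have "\<Prod>P ^ k *s x = s *s (f x *s x)" by simp
    then show ?thesis using f[OF x] by simp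
  qed
  have sub: "S \<subseteq> P"
  proof
    fix p assume p: "p \<in> S"
    show "p \<in> P"
    proof (rule ccontr)
      assume "p \<notin> P"
      then have "comaximal p (\<Prod>P)"
        using p P(2) unfolding S_def by (intro comaximal_prod comaximal_irreducibles) auto
      have "x = 0" if x: "x \<in> tors M p" for x
      proof -
        obtain j where j: "x \<in> M" "p ^ j *s x = 0" using x unfolding tors_def by blast
        have "comaximal (p ^ j) (\<Prod>P ^ k)"
          by (intro comaximal_power comaximal_sym[OF comaximal_power[OF comaximal_sym]]) fact
        then obtain u v where uv: "u * p ^ j + v * \<Prod>P ^ k = 1" unfolding comaximal_def by blast
        have "x = (u * p ^ j + v * \<Prod>P ^ k) *s x" using uv by simp
        also have "\<dots> = u *s (p ^ j *s x) + v *s (\<Prod>P ^ k *s x)"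
          by (simp add: scale_left_distrib)
        finally show "x = 0" using j(2) kill[OF j(1)] by simp
      qed
      then show False using p subspace_0[OF subspace_tors[OF M(1)]] unfolding S_def by blast
    qed
  qed
  then show "finite S" using P(1) finite_subset by blast
  have "tors M (\<Prod>P) = M" using kill unfolding tors_def by blast
  then have "gf M = (\<Prod>p\<in>P. gf (tors M p))" using gf_tors_prod[OF M P(1)] P(2) by simp
  also have "\<dots> = (\<Prod>p\<in>S. gf (tors M p))"
    using sub P(1,2) by (intro prod.mono_neutral_right) (auto simp: S_def gf_zero)
  finally show "gf M = (\<Prod>p\<in>S. gf (tors M p))" .
qed

end

section \<open>Uniqueness of the partition\<close>

lemma sum_list_min_Suc:
  "sum_list (map (min (Suc i)) l) = sum_list (map (min i) l) + length (filter (\<lambda>k. i < k) l)"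
  by (induction l) auto

lemma length_filter_less:
  "length (filter (\<lambda>x. k \<le> x) l) = length (filter (\<lambda>x. k < x) l) + count (mset l) (k::nat)"
  by (induction l) auto

text \<open>Successive differences of the sums count the parts exceeding each \<open>i\<close>, the
  differences of these counts are the multiplicities, and the ordering fixes the list.\<close>

lemma int_partition_eqI:
  assumes l: "int_partition l" "int_partition l'"
    and eq: "\<And>i. sum_list (map (min i) l) = sum_list (map (min i) l')"
  shows "l = l'"
proof -
  have len: "length (filter (\<lambda>k. i < k) l) = length (filter (\<lambda>k. i < k) l')" for i
    using eq[of i] eq[of "Suc i"] by (simp add: sum_list_min_Suc)
  have "count (mset l) k = count (mset l') k" for k
  proof (cases k)
    \<comment> \<open>The differences see positive parts only; zero parts are excluded by
      \<open>int_partition\<close>.\<close>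
    case 0
    have "count (mset l) 0 = 0" "count (mset l') 0 = 0"
      using l by (simp_all add: int_partition_def count_eq_zero_iff)
    then show ?thesis unfolding 0 by (simp only:)
  next
    case (Suc i)
    have "length (filter (\<lambda>x. k \<le> x) l) = length (filter (\<lambda>x. k \<le> x) l')"
      using len[of i] unfolding Suc Suc_le_eq .
    then show ?thesis using length_filter_less[of k l] length_filter_less[of k l'] len[of k] by simp
  qed
  then have "mset (rev l) = mset (rev l')" by (intro multiset_eqI) simp
  moreover have "sorted (rev l)" "sorted (rev l')"
    using l by (simp_all add: int_partition_def sorted_wrt_rev)
  ultimately have "rev l = rev l'" using properties_for_sort by metis
  then show ?thesis by simp
qed

lemma card_list_all2:
  assumes "\<And>k. finite {g. P k g}"
  shows "finite {gs. list_all2 P l gs} \<and> card {gs. list_all2 P l gs} = (\<Prod>k\<leftarrow>l. card {g. P k g})"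
proof (induction l)
  case (Cons k l)
  have "{gs. list_all2 P (k # l) gs} = (\<lambda>(g, gs). g # gs) ` ({g. P k g} \<times> {gs. list_all2 P l gs})"
    by (auto simp: list_all2_Cons1 image_iff)
  moreover have "inj_on (\<lambda>(g, gs). g # gs) ({g. P k g} \<times> {gs. list_all2 P l gs})"
    by (auto simp: inj_on_def)
  ultimately show ?case
    using Cons assms by (simp add: card_image card_cartesian_product)
qed simp

text \<open>In R/(p^k) the kernel of p^i is generated by p^(k-j) with j = min i k, and it is a copy
  of R/(p^j).\<close>

lemma card_torsion_residues:
  fixes p :: "'a::{field,finite} poly"
  assumes "irreducible p"
  shows "finite {g. g mod p ^ k = g \<and> (p ^ i * g) mod p ^ k = 0}"
    "card {g. g mod p ^ k = g \<and> (p ^ i * g) mod p ^ k = 0} = CARD('a) ^ (degree p * min i k)"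
proof -
  have p0: "p \<noteq> 0" using assms by auto
  define j e where "j = min i k" and "e = k - j"
  have k: "p ^ k = p ^ e * p ^ j" by (simp add: j_def e_def flip: power_add)
  have eq: "{g. g mod p ^ k = g \<and> (p ^ i * g) mod p ^ k = 0} = (\<lambda>r. p ^ e * r) ` {r. r mod p ^ j = r}"
  proof (intro equalityI subsetI)
    fix g assume "g \<in> {g. g mod p ^ k = g \<and> (p ^ i * g) mod p ^ k = 0}"
    then have g: "g mod p ^ k = g" "p ^ k dvd p ^ i * g" by auto
    have "p ^ e dvd g"
    proof (cases "i \<le> k")
      case True
      then have "p ^ i * p ^ e dvd p ^ i * g"
        using g(2) k by (simp add: j_def mult.commute)
      then show ?thesis using p0 by (simp add: dvd_times_left_cancel_iff)
    qed (simp add: e_def j_def)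
    then obtain r where r: "g = p ^ e * r" ..
    then have "p ^ e * (r mod p ^ j) = p ^ e * r" using g(1) by (simp only: k mod_mult_mult1)
    then have "r mod p ^ j = r" using p0 by simp
    then show "g \<in> (\<lambda>r. p ^ e * r) ` {r. r mod p ^ j = r}" using r by blast
  next
    fix g assume "g \<in> (\<lambda>r. p ^ e * r) ` {r. r mod p ^ j = r}"
    then obtain r where r: "r mod p ^ j = r" "g = p ^ e * r" by blast
    have "g mod p ^ k = g" unfolding r(2) k by (simp only: mod_mult_mult1 r(1))
    moreover have "p ^ k dvd p ^ (i + e) * r"
      by (intro dvd_mult2 le_imp_power_dvd) (simp add: e_def j_def)
    then have "(p ^ i * g) mod p ^ k = 0" by (simp add: r(2) power_add mult.assoc)
    ultimately show "g \<in> {g. g mod p ^ k = g \<and> (p ^ i * g) mod p ^ k = 0}" by blast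
  qed
  have "p ^ j \<noteq> 0" using p0 by simp
  note res = card_reduced_residues[OF this]
  have "inj_on (\<lambda>r. p ^ e * r) {r. r mod p ^ j = r}" using p0 by (auto simp: inj_on_def)
  then show "card {g. g mod p ^ k = g \<and> (p ^ i * g) mod p ^ k = 0} = CARD('a) ^ (degree p * min i k)"
    unfolding eq using res(2) p0 by (simp add: card_image degree_power_eq j_def mult.commute)
  show "finite {g. g mod p ^ k = g \<and> (p ^ i * g) mod p ^ k = 0}"
    unfolding eq using res(1) by (rule finite_imageI)
qed

lemma card_torsion_cyclic_sum:
  fixes p :: "'a::{field,finite} poly"
  assumes "irreducible p"
  shows "card {gs \<in> carrier (cyclic_sum p l). p ^ i \<odot>\<^bsub>cyclic_sum p l\<^esub> gs = \<zero>\<^bsub>cyclic_sum p l\<^esub>} =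
    CARD('a) ^ (degree p * sum_list (map (min i) l))"
proof -
  let ?P = "\<lambda>k g. g mod p ^ k = g \<and> (p ^ i * g) mod p ^ k = 0"
  have "list_all2 (\<lambda>k g. g mod p ^ k = g) l gs \<and>
      map2 (\<lambda>k g. (p ^ i * g) mod p ^ k) l gs = replicate (length l) 0 \<longleftrightarrow> list_all2 ?P l gs" for gs
    by (induction l gs rule: list_induct2') auto
  then have "{gs \<in> carrier (cyclic_sum p l). p ^ i \<odot>\<^bsub>cyclic_sum p l\<^esub> gs = \<zero>\<^bsub>cyclic_sum p l\<^esub>} =
      {gs. list_all2 ?P l gs}"
    by (simp add: cyclic_sum_def)
  also have "card \<dots> = (\<Prod>k\<leftarrow>l. CARD('a) ^ (degree p * min i k))"
    using card_list_all2[of ?P l] card_torsion_residues[OF assms] by simp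
  also have "\<dots> = CARD('a) ^ (degree p * sum_list (map (min i) l))"
    by (induction l) (simp_all add: power_add algebra_simps)
  finally show ?thesis .
qed

text \<open>The number of elements killed by p^i is an isomorphism invariant; for
  \<open>cyclic_sum p l\<close> its exponent is the degree of p times the sum of the parts truncated
  at i. The truncated sums for all i determine the partition.\<close>

lemma module_isomorphic_cyclic_sum_unique:
  fixes p :: "'a::{field,finite} poly"
  assumes p: "irreducible p" and l: "int_partition l" "int_partition l'"
    and zero: "\<zero>\<^bsub>N\<^esub> \<in> carrier N" "0 \<odot>\<^bsub>N\<^esub> \<zero>\<^bsub>N\<^esub> = \<zero>\<^bsub>N\<^esub>"
    and smult: "\<And>f x. x \<in> carrier N \<Longrightarrow> f \<odot>\<^bsub>N\<^esub> x \<in> carrier N"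
    and iso: "module_isomorphic class_ring N (cyclic_sum p l)" "module_isomorphic class_ring N (cyclic_sum p l')"
  shows "l = l'"
proof (rule int_partition_eqI[OF l])
  fix i
  have card: "card {x \<in> carrier N. p ^ i \<odot>\<^bsub>N\<^esub> x = \<zero>\<^bsub>N\<^esub>} = CARD('a) ^ (degree p * sum_list (map (min i) m))"
    if iso_m: "module_isomorphic class_ring N (cyclic_sum p m)" for m
  proof -
    let ?Z = "cyclic_sum p m"
    obtain h where h: "h \<in> LinearCombinations.module_hom class_ring N ?Z"
      and bij: "bij_betw h (carrier N) (carrier ?Z)"
      using iso_m unfolding module_isomorphic_def by blast
    have hs: "h (f \<odot>\<^bsub>N\<^esub> x) = f \<odot>\<^bsub>?Z\<^esub> h x" if "x \<in> carrier N" for f x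
      using module_hom_smult[OF h _ that, of f] by simp
    \<comment> \<open>A \<open>module_hom\<close> is additive and respects scalars; that it fixes
      zero is derived from 0 = 0 * 0.\<close>
    have "h \<zero>\<^bsub>N\<^esub> \<in> carrier ?Z" using bij zero(1) by (rule bij_betw_apply)
    then have "0 \<odot>\<^bsub>?Z\<^esub> h \<zero>\<^bsub>N\<^esub> = \<zero>\<^bsub>?Z\<^esub>"
      by (auto simp: cyclic_sum_def list_all2_conv_all_nth intro!: nth_equalityI)
    then have h0: "h \<zero>\<^bsub>N\<^esub> = \<zero>\<^bsub>?Z\<^esub>" using hs[OF zero(1), of 0] zero(2) by simp
    have iff: "p ^ i \<odot>\<^bsub>N\<^esub> x = \<zero>\<^bsub>N\<^esub> \<longleftrightarrow> p ^ i \<odot>\<^bsub>?Z\<^esub> h x = \<zero>\<^bsub>?Z\<^esub>" if x: "x \<in> carrier N" for x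
      using bij smult[OF x] zero(1) unfolding hs[OF x, symmetric] h0[symmetric]
      by (auto simp: bij_betw_def inj_on_def)
    let ?X = "{x \<in> carrier N. p ^ i \<odot>\<^bsub>N\<^esub> x = \<zero>\<^bsub>N\<^esub>}"
      and ?Y = "{gs \<in> carrier ?Z. p ^ i \<odot>\<^bsub>?Z\<^esub> gs = \<zero>\<^bsub>?Z\<^esub>}"
    have img: "h ` carrier N = carrier ?Z" and inj: "inj_on h (carrier N)"
      using bij by (simp_all add: bij_betw_def)
    have "h ` ?X = ?Y"
    proof (intro equalityI subsetI)
      fix y assume "y \<in> h ` ?X"
      then obtain x where x: "x \<in> ?X" "y = h x" by blast
      then have "x \<in> carrier N" by simp
      then show "y \<in> ?Y" using iff[of x] x img by blast
    next
      fix y assume y: "y \<in> ?Y"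
      then have "y \<in> h ` carrier N" using img by simp
      then obtain x where x: "x \<in> carrier N" "y = h x" by blast
      then have "x \<in> ?X" using iff[OF x(1)] y by simp
      then show "y \<in> h ` ?X" using x(2) by blast
    qed
    moreover have "inj_on h ?X" using inj by (rule inj_on_subset) blast
    ultimately have "bij_betw h ?X ?Y" by (simp only: bij_betw_def)
    from bij_betw_same_card[OF this] show ?thesis by (simp only: card_torsion_cyclic_sum[OF p])
  qed
  have "CARD('a) ^ (degree p * sum_list (map (min i) l)) = CARD('a) ^ (degree p * sum_list (map (min i) l'))"
    using card[OF iso(1)] card[OF iso(2)] by simp
  moreover have "CARD('a) > 1"
    using card_mono[of "UNIV :: 'a set" "{0, 1}"] by simp
  moreover have "degree p > 0"
    using p by (metis irreducible_def is_unit_iff_degree neq0_conv)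
  ultimately show "sum_list (map (min i) l) = sum_list (map (min i) l')" by simp
qed

section \<open>Matrices as modules\<close>

definition fsc :: "'a::field \<Rightarrow> (nat \<Rightarrow> 'a) \<Rightarrow> (nat \<Rightarrow> 'a)" where
  "fsc c x = (\<lambda>i. c * x i)"

definition mat_op :: "'a::field mat \<Rightarrow> (nat \<Rightarrow> 'a) \<Rightarrow> (nat \<Rightarrow> 'a)" where
  "mat_op T x = (\<lambda>i. if i < dim_row T then \<Sum>j<dim_col T. T $$ (i, j) * x j else 0)"

text \<open>The term of degree 0 is the function itself, so \<open>1\<close> acts as the identity
  even on entries beyond the size of \<open>T\<close>, where \<open>mat_op T\<close> returns
  0.\<close>

definition act :: "'a::field mat \<Rightarrow> 'a poly \<Rightarrow> (nat \<Rightarrow> 'a) \<Rightarrow> (nat \<Rightarrow> 'a)" where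
  "act T f x = (\<lambda>i. \<Sum>k\<le>degree f. coeff f k * (mat_op T ^^ k) x i)"

lemma mat_op_add: "mat_op T (x + y) = mat_op T x + mat_op T y"
  by (rule ext) (simp add: mat_op_def distrib_left sum.distrib)

lemma act_bound:
  assumes "degree f \<le> m"
  shows "act T f x i = (\<Sum>k\<le>m. coeff f k * (mat_op T ^^ k) x i)"
  unfolding act_def using assms by (intro sum.mono_neutral_left) (auto simp: coeff_eq_0)

lemma act_0: "act T 0 x = 0"
  by (rule ext) (simp add: act_def)

text \<open>Horner's rule; additivity in the vector and compatibility with products of polynomials
  follow from it by induction on the polynomial.\<close>

lemma act_pCons: "act T (pCons a f) x = fsc a x + mat_op T (act T f x)"
proof
  fix i
  have "act T (pCons a f) x i = (\<Sum>k\<le>Suc (degree f). coeff (pCons a f) k * (mat_op T ^^ k) x i)"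
    by (rule act_bound) (simp add: degree_pCons_le)
  also have "\<dots> = a * x i + (\<Sum>k\<le>degree f. coeff f k * mat_op T ((mat_op T ^^ k) x) i)"
    by (subst sum.atMost_Suc_shift) simp
  also have "(\<Sum>k\<le>degree f. coeff f k * mat_op T ((mat_op T ^^ k) x) i) = mat_op T (act T f x) i"
  proof (cases "i < dim_row T")
    case True
    then have "(\<Sum>k\<le>degree f. coeff f k * mat_op T ((mat_op T ^^ k) x) i) =
        (\<Sum>k\<le>degree f. \<Sum>j<dim_col T. T $$ (i, j) * (coeff f k * (mat_op T ^^ k) x j))"
      by (simp add: mat_op_def sum_distrib_left mult_ac)
    also have "\<dots> = (\<Sum>j<dim_col T. \<Sum>k\<le>degree f. T $$ (i, j) * (coeff f k * (mat_op T ^^ k) x j))"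
      by (rule sum.swap)
    finally show ?thesis using True by (simp add: mat_op_def act_def sum_distrib_left)
  qed (simp add: mat_op_def)
  finally show "act T (pCons a f) x i = (fsc a x + mat_op T (act T f x)) i"
    by (simp add: fsc_def)
qed

lemma act_add_left: "act T (f + g) x = act T f x + act T g x"
proof
  fix i
  define m where "m = max (degree f) (degree g)"
  have "degree (f + g) \<le> m" "degree f \<le> m" "degree g \<le> m"
    by (simp_all add: m_def degree_add_le_max)
  then show "act T (f + g) x i = (act T f x + act T g x) i"
    by (simp add: act_bound[where m = m] distrib_right sum.distrib)
qed

lemma act_smult: "act T (Polynomial.smult c f) x = fsc c (act T f x)"
proof
  fix i
  have "act T (Polynomial.smult c f) x i =
      (\<Sum>k\<le>degree f. coeff (Polynomial.smult c f) k * (mat_op T ^^ k) x i)"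
    by (rule act_bound) (rule degree_smult_le)
  then show "act T (Polynomial.smult c f) x i = fsc c (act T f x) i"
    by (simp add: fsc_def act_def sum_distrib_left mult.assoc)
qed

lemma mat_op_0: "mat_op T 0 = 0"
  by (rule ext) (simp add: mat_op_def)

lemma poly_module_act: "poly_module (act T)"
proof
  fix f g :: "'a poly" and x y :: "nat \<Rightarrow> 'a"
  show "act T (f + g) x = act T f x + act T g x" by (rule act_add_left)
  show "act T f (x + y) = act T f x + act T f y"
  proof (induction f)
    case (pCons a f)
    have "fsc a (x + y) = fsc a x + fsc a y" by (rule ext) (simp add: fsc_def distrib_left)
    then show ?case by (simp only: act_pCons pCons.IH mat_op_add ac_simps)
  qed (simp add: act_0)
  show "act T f (act T g x) = act T (f * g) x"
  proof (induction f)
    case (pCons a f)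
    have "fsc 0 x = 0" by (rule ext) (simp add: fsc_def)
    then have "act T (pCons 0 (f * g)) x = mat_op T (act T (f * g) x)" by (simp add: act_pCons)
    then show ?case by (simp add: act_pCons act_add_left act_smult pCons.IH)
  qed (simp add: act_0)
  show "act T 1 x = x"
    by (rule ext) (simp add: one_pCons act_pCons act_0 mat_op_0 fsc_def)
qed

text \<open>Vectors of dimension \<open>n\<close> are identified with the functions vanishing from \<open>n\<close> on, a type that
  carries the structure of an abelian group.\<close>

definition vf :: "nat \<Rightarrow> 'a::field vec \<Rightarrow> (nat \<Rightarrow> 'a)" where
  "vf n v = (\<lambda>i. if i < n then v $ i else 0)"

definition funs :: "nat \<Rightarrow> (nat \<Rightarrow> 'a::field) set" where
  "funs n = {x. \<forall>i\<ge>n. x i = 0}"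

lemma vf_bij: "bij_betw (vf n) (carrier_vec n) (funs n)"
proof (rule bij_betw_byWitness[where f' = "vec n"])
  show "\<forall>v\<in>carrier_vec n. vec n (vf n v) = v" by (auto simp: vf_def)
  show "\<forall>x\<in>funs n. vf n (vec n x) = x" by (auto simp: vf_def funs_def fun_eq_iff)
qed (auto simp: vf_def funs_def)

lemma vf_inj: "v \<in> carrier_vec n \<Longrightarrow> w \<in> carrier_vec n \<Longrightarrow> vf n v = vf n w \<Longrightarrow> v = w"
  using vf_bij[of n] by (auto simp: bij_betw_def inj_on_def)

lemma vf_add: "v \<in> carrier_vec n \<Longrightarrow> w \<in> carrier_vec n \<Longrightarrow> vf n (v + w) = vf n v + vf n w"
  by (rule ext) (auto simp: vf_def)

lemma vf_smult: "v \<in> carrier_vec n \<Longrightarrow> vf n (c \<cdot>\<^sub>v v) = fsc c (vf n v)"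
  by (rule ext) (auto simp: vf_def fsc_def)

lemma vf_zero: "vf n (0\<^sub>v n) = 0"
  by (rule ext) (auto simp: vf_def)

lemma vf_mult:
  assumes "T \<in> carrier_mat n n" "v \<in> carrier_vec n"
  shows "vf n (T *\<^sub>v v) = mat_op T (vf n v)"
proof
  fix i
  show "vf n (T *\<^sub>v v) i = mat_op T (vf n v) i"
    using assms by (auto simp: vf_def mat_op_def scalar_prod_def lessThan_atLeast0 intro!: sum.cong)
qed

lemma vf_pow:
  assumes T: "T \<in> carrier_mat n n" and "v \<in> carrier_vec n"
  shows "vf n ((T ^\<^sub>m k) *\<^sub>v v) = (mat_op T ^^ k) (vf n v)"
  using assms(2)
proof (induction k arbitrary: v)
  case 0
  then show ?case using T by simp
next
  case (Suc k)
  have "(T ^\<^sub>m Suc k) *\<^sub>v v = (T ^\<^sub>m k) *\<^sub>v (T *\<^sub>v v)"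
    using T Suc.prems by (simp add: assoc_mult_mat_vec[OF pow_carrier_mat[OF T] T])
  then show ?case
    using Suc.IH[of "T *\<^sub>v v"] T Suc.prems by (simp add: vf_mult funpow_swap1)
qed

lemma poly_act_closed:
  assumes T: "T \<in> carrier_mat n n" and v: "v \<in> carrier_vec n"
  shows "poly_act T f v \<in> carrier_vec n"
  using T v mult_mat_vec_carrier[OF pow_carrier_mat[OF T] v]
  unfolding poly_act_def by (auto intro!: finsum_vec_closed)

lemma vf_act:
  assumes T: "T \<in> carrier_mat n n" and v: "v \<in> carrier_vec n"
  shows "vf n (poly_act T f v) = act T f (vf n v)"
proof
  fix i
  have carr: "(\<lambda>k. coeff f k \<cdot>\<^sub>v ((T ^\<^sub>m k) *\<^sub>v v)) \<in> {..degree f} \<rightarrow> carrier_vec n"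
    using mult_mat_vec_carrier[OF pow_carrier_mat[OF T] v] by auto
  have *: "(mat_op T ^^ k) (vf n v) i = (if i < n then ((T ^\<^sub>m k) *\<^sub>v v) $ i else 0)" for k
    using vf_pow[OF T v, of k] by (metis vf_def)
  show "vf n (poly_act T f v) i = act T f (vf n v) i"
  proof (cases "i < n")
    case True
    then have "vf n (poly_act T f v) i = (\<Sum>k\<le>degree f. (coeff f k \<cdot>\<^sub>v ((T ^\<^sub>m k) *\<^sub>v v)) $ i)"
      unfolding poly_act_def vf_def using T index_finsum_vec[OF _ True carr] by simp
    also have "\<dots> = (\<Sum>k\<le>degree f. coeff f k * ((T ^\<^sub>m k) *\<^sub>v v) $ i)"
    proof (rule sum.cong[OF refl])
      fix k
      have "(T ^\<^sub>m k) *\<^sub>v v \<in> carrier_vec n"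
        by (rule mult_mat_vec_carrier[OF pow_carrier_mat[OF T] v])
      then show "(coeff f k \<cdot>\<^sub>v ((T ^\<^sub>m k) *\<^sub>v v)) $ i = coeff f k * ((T ^\<^sub>m k) *\<^sub>v v) $ i"
        using True by (metis carrier_vecD index_smult_vec(1))
    qed
    finally show ?thesis using True by (simp add: act_def *)
  qed (simp add: vf_def[of n "poly_act T f v"] act_def *)
qed

lemma finite_carrier_vec: "finite (carrier_vec n :: 'a::finite vec set)"
proof -
  have "v \<in> vec_of_list ` {xs. set xs \<subseteq> UNIV \<and> length xs = n}" if "v \<in> carrier_vec n" for v :: "'a vec"
    using that by (intro image_eqI[of _ _ "list_of_vec v"]) (auto simp: vec_list)
  then have "(carrier_vec n :: 'a vec set) \<subseteq> vec_of_list ` {xs. set xs \<subseteq> UNIV \<and> length xs = n}"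
    by (rule subsetI)
  then show ?thesis
    by (rule finite_subset) (intro finite_imageI finite_lists_length_eq finite)
qed

text \<open>Coordinates with respect to a basis identify \<open>W\<close> with the functions from
  that basis to the field. This links the dimension in the definition of
  \<open>num_invariant_subspaces\<close> to the counting dimension \<open>dm\<close>.\<close>

lemma card_subspace_dim:
  fixes W :: "'a::{field,finite} vec set"
  assumes W: "VectorSpace.subspace class_ring W (module_vec TYPE('a) n)"
  shows "card W = CARD('a) ^ vectorspace.dim class_ring ((module_vec TYPE('a) n)\<lparr>carrier := W\<rparr>)"
proof -
  let ?V = "(module_vec TYPE('a) n)\<lparr>carrier := W\<rparr>"
  interpret W: vectorspace class_ring ?V
    using vectorspace.subspace_is_vs[OF vec_vs W] .
  have "W \<subseteq> carrier_vec n"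
    using W by (auto simp: VectorSpace.subspace_def submodule_def module_vec_simps)
  then have finW: "finite W"
    by (rule finite_subset[OF _ finite_carrier_vec])
  have "W.gen_set W"
  proof -
    have "W.span W \<subseteq> W" using W.span_is_subset2[of W] by simp
    moreover have "W \<subseteq> W.span W" using W.in_own_span[of W] by simp
    ultimately show ?thesis by auto
  qed
  then have "W.fin_dim" unfolding W.fin_dim_def using finW by (intro exI[of _ W]) simp
  then obtain B where B: "finite B" "W.basis B" using W.finite_basis_exists by blast
  have BW: "B \<subseteq> carrier ?V" using B(2) unfolding W.basis_def by blast
  let ?E = "B \<rightarrow>\<^sub>E (UNIV :: 'a set)"
  have uni: "\<forall>v. v \<in> W \<longrightarrow> (\<exists>!a. a \<in> ?E \<and> W.lincomb a B = v)"
    using W.basis_criterion[OF B(1) BW] B(2) by simp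
  have closed: "W.lincomb a B \<in> W" for a
    using W.lincomb_closed[OF BW, of a] by simp
  have "bij_betw (\<lambda>a. W.lincomb a B) ?E W"
    unfolding bij_betw_def inj_on_def using uni closed by (auto simp: image_iff)
  then have "card W = card ?E" by (metis bij_betw_same_card)
  also have "\<dots> = CARD('a) ^ card B" using B(1) by (simp add: card_PiE)
  finally show ?thesis by (simp add: W.dim_basis[OF B])
qed

section \<open>Similarity class types\<close>

lemma comm_ring_hom_specialize: "comm_ring_hom (specialize q)"
proof -
  interpret e: comm_ring_hom "\<lambda>c :: int poly. poly c q" by (rule poly_hom_at)
  interpret E: map_poly_comm_ring_hom "\<lambda>c :: int poly. poly c q" ..
  show ?thesis unfolding specialize_def by unfold_locales
qed

text \<open>Substituting u^d for u and then setting u = q is the same as setting u = q^d. In this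
  way the factor of \<open>f_type\<close> for a prime of degree d meets the generating function of
  its primary component.\<close>

lemma specialize_subst_pow:
  assumes "d > 0"
  shows "specialize (int q) (subst_pow d F) = eval_scaled q d F"
proof (rule poly_eqI)
  fix j
  show "coeff (specialize (int q) (subst_pow d F)) j = coeff (eval_scaled q d F) j"
    unfolding specialize_def subst_pow_def
    by (simp add: coeff_map_poly coeff_pcompose_monom[OF assms] coeff_eval_scaled[OF assms]
      poly_pcompose poly_monom)
qed

locale square_matrix =
  fixes T :: "'a::{field,finite} mat" and n :: nat
  assumes T: "T \<in> carrier_mat n n"
begin

sublocale poly_module "act T"
  by (rule poly_module_act)

lemma dim_T: "dim_row T = n" "dim_col T = n"
  using T by auto

lemma act_const: "act T [:c:] x = fsc c x"
proof -
  have "act T [:c:] x = fsc c x + mat_op T (act T 0 x)" by (rule act_pCons)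
  then show ?thesis by (simp only: act_0 mat_op_0 add_0_right)
qed

lemma act_X: "act T [:0, 1:] x = mat_op T x"
proof -
  have "act T [:0, 1:] x = fsc 0 x + mat_op T (act T [:1:] x)" by (rule act_pCons)
  moreover have "fsc 0 x = 0" "fsc 1 x = x" by (simp_all add: fsc_def fun_eq_iff)
  ultimately show ?thesis by (simp only: act_const add_0_left)
qed

text \<open>By Horner's rule, closure under sums, scalars and \<open>T\<close> gives closure under
  every polynomial in \<open>T\<close>.\<close>

lemma subspaceI_linear:
  assumes "0 \<in> W" "\<And>x y. x \<in> W \<Longrightarrow> y \<in> W \<Longrightarrow> x + y \<in> W" "\<And>c x. x \<in> W \<Longrightarrow> fsc c x \<in> W"
    "\<And>x. x \<in> W \<Longrightarrow> mat_op T x \<in> W"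
  shows "subspace W"
proof (rule subspaceI)
  fix f x assume x: "x \<in> W"
  show "act T f x \<in> W"
  proof (induction f)
    case 0
    show ?case unfolding act_0 by (rule assms(1))
  next
    case (pCons a f)
    show ?case unfolding act_pCons by (intro assms(2-4) x pCons.IH)
  qed
qed (use assms in auto)

lemma subspace_funs: "subspace (funs n)"
  by (rule subspaceI_linear) (auto simp: funs_def fsc_def mat_op_def dim_T)

lemma finite_funs: "finite (funs n :: (nat \<Rightarrow> 'a) set)"
  using bij_betw_finite[OF vf_bij[of n, where 'a = 'a]] finite_carrier_vec by blast

section \<open>Invariant subspaces as submodules\<close>

lemma invariant_subspaces_iff:
  "W \<in> invariant_subspaces T \<longleftrightarrow> W \<subseteq> carrier_vec n \<and> 0\<^sub>v n \<in> W \<and> (\<forall>v\<in>W. \<forall>w\<in>W. v + w \<in> W) \<and>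
    (\<forall>c. \<forall>v\<in>W. c \<cdot>\<^sub>v v \<in> W) \<and> (\<forall>v\<in>W. T *\<^sub>v v \<in> W)"
  unfolding invariant_subspaces_def dim_T VectorSpace.subspace_def submodule_def
  using vec_vs[of n, where 'a = 'a] vec_module[of n, where 'a = 'a]
  by (auto simp: module_vec_simps)

text \<open>Scalars and \<open>T\<close> generate the action of all polynomials, and conversely the
  actions of the constants and of \<open>[:0, 1:]\<close> give them back.\<close>

lemma vf_image_subspace:
  assumes W: "W \<subseteq> carrier_vec n"
  shows "subspace (vf n ` W) \<longleftrightarrow> W \<in> invariant_subspaces T"
proof
  assume "W \<in> invariant_subspaces T"
  then have inv: "0\<^sub>v n \<in> W" "\<And>v w. v \<in> W \<Longrightarrow> w \<in> W \<Longrightarrow> v + w \<in> W"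
    "\<And>c v. v \<in> W \<Longrightarrow> c \<cdot>\<^sub>v v \<in> W" "\<And>v. v \<in> W \<Longrightarrow> T *\<^sub>v v \<in> W"
    unfolding invariant_subspaces_iff by blast+
  show "subspace (vf n ` W)"
  proof (rule subspaceI_linear)
    show "0 \<in> vf n ` W" by (rule image_eqI[OF _ inv(1)]) (simp only: vf_zero)
  next
    fix x y assume "x \<in> vf n ` W" "y \<in> vf n ` W"
    then obtain v w where v: "v \<in> W" "x = vf n v" and w: "w \<in> W" "y = vf n w" by blast
    show "x + y \<in> vf n ` W"
      by (rule image_eqI[OF _ inv(2)[OF v(1) w(1)]])
        (simp only: v(2) w(2) vf_add[OF subsetD[OF W v(1)] subsetD[OF W w(1)]])
  next
    fix c x assume "x \<in> vf n ` W"
    then obtain v where v: "v \<in> W" "x = vf n v" by blast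
    show "fsc c x \<in> vf n ` W"
      by (rule image_eqI[OF _ inv(3)[OF v(1)]]) (simp only: v(2) vf_smult[OF subsetD[OF W v(1)]])
  next
    fix x assume "x \<in> vf n ` W"
    then obtain v where v: "v \<in> W" "x = vf n v" by blast
    show "mat_op T x \<in> vf n ` W"
      by (rule image_eqI[OF _ inv(4)[OF v(1)]]) (simp only: v(2) vf_mult[OF T subsetD[OF W v(1)]])
  qed
next
  assume sub: "subspace (vf n ` W)"
  have mem: "v \<in> W" if v: "v \<in> carrier_vec n" "vf n v \<in> vf n ` W" for v
  proof -
    obtain w where w: "w \<in> W" "vf n v = vf n w" using v(2) by blast
    have "v = w" by (rule vf_inj[OF v(1) subsetD[OF W w(1)] w(2)])
    then show ?thesis using w(1) by simp
  qed
  show "W \<in> invariant_subspaces T"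
    unfolding invariant_subspaces_iff
  proof (intro conjI ballI allI)
    show "0\<^sub>v n \<in> W" using subspace_0[OF sub] by (intro mem) (simp_all only: vf_zero zero_carrier_vec)
  next
    fix v w assume vw: "v \<in> W" "w \<in> W"
    have c: "v \<in> carrier_vec n" "w \<in> carrier_vec n" using vw W by auto
    have "vf n v + vf n w \<in> vf n ` W" using vw by (intro subspace_add[OF sub] imageI)
    then show "v + w \<in> W" using c by (intro mem) (simp_all only: vf_add add_carrier_vec)
  next
    fix c v assume v: "v \<in> W"
    have cv: "v \<in> carrier_vec n" using v W by auto
    have "act T [:c:] (vf n v) \<in> vf n ` W" using v by (intro subspace_scale[OF sub] imageI)
    then show "c \<cdot>\<^sub>v v \<in> W"
      using cv by (intro mem) (simp_all only: vf_smult act_const smult_carrier_vec)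
  next
    fix v assume v: "v \<in> W"
    have cv: "v \<in> carrier_vec n" using v W by auto
    have "act T [:0, 1:] (vf n v) \<in> vf n ` W" using v by (intro subspace_scale[OF sub] imageI)
    then show "T *\<^sub>v v \<in> W"
      using cv by (intro mem mult_mat_vec_carrier[OF T]) (simp_all only: vf_mult[OF T] act_X)
  qed (use W in auto)
qed

lemma bij_invariant_subspaces:
  "bij_betw ((`) (vf n)) (invariant_subspaces T) (subspaces_of (funs n))"
  unfolding bij_betw_def
proof (intro conjI equalityI subsetI)
  have img: "vf n ` (carrier_vec n :: 'a vec set) = funs n"
    and inj: "inj_on (vf n) (carrier_vec n :: 'a vec set)"
    using vf_bij[of n] by (auto simp: bij_betw_def)
  have sub: "W \<subseteq> carrier_vec n" if "W \<in> invariant_subspaces T" for W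
    using that unfolding invariant_subspaces_iff by blast
  show "inj_on ((`) (vf n)) (invariant_subspaces T)"
    by (rule inj_on_subset[OF inj_on_image_Pow[OF inj]]) (use sub in blast)
  fix X
  show "X \<in> subspaces_of (funs n)" if X: "X \<in> (`) (vf n) ` invariant_subspaces T"
  proof -
    obtain W where W: "W \<in> invariant_subspaces T" "X = vf n ` W" using X by blast
    have "subspace X" unfolding W(2) using vf_image_subspace[OF sub[OF W(1)]] W(1) by blast
    moreover have "X \<subseteq> funs n" unfolding W(2) img[symmetric] by (rule image_mono[OF sub[OF W(1)]])
    ultimately show ?thesis unfolding subspaces_of_def by blast
  qed
  show "X \<in> (`) (vf n) ` invariant_subspaces T" if X: "X \<in> subspaces_of (funs n)"
  proof -
    have "X \<subseteq> vf n ` carrier_vec n" using subspaces_ofD(2)[OF X] img by simp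
    then obtain W where W: "W \<subseteq> carrier_vec n" "X = vf n ` W" by (auto simp: subset_image_iff)
    then have "W \<in> invariant_subspaces T"
      using vf_image_subspace[OF W(1)] subspaces_ofD(1)[OF X] by blast
    then show ?thesis using W(2) by blast
  qed
qed

lemma invariant_gf_eq: "invariant_gf T = gf (funs n)"
proof -
  let ?dim = "\<lambda>W. vectorspace.dim class_ring ((module_vec TYPE('a) n)\<lparr>carrier := W\<rparr>)"
  let ?I = "invariant_subspaces T"
  have finI: "finite ?I"
    using bij_betw_finite[OF bij_invariant_subspaces] finite_subspaces_of[OF finite_funs] by blast
  \<comment> \<open>\<open>invariant_gf\<close> stops at degree n, so grouping by dimension requires
    every dimension to be at most n.\<close>
  have dm_le: "dm X \<le> n" if X: "X \<in> subspaces_of (funs n)" for X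
  proof -
    have "CARD('a) ^ dm X \<le> card (funs n :: (nat \<Rightarrow> 'a) set)"
      using card_subspace[OF subspaces_ofD(1)[OF X] finite_subset[OF subspaces_ofD(2)[OF X] finite_funs]]
        card_mono[OF finite_funs subspaces_ofD(2)[OF X]] by simp
    also have "\<dots> = card (carrier_vec n :: 'a vec set)" by (rule bij_betw_same_card[OF vf_bij, symmetric])
    also have "\<dots> \<le> card {xs. set xs \<subseteq> (UNIV :: 'a set) \<and> length xs = n}"
    proof (rule card_inj_on_le[of list_of_vec])
      show "inj_on list_of_vec (carrier_vec n :: 'a vec set)"
        by (rule inj_onI) (metis vec_list)
      show "finite {xs. set xs \<subseteq> (UNIV :: 'a set) \<and> length xs = n}"
        by (rule finite_lists_length_eq) simp
    qed auto
    also have "\<dots> = CARD('a) ^ n" by (rule card_lists_length_eq) simp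
    finally show ?thesis using one_less_card by simp
  qed
  \<comment> \<open>Both dimensions are the exponent of q in the same cardinality.\<close>
  have dim: "dm (vf n ` W) = ?dim W" if W: "W \<in> ?I" for W
  proof (rule dm_eq)
    have sub: "W \<subseteq> carrier_vec n" using W unfolding invariant_subspaces_iff by blast
    have "VectorSpace.subspace class_ring W (module_vec TYPE('a) n)"
      using W unfolding invariant_subspaces_def dim_T by blast
    moreover have "card (vf n ` W) = card W"
      by (rule card_image, rule inj_onI, rule vf_inj[of _ n]) (use sub in blast)+
    ultimately show "card (vf n ` W) = CARD('a) ^ ?dim W" by (simp only: card_subspace_dim)
  qed
  have le: "?dim ` ?I \<subseteq> {..n}"
  proof
    fix j assume "j \<in> ?dim ` ?I"
    then obtain W where W: "W \<in> ?I" "j = ?dim W" by blast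
    have "dm (vf n ` W) \<le> n" by (rule dm_le[OF bij_betw_apply[OF bij_invariant_subspaces W(1)]])
    then show "j \<in> {..n}" unfolding dim[OF W(1)] W(2) atMost_iff .
  qed
  have "gf (funs n) = (\<Sum>W\<in>?I. monom 1 (dm (vf n ` W)))"
    unfolding gf_def by (rule sum.reindex_bij_betw[OF bij_invariant_subspaces, symmetric])
  also have "\<dots> = (\<Sum>W\<in>?I. monom 1 (?dim W))"
    using dim by (intro sum.cong) simp_all
  also have "\<dots> = (\<Sum>j\<le>n. \<Sum>W\<in>{W \<in> ?I. ?dim W = j}. monom 1 (?dim W))"
    by (rule sum.group[OF finI _ le, symmetric]) simp
  also have "\<dots> = invariant_gf T"
    unfolding invariant_gf_def dim_T num_invariant_subspaces_def
  proof (rule sum.cong[OF refl])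
    fix j
    have "(\<Sum>W\<in>{W \<in> ?I. ?dim W = j}. monom 1 (?dim W)) = (\<Sum>W\<in>{W \<in> ?I. ?dim W = j}. monom (1::int) j)"
      by (intro sum.cong) auto
    then show "(\<Sum>W\<in>{W \<in> ?I. ?dim W = j}. monom 1 (?dim W)) = monom (int (card {W \<in> ?I. ?dim W = j})) j"
      by (simp add: of_nat_monom mult_monom)
  qed
  finally show ?thesis ..
qed

section \<open>Primary components and their partitions\<close>

lemma primary_component_simps:
  "carrier (primary_component (mat_module T) p) = {x \<in> carrier_vec n. \<exists>k. poly_act T (p ^ k) x = 0\<^sub>v n}"
  "\<zero>\<^bsub>primary_component (mat_module T) p\<^esub> = 0\<^sub>v n"
  "x \<oplus>\<^bsub>primary_component (mat_module T) p\<^esub> y = x + y"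
  "f \<odot>\<^bsub>primary_component (mat_module T) p\<^esub> x = poly_act T f x"
  by (simp_all add: primary_component_def mat_module_def dim_T)

lemma vf_primary_component:
  "bij_betw (vf n) (carrier (primary_component (mat_module T) p)) (tors (funs n) p)"
proof -
  have iff: "poly_act T f x = 0\<^sub>v n \<longleftrightarrow> act T f (vf n x) = 0" if x: "x \<in> carrier_vec n" for f x
  proof
    assume "poly_act T f x = 0\<^sub>v n"
    then have "vf n (poly_act T f x) = vf n (0\<^sub>v n)" by simp
    then show "act T f (vf n x) = 0" by (simp only: vf_act[OF T x] vf_zero)
  next
    assume "act T f (vf n x) = 0"
    then have "vf n (poly_act T f x) = vf n (0\<^sub>v n)" by (simp only: vf_act[OF T x] vf_zero)
    then show "poly_act T f x = 0\<^sub>v n" by (rule vf_inj[OF poly_act_closed[OF T x] zero_carrier_vec])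
  qed
  have img: "vf n ` carrier_vec n = funs n" and inj: "inj_on (vf n) (carrier_vec n)"
    using vf_bij[of n] by (auto simp: bij_betw_def)
  let ?C = "{x \<in> carrier_vec n. \<exists>k. poly_act T (p ^ k) x = 0\<^sub>v n}"
  have "vf n ` ?C = tors (funs n) p"
  proof (intro equalityI subsetI)
    fix y assume "y \<in> vf n ` ?C"
    then obtain x k where x: "x \<in> carrier_vec n" "poly_act T (p ^ k) x = 0\<^sub>v n" "y = vf n x" by blast
    then have "y \<in> funs n" "act T (p ^ k) y = 0" using img iff[OF x(1)] by blast+
    then show "y \<in> tors (funs n) p" unfolding tors_def by blast
  next
    fix y assume "y \<in> tors (funs n) p"
    then obtain k where y: "y \<in> funs n" "act T (p ^ k) y = 0" unfolding tors_def by blast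
    then obtain x where x: "x \<in> carrier_vec n" "y = vf n x" using img by blast
    then have "poly_act T (p ^ k) x = 0\<^sub>v n" using iff y(2) by blast
    then show "y \<in> vf n ` ?C" using x by blast
  qed
  moreover have "inj_on (vf n) ?C" using inj by (rule inj_on_subset) blast
  ultimately show ?thesis unfolding primary_component_simps bij_betw_def by blast
qed

lemma cyclic_sum_closed:
  "xs \<in> carrier (cyclic_sum p l) \<Longrightarrow> ys \<in> carrier (cyclic_sum p l) \<Longrightarrow> map2 (+) xs ys \<in> carrier (cyclic_sum p l)"
  "xs \<in> carrier (cyclic_sum p l) \<Longrightarrow> map2 (\<lambda>k g. (f * g) mod p ^ k) l xs \<in> carrier (cyclic_sum p l)"
  for p :: "'a poly"
  by (auto simp: cyclic_sum_def list_all2_conv_all_nth poly_mod_add_left)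

text \<open>This resolves the definite description: existence comes from the cyclic decomposition of
  the torsion submodule, transported back to vectors, and uniqueness from counting
  p^i-torsion.\<close>

lemma primary_partition_htype:
  assumes p: "irreducible p"
  shows "primary.htype (act T) p (primary_partition T p) (tors (funs n) p)"
    "int_partition (primary_partition T p)"
proof -
  interpret primary "act T" p by unfold_locales (rule p)
  let ?V = "tors (funs n) p" and ?N = "primary_component (mat_module T) p"
  note T_sub = subspace_tors[OF subspace_funs, of p]
  obtain k where k: "\<And>x j m. x \<in> funs n \<Longrightarrow> act T (p ^ j) x = 0 \<Longrightarrow> k \<le> m \<Longrightarrow> act T (p ^ m) x = 0"
    using tors_uniform[OF finite_funs] by blast
  have "act T (p ^ k) x = 0" if "x \<in> ?V" for x
    using that k[OF _ _ order_refl] unfolding tors_def by blast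
  then obtain l where l: "int_partition l" "htype l ?V"
    using exists_htype[OF T_sub finite_subset[OF tors_subset finite_funs]] by blast
  let ?Z = "cyclic_sum p l"
  obtain h where h: "bij_betw h (carrier ?Z) ?V"
    "\<And>gs gs'. gs \<in> carrier ?Z \<Longrightarrow> gs' \<in> carrier ?Z \<Longrightarrow> h (map2 (+) gs gs') = h gs + h gs'"
    "\<And>f gs. gs \<in> carrier ?Z \<Longrightarrow> h (map2 (\<lambda>k g. (f * g) mod p ^ k) l gs) = act T f (h gs)"
    using htype_iso[OF l(2)] by blast
  define g where "g = inv_into (carrier ?Z) h \<circ> vf n"
  have gbij: "bij_betw g (carrier ?N) (carrier ?Z)"
    unfolding g_def by (rule bij_betw_trans[OF vf_primary_component bij_betw_inv_into[OF h(1)]])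
  have hg: "h (g x) = vf n x" if x: "x \<in> carrier ?N" for x
    unfolding g_def comp_def
    using bij_betw_inv_into_right[OF h(1) bij_betw_apply[OF vf_primary_component x]] .
  have hinj: "a = b" if "a \<in> carrier ?Z" "b \<in> carrier ?Z" "h a = h b" for a b
    using h(1) that unfolding bij_betw_def inj_on_def by blast
  have gmem: "g x \<in> carrier ?Z" if "x \<in> carrier ?N" for x
    using bij_betw_apply[OF gbij that] .
  have carr: "x \<in> carrier_vec n" if "x \<in> carrier ?N" for x
    using that unfolding primary_component_simps by blast
  have V_iff: "x \<in> carrier ?N \<longleftrightarrow> vf n x \<in> ?V" if x: "x \<in> carrier_vec n" for x
  proof
    show "vf n x \<in> ?V" if "x \<in> carrier ?N" using bij_betw_apply[OF vf_primary_component that] .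
    assume "vf n x \<in> ?V"
    then obtain y where y: "y \<in> carrier ?N" "vf n x = vf n y"
      using vf_primary_component[of p] unfolding bij_betw_def by blast
    then show "x \<in> carrier ?N" using vf_inj[OF x carr[OF y(1)] y(2)] by simp
  qed
  have add: "x + y \<in> carrier ?N" if xy: "x \<in> carrier ?N" "y \<in> carrier ?N" for x y
  proof -
    have "vf n (x + y) \<in> ?V"
      unfolding vf_add[OF carr[OF xy(1)] carr[OF xy(2)]]
      using xy V_iff carr by (intro subspace_add[OF T_sub]) blast+
    then show ?thesis using V_iff[OF add_carrier_vec[OF carr[OF xy(1)] carr[OF xy(2)]]] by blast
  qed
  have smult: "poly_act T f x \<in> carrier ?N" if x: "x \<in> carrier ?N" for f x
  proof -
    have "vf n (poly_act T f x) \<in> ?V"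
      unfolding vf_act[OF T carr[OF x]]
      using x V_iff carr by (intro subspace_scale[OF T_sub]) blast
    then show ?thesis using V_iff[OF poly_act_closed[OF T carr[OF x]]] by blast
  qed
  have "g \<in> LinearCombinations.module_hom class_ring ?N ?Z"
    unfolding module_hom_def
  proof (intro CollectI conjI allI impI; (elim conjE)?)
    show "g \<in> carrier ?N \<rightarrow> carrier ?Z" using gmem by blast
  next
    fix x y assume xy: "x \<in> carrier ?N" "y \<in> carrier ?N"
    \<comment> \<open>The laws for \<open>g\<close> are checked after applying \<open>h\<close>,
      which is injective on \<open>cyclic_sum\<close> and turns values of \<open>g\<close> into
      values of \<open>vf\<close>.\<close>
    have "h (g (x + y)) = h (map2 (+) (g x) (g y))"
      unfolding hg[OF add[OF xy]] h(2)[OF gmem[OF xy(1)] gmem[OF xy(2)]] hg[OF xy(1)] hg[OF xy(2)]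
      by (rule vf_add[OF carr[OF xy(1)] carr[OF xy(2)]])
    then have "g (x + y) = map2 (+) (g x) (g y)"
      by (rule hinj[OF gmem[OF add[OF xy]] cyclic_sum_closed(1)[OF gmem[OF xy(1)] gmem[OF xy(2)]]])
    then show "g (x \<oplus>\<^bsub>?N\<^esub> y) = g x \<oplus>\<^bsub>?Z\<^esub> g y"
      by (simp add: primary_component_simps cyclic_sum_def)
  next
    fix f x assume x: "x \<in> carrier ?N"
    have "h (g (poly_act T f x)) = h (map2 (\<lambda>k g. (f * g) mod p ^ k) l (g x))"
      unfolding hg[OF smult[OF x]] h(3)[OF gmem[OF x]] hg[OF x]
      by (rule vf_act[OF T carr[OF x]])
    then have "g (poly_act T f x) = map2 (\<lambda>k g. (f * g) mod p ^ k) l (g x)"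
      by (rule hinj[OF gmem[OF smult[OF x]] cyclic_sum_closed(2)[OF gmem[OF x]]])
    then show "g (f \<odot>\<^bsub>?N\<^esub> x) = f \<odot>\<^bsub>?Z\<^esub> g x"
      by (simp add: primary_component_simps cyclic_sum_def)
  qed
  then have iso: "module_isomorphic class_ring ?N ?Z"
    unfolding module_isomorphic_def using gbij by blast
  have "vf n (0\<^sub>v n) \<in> ?V" using subspace_0[OF T_sub] by (simp only: vf_zero)
  then have zero: "\<zero>\<^bsub>?N\<^esub> \<in> carrier ?N"
    using V_iff[OF zero_carrier_vec] unfolding primary_component_simps(2) by blast
  have "vf n (poly_act T 0 (0\<^sub>v n)) = vf n (0\<^sub>v n)"
    by (simp only: vf_act[OF T zero_carrier_vec] act_0 vf_zero)
  then have "poly_act T 0 (0\<^sub>v n) = 0\<^sub>v n"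
    by (rule vf_inj[OF poly_act_closed[OF T zero_carrier_vec] zero_carrier_vec])
  then have zero': "0 \<odot>\<^bsub>?N\<^esub> \<zero>\<^bsub>?N\<^esub> = \<zero>\<^bsub>?N\<^esub>" by (simp only: primary_component_simps)
  have "primary_partition T p = l"
    unfolding primary_partition_def
  proof (rule the_equality)
    show "int_partition l \<and> module_isomorphic class_ring ?N ?Z" using l(1) iso by blast
    fix l' assume l': "int_partition l' \<and> module_isomorphic class_ring ?N (cyclic_sum p l')"
    show "l' = l"
    proof (rule module_isomorphic_cyclic_sum_unique[OF p _ l(1) zero zero'])
      show "f \<odot>\<^bsub>?N\<^esub> x \<in> carrier ?N" if "x \<in> carrier ?N" for f x
        using smult[OF that] by (simp only: primary_component_simps(4))
    qed (use l' iso in blast)+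
  qed
  then show "htype (primary_partition T p) ?V" "int_partition (primary_partition T p)"
    using l by simp_all
qed

text \<open>The torsion submodule has q^(d |lambda|) elements, and the exponent vanishes only for
  the empty partition because d and all parts are positive.\<close>

lemma primary_partition_eq_Nil:
  assumes p: "irreducible p"
  shows "primary_partition T p = [] \<longleftrightarrow> tors (funs n) p = {0}"
proof -
  interpret primary "act T" p by unfold_locales (rule p)
  let ?l = "primary_partition T p" and ?V = "tors (funs n) p"
  have card: "card ?V = CARD('a) ^ (d * sum_list ?l)"
    by (rule htype_card[OF primary_partition_htype(1)[OF p]])
  have 0: "0 \<in> ?V" by (rule subspace_0[OF subspace_tors[OF subspace_funs]])
  show ?thesis
  proof
    assume "?l = []"
    then have "card ?V = 1" using card by simp
    then show "?V = {0}" using 0 by (auto simp: card_1_singleton_iff)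
  next
    assume "?V = {0}"
    then have "CARD('a) ^ (d * sum_list ?l) = CARD('a) ^ 0" using card by simp
    then have "sum_list ?l = 0" using one_less_card d_pos by simp
    then have "set ?l \<subseteq> {0}" by (auto simp: sum_list_eq_0_iff)
    then show "?l = []"
      using primary_partition_htype(2)[OF p] unfolding int_partition_def by (cases ?l) auto
  qed
qed

text \<open>Different primes with equal degree and partition give repeated pairs in the multiset. So
  the product over the class type is a product over the primes with nonzero torsion, which the
  primary decomposition identifies with the full generating function.\<close>

theorem invariant_gf_similarity_class_type:
  "invariant_gf T = specialize (int CARD('a)) (f_type (similarity_class_type T))"
proof -
  let ?S = "{p. lead_coeff p = 1 \<and> irreducible p \<and> primary_partition T p \<noteq> []}"
  let ?q = "int CARD('a)"
  interpret E: comm_ring_hom "specialize ?q" by (rule comm_ring_hom_specialize)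
  have S: "{p. irreducible p \<and> lead_coeff p = 1 \<and> tors (funs n) p \<noteq> {0}} = ?S"
    using primary_partition_eq_Nil by blast
  have "f_type (similarity_class_type T) =
      (\<Prod>p\<in>?S. subst_pow (degree p) (f_part (primary_partition T p)))"
    by (simp add: f_type_def similarity_class_type_def image_mset.compositionality comp_def
      prod_unfold_prod_mset)
  then have "specialize ?q (f_type (similarity_class_type T)) =
      (\<Prod>p\<in>?S. specialize ?q (subst_pow (degree p) (f_part (primary_partition T p))))"
    by (simp only: E.hom_prod)
  also have "\<dots> = (\<Prod>p\<in>?S. gf (tors (funs n) p))"
  proof (rule prod.cong[OF refl])
    fix p assume "p \<in> ?S"
    then have p: "irreducible p" by blast
    interpret primary "act T" p by unfold_locales (rule p)
    show "specialize ?q (subst_pow (degree p) (f_part (primary_partition T p))) = gf (tors (funs n) p)"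
      unfolding specialize_subst_pow[OF d_pos] by (rule gf_htype[OF primary_partition_htype(1)[OF p], symmetric])
  qed
  also have "\<dots> = gf (funs n)"
    unfolding S[symmetric] by (rule primary_decomposition(2)[OF subspace_funs finite_funs, symmetric])
  finally show ?thesis by (simp only: invariant_gf_eq)
qed

end

theorem theorem2p4:
  fixes T :: "'a::{field,finite} mat" and n :: nat and \<tau> :: "(nat \<times> nat list) multiset"
  assumes "class_type_of_size n \<tau>"
    and "T \<in> carrier_mat n n"
    and "similarity_class_type T = \<tau>"
  shows "invariant_gf T = specialize (int CARD('a)) (f_type \<tau>)
    \<and> (\<forall>j\<le>n. int (num_invariant_subspaces T j) = poly (X_type \<tau> j) (int CARD('a)))"
proof (intro conjI allI impI)
  interpret square_matrix T n by unfold_locales (rule assms(2))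
  show eq: "invariant_gf T = specialize (int CARD('a)) (f_type \<tau>)"
    using invariant_gf_similarity_class_type assms(3) by simp
  fix j assume "j \<le> n"
  then have "int (num_invariant_subspaces T j) = coeff (invariant_gf T) j"
    by (simp add: invariant_gf_def dim_T coeff_sum)
  then show "int (num_invariant_subspaces T j) = poly (X_type \<tau> j) (int CARD('a))"
    by (simp add: eq X_type_def specialize_def coeff_map_poly)
qed

end
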